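(* Let $(G,\mathcal{G})$ be a half-Lie group equipped with a strong $G$-right-invariant Riemannian metric $\mathcal{G}$, and let $L\colon TG\to\mathbb{R}$ be a Tonelli Lagrangian on $(G,\mathcal{G})$. Assume that $G$ is $L^2$-regular and that, for all $p\in G$, the set $$A_p:=\{\xi\in L^2([0,1],T_eG)\mid \operatorname{evol}(\xi)=p\}$$ is weakly closed. Then, for every pair of points $p,q\in G$ and every $\kappa>c(L)$, there exists a global minimizer of $\mathbb{S}_{L+\kappa}$ in $\mathcal{P}(p,q)$, i.e. a path $\gamma\in\mathcal{P}(p,q)$ with $\mathbb{S}_{L+\kappa}(\gamma)=\inf_{\eta\in\mathcal{P}(p,q)}\mathbb{S}_{L+\kappa}(\eta)$.
   Context: Half-Lie groups. A (right) half-Lie group is a topological group endowed with a smooth manifold structure (here modeled on a Banach or Hilbert space) such that right multiplication by any element is smooth; left multiplications are only required to be continuous. The neutral element is $e$; write $\mu_x(y)=xy=\mu^y(x)$ for left and right translations. Metrics. A Riemannian metric $\mathcal{G}$ on $G$ is $G$-right-invariant if $\mathcal{G}_x(T_e\mu^x v,T_e\mu^x w)=\mathcal{G}_e(v,w)$ for all $x\in G$, $v,w\in T_eG$. It is strong if $\mathcal{G}_x$ induces the manifold topology on $T_xG$ for every $x\in G$ (so $G$ is a Hilbert manifold and $T_eG$ a Hilbert space). Regularity. $G$ is $L^2$-regular if for every $X\in L^2_{\mathrm{loc}}(\mathbb{R},T_eG)$ there is a unique solution $g\in W^{1,1}_{\mathrm{loc}}(\mathbb{R},G)$ of $\partial_tg(t)=T_e\mu^{g(t)}X(t)$,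 $g(0)=e$. The solution is denoted $\operatorname{Evol}(X)$ and its value at $t=1$ is $\operatorname{evol}(X)$; for $X\in L^2([0,1],T_eG)$ one extends $X$ by zero. Tonelli Lagrangians. A $C^2$ function $L\colon TG\to\mathbb{R}$ that is $G$-right-invariant (invariant under the tangent maps of right translations) is a Tonelli Lagrangian on $(G,\mathcal{G})$ if there are constants $M\geq m>0$ with $m\|w\|_{\mathcal{G}}^2\leq D_v^2L(e,v)(w,w)\leq M\|w\|_{\mathcal{G}}^2$ for all $v,w\in T_eG$, where $D_v$ denotes the derivative along the fibers of $TG\to G$. Action. For $\gamma\in H^1([0,T],G)$, $T>0$, and $\kappa\in\mathbb{R}$, $\mathbb{S}_{L+\kappa}(\gamma)=\int_0^T\big(L(\gamma(t),\dot\gamma(t))+\kappa\big)\,dt$. Moreover $\mathcal{P}(p,q)=\{\gamma\in H^1([0,T],G)\mid\gamma(0)=p,\ \gamma(T)=q,\ T>0\}$, where $T$ is free. Mañé critical value. $c(L)=-\inf\{\frac1T\int_0^TL(\gamma(t),\dot\gamma(t))\,dt\mid\gamma\in H^1(\mathbb{R}/T\mathbb{Z},G),\ T>0\}$, the infimum being over all closed curves; equivalently the infimum of all $\kappa\in\mathbb{R}$ such that $\mathbb{S}_{L+\kappa}(\gamma)\geq0$ for all closed $H^1$ curves $\gamma$ of arbitrary period $T>0$.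
   Formalization: The points p and q are assumed distinct and in the same connected component of G: for p = q the infimum is 0 and is not attained since T > 0 (constant curves with T → 0), and for points in different components P(p,q) is empty. *)

theory Defs
  imports "HOL-Analysis.Analysis"
begin

section \<open>Maps of class $C^k$ between normed spaces\<close>

text \<open>
  HOL-Analysis has no higher Frechet derivatives in infinite dimensions.  The \<open>j\<close>-th derivative
  at a point is a bounded \<open>j\<close>-linear map, encoded as a function on lists, of which only the values
  on lists of length \<open>j\<close> matter.
\<close>

definition bounded_multilinear :: "nat \<Rightarrow> ('a::real_normed_vector list \<Rightarrow> 'b::real_normed_vector) \<Rightarrow> bool"
  where "bounded_multilinear j F \<longleftrightarrow>
    (\<forall>vs i. length vs = j \<and> i < j \<longrightarrow> linear (\<lambda>v. F (vs[i := v]))) \<and>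
    (\<exists>K. \<forall>vs. length vs = j \<longrightarrow> norm (F vs) \<le> K * (\<Prod>v\<leftarrow>vs. norm v))"

text \<open>
  \<open>Ck_on k S f\<close> is meant for open \<open>S\<close>.  \<open>D j\<close> is the \<open>j\<close>-th derivative of \<open>f\<close>; the third conjunct
  says that \<open>D (Suc j)\<close> is the Frechet derivative of \<open>D j\<close>, and the last one that \<open>D k\<close> is
  continuous, both with respect to the operator norm on \<open>j\<close>-linear, resp. \<open>k\<close>-linear, maps.
\<close>

definition Ck_on :: "nat \<Rightarrow> 'a::real_normed_vector set \<Rightarrow> ('a \<Rightarrow> 'b::real_normed_vector) \<Rightarrow> bool"
  where "Ck_on k S f \<longleftrightarrow> (\<exists>D :: nat \<Rightarrow> 'a \<Rightarrow> 'a list \<Rightarrow> 'b.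
    (\<forall>x\<in>S. D 0 x [] = f x) \<and>
    (\<forall>j\<le>k. \<forall>x\<in>S. bounded_multilinear j (D j x)) \<and>
    (\<forall>j<k. \<forall>x\<in>S. \<forall>\<epsilon>>0. \<forall>\<^sub>F y in at x within S. \<forall>vs. length vs = j \<longrightarrow>
       norm (D j y vs - D j x vs - D (Suc j) x ((y - x) # vs))
         \<le> \<epsilon> * norm (y - x) * (\<Prod>v\<leftarrow>vs. norm v)) \<and>
    (\<forall>x\<in>S. \<forall>\<epsilon>>0. \<forall>\<^sub>F y in at x within S. \<forall>vs. length vs = k \<longrightarrow>
       norm (D k y vs - D k x vs) \<le> \<epsilon> * (\<Prod>v\<leftarrow>vs. norm v)))"

definition smooth_on :: "'a::real_normed_vector set \<Rightarrow> ('a \<Rightarrow> 'b::real_normed_vector) \<Rightarrow> bool"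
  where "smooth_on S f \<longleftrightarrow> (\<forall>k. Ck_on k S f)"


section \<open>Smooth manifolds and their tangent spaces\<close>

text \<open>A chart is a pair of an open domain and a homeomorphism onto an open subset of the model space.\<close>

type_synonym ('g, 'e) chart = "'g set \<times> ('g \<Rightarrow> 'e)"

definition is_chart :: "('g::topological_space, 'e::real_normed_vector) chart \<Rightarrow> bool"
  where "is_chart = (\<lambda>(U, \<phi>). open U \<and> open (\<phi> ` U) \<and> homeomorphism U (\<phi> ` U) \<phi> (inv_into U \<phi>))"

text \<open>\<open>f\<close> is smooth as a partially defined map of the manifold: its local representatives are smooth.\<close>

definition smooth_in_charts ::
    "('g::topological_space, 'e::real_normed_vector) chart set \<Rightarrow> ('g \<Rightarrow> 'g) \<Rightarrow> bool"
  where "smooth_in_charts A f \<longleftrightarrow> (\<forall>(U, \<phi>)\<in>A. \<forall>(V, \<psi>)\<in>A.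
    smooth_on (\<phi> ` (U \<inter> f -` V)) (\<psi> \<circ> f \<circ> inv_into U \<phi>))"

definition smooth_atlas :: "('g::topological_space, 'e::real_normed_vector) chart set \<Rightarrow> bool"
  where "smooth_atlas A \<longleftrightarrow> (\<forall>c\<in>A. is_chart c) \<and> (\<Union>c\<in>A. fst c) = UNIV \<and> smooth_in_charts A id"

text \<open>
  Every point \<open>x\<close> has a preferred chart, and the tangent space at \<open>x\<close> is identified with the model
  space \<open>'e\<close> by the differential at \<open>x\<close> of that chart.  So a tangent vector of the manifold is a pair
  of \<open>x :: 'g\<close> and \<open>v :: 'e\<close>, and functions on the tangent bundle have type \<open>'g \<Rightarrow> 'e \<Rightarrow> _\<close>.  Since the
  preferred chart may jump from point to point, regularity of such functions is expressed by
  \<open>from_chart\<close>, which turns the coordinates of a tangent vector at \<open>x\<close> in an arbitrary chart around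
  \<open>x\<close> into those in the preferred chart.
\<close>

definition chart_at :: "('g, 'e) chart set \<Rightarrow> 'g \<Rightarrow> ('g, 'e) chart"
  where "chart_at A x = (SOME c. c \<in> A \<and> x \<in> fst c)"

definition from_chart :: "('g, 'e::real_normed_vector) chart set \<Rightarrow> ('g, 'e) chart \<Rightarrow> 'g \<Rightarrow> 'e \<Rightarrow> 'e"
  where "from_chart A c x =
    frechet_derivative (snd (chart_at A x) \<circ> inv_into (fst c) (snd c)) (at (snd c x))"

text \<open>The tangent map at \<open>x\<close> of \<open>f\<close>, from the tangent space at \<open>x\<close> to that at \<open>f x\<close>.\<close>

definition tangent_map :: "('g, 'e::real_normed_vector) chart set \<Rightarrow> ('g \<Rightarrow> 'g) \<Rightarrow> 'g \<Rightarrow> 'e \<Rightarrow> 'e"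
  where "tangent_map A f x =
    frechet_derivative
      (snd (chart_at A (f x)) \<circ> f \<circ> inv_into (fst (chart_at A x)) (snd (chart_at A x)))
      (at (snd (chart_at A x) x))"

definition velocity :: "('g, 'e::real_normed_vector) chart set \<Rightarrow> (real \<Rightarrow> 'g) \<Rightarrow> real \<Rightarrow> 'e"
  where "velocity A \<gamma> t = vector_derivative (snd (chart_at A (\<gamma> t)) \<circ> \<gamma>) (at t)"


section \<open>Half-Lie groups, invariant metrics and Lagrangians\<close>

locale half_lie_group = group mul e iv
  for mul :: "'g::t2_space \<Rightarrow> 'g \<Rightarrow> 'g" (infixl \<open>\<odot>\<close> 70)
    and e :: 'g
    and iv :: "'g \<Rightarrow> 'g" +
  fixes A :: "('g, 'e::real_normed_vector) chart set"
  assumes continuous_mult: "continuous_on UNIV (\<lambda>(x, y). x \<odot> y)"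
    and continuous_inv: "continuous_on UNIV iv"
    and smooth_atlas: "smooth_atlas A"
    and smooth_right_mult: "smooth_in_charts A (\<lambda>x. x \<odot> y)"

text \<open>
  In the third conjunct, smoothness of the metric is smoothness of \<open>(x, v, w) \<mapsto> \<G> x v w\<close> on the
  double tangent bundle $TG \oplus TG$.
\<close>

definition riemannian_metric ::
    "('g, 'e::real_normed_vector) chart set \<Rightarrow> ('g \<Rightarrow> 'e \<Rightarrow> 'e \<Rightarrow> real) \<Rightarrow> bool"
  where "riemannian_metric A \<G> \<longleftrightarrow>
    (\<forall>x. bilinear (\<G> x) \<and> (\<forall>v w. \<G> x v w = \<G> x w v)) \<and>
    (\<forall>x v. v \<noteq> 0 \<longrightarrow> \<G> x v v > 0) \<and>
    (\<forall>(U, \<phi>)\<in>A. smooth_on (\<phi> ` U \<times> UNIV \<times> UNIV) (\<lambda>(y, v, w).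
       let x = inv_into U \<phi> y in \<G> x (from_chart A (U, \<phi>) x v) (from_chart A (U, \<phi>) x w)))"

text \<open>The topology of every tangent space is the one given by the norm of the metric.\<close>

definition strong_metric :: "('g \<Rightarrow> 'e::real_normed_vector \<Rightarrow> 'e \<Rightarrow> real) \<Rightarrow> bool"
  where "strong_metric \<G> \<longleftrightarrow>
    (\<forall>x S. open S \<longleftrightarrow> (\<forall>v\<in>S. \<exists>\<epsilon>>0. \<forall>w. sqrt (\<G> x (w - v) (w - v)) < \<epsilon> \<longrightarrow> w \<in> S))"

definition right_invariant_metric ::
    "('g \<Rightarrow> 'g \<Rightarrow> 'g) \<Rightarrow> 'g \<Rightarrow> ('g, 'e::real_normed_vector) chart set
      \<Rightarrow> ('g \<Rightarrow> 'e \<Rightarrow> 'e \<Rightarrow> real) \<Rightarrow> bool"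
  where "right_invariant_metric mul e A \<G> \<longleftrightarrow> (\<forall>x v w.
    \<G> x (tangent_map A (\<lambda>z. mul z x) e v) (tangent_map A (\<lambda>z. mul z x) e w) = \<G> e v w)"

definition C2_lagrangian ::
    "('g, 'e::real_normed_vector) chart set \<Rightarrow> ('g \<Rightarrow> 'e \<Rightarrow> real) \<Rightarrow> bool"
  where "C2_lagrangian A L \<longleftrightarrow> (\<forall>(U, \<phi>)\<in>A.
    Ck_on 2 (\<phi> ` U \<times> UNIV) (\<lambda>(y, v). let x = inv_into U \<phi> y in L x (from_chart A (U, \<phi>) x v)))"

definition right_invariant_lagrangian ::
    "('g \<Rightarrow> 'g \<Rightarrow> 'g) \<Rightarrow> ('g, 'e::real_normed_vector) chart set \<Rightarrow> ('g \<Rightarrow> 'e \<Rightarrow> real) \<Rightarrow> bool"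
  where "right_invariant_lagrangian mul A L \<longleftrightarrow>
    (\<forall>x y v. L (mul x y) (tangent_map A (\<lambda>z. mul z y) x v) = L x v)"

text \<open>\<open>D\<^sup>2f(v)(w,w)\<close>, for \<open>f\<close> of class \<open>C\<^sup>2\<close>.\<close>

definition second_derivative :: "('e::real_normed_vector \<Rightarrow> real) \<Rightarrow> 'e \<Rightarrow> 'e \<Rightarrow> real"
  where "second_derivative f v w =
    frechet_derivative (\<lambda>u. frechet_derivative f (at u) w) (at v) w"

definition tonelli_lagrangian ::
    "('g \<Rightarrow> 'g \<Rightarrow> 'g) \<Rightarrow> 'g \<Rightarrow> ('g, 'e::real_normed_vector) chart set
      \<Rightarrow> ('g \<Rightarrow> 'e \<Rightarrow> 'e \<Rightarrow> real) \<Rightarrow> ('g \<Rightarrow> 'e \<Rightarrow> real) \<Rightarrow> bool"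
  where "tonelli_lagrangian mul e A \<G> L \<longleftrightarrow>
    C2_lagrangian A L \<and> right_invariant_lagrangian mul A L \<and>
    (\<exists>m M. 0 < m \<and> m \<le> M \<and> (\<forall>v w.
       m * \<G> e w w \<le> second_derivative (L e) v w \<and>
       second_derivative (L e) v w \<le> M * \<G> e w w))"


section \<open>Lebesgue and Sobolev spaces of curves\<close>

text \<open>
  The model space need not be separable, so Bochner measurability is stronger than Borel
  measurability.
\<close>

definition strongly_measurable :: "'a measure \<Rightarrow> ('a \<Rightarrow> 'b::real_normed_vector) \<Rightarrow> bool"
  where "strongly_measurable M f \<longleftrightarrow>
    (\<exists>s. (\<forall>n::nat. simple_function M (s n)) \<and> (AE x in M. (\<lambda>n. s n x) \<longlonglongrightarrow> f x))"

text \<open>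
  Elements of \<open>L\<^sup>p([a,b], E)\<close> are represented by functions on \<open>\<real>\<close>, not identified when they agree
  almost everywhere.  The norm of the model space is used; for a strong metric \<open>\<G>\<close>, the norm of \<open>\<G>\<close>
  at the neutral element gives the same spaces with the same topologies.
\<close>

definition Lp :: "nat \<Rightarrow> real \<Rightarrow> real \<Rightarrow> (real \<Rightarrow> 'e::real_normed_vector) set"
  where "Lp p a b = {f. strongly_measurable (lebesgue_on {a..b}) f \<and>
    integrable (lebesgue_on {a..b}) (\<lambda>t. norm (f t) ^ p)}"

text \<open>
  \<open>W\<^sup>1\<^sup>,\<^sup>p([a,b], E)\<close>: the absolutely continuous functions (continuous representatives) that are
  almost everywhere differentiable, with derivative in \<open>L\<^sup>p\<close>, and are primitives of their derivative.
  For functions in \<open>L\<^sup>p\<close>, \<open>p \<ge> 1\<close>, the Henstock-Kurzweil integral is the Bochner integral, whose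
  library version is restricted to second countable spaces.
\<close>

definition W1p :: "nat \<Rightarrow> real \<Rightarrow> real \<Rightarrow> (real \<Rightarrow> 'e::real_normed_vector) set"
  where "W1p p a b = {f. (AE t in lebesgue_on {a..b}. f differentiable (at t)) \<and>
    (\<lambda>t. vector_derivative f (at t)) \<in> Lp p a b \<and>
    (\<forall>s t. a \<le> s \<and> s \<le> t \<and> t \<le> b \<longrightarrow>
       ((\<lambda>r. vector_derivative f (at r)) has_integral (f t - f s)) {s..t})}"

text \<open>
  Curves of class \<open>W\<^sup>1\<^sup>,\<^sup>p\<^bsub>loc\<^esub>\<close> on an interval \<open>I\<close>; for compact \<open>I\<close> the subscript is void.
\<close>

definition W1p_curve ::
    "nat \<Rightarrow> ('g::topological_space, 'e::real_normed_vector) chart set \<Rightarrow> real set \<Rightarrow> (real \<Rightarrow> 'g) \<Rightarrow> bool"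
  where "W1p_curve p A I \<gamma> \<longleftrightarrow> continuous_on I \<gamma> \<and>
    (\<forall>(U, \<phi>)\<in>A. \<forall>a b. a \<le> b \<and> {a..b} \<subseteq> I \<and> \<gamma> ` {a..b} \<subseteq> U \<longrightarrow> \<phi> \<circ> \<gamma> \<in> W1p p a b)"

abbreviation H1_curve ::
    "('g::topological_space, 'e::real_normed_vector) chart set \<Rightarrow> real \<Rightarrow> (real \<Rightarrow> 'g) \<Rightarrow> bool"
  where "H1_curve A T \<gamma> \<equiv> W1p_curve 2 A {0..T} \<gamma>"


section \<open>Regularity and the evolution map\<close>

definition evolution ::
    "('g::topological_space \<Rightarrow> 'g \<Rightarrow> 'g) \<Rightarrow> 'g \<Rightarrow> ('g, 'e::real_normed_vector) chart set
      \<Rightarrow> (real \<Rightarrow> 'e) \<Rightarrow> (real \<Rightarrow> 'g) \<Rightarrow> bool"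
  where "evolution mul e A X g \<longleftrightarrow> W1p_curve 1 A UNIV g \<and> g 0 = e \<and>
    (AE t in lebesgue. velocity A g t = tangent_map A (\<lambda>z. mul z (g t)) e (X t))"

definition L2_regular ::
    "('g::topological_space \<Rightarrow> 'g \<Rightarrow> 'g) \<Rightarrow> 'g \<Rightarrow> ('g, 'e::real_normed_vector) chart set \<Rightarrow> bool"
  where "L2_regular mul e A \<longleftrightarrow>
    (\<forall>X. (\<forall>a b. X \<in> Lp 2 a b) \<longrightarrow> (\<exists>!g. evolution mul e A X g))"

definition Evol ::
    "('g::topological_space \<Rightarrow> 'g \<Rightarrow> 'g) \<Rightarrow> 'g \<Rightarrow> ('g, 'e::real_normed_vector) chart set
      \<Rightarrow> (real \<Rightarrow> 'e) \<Rightarrow> real \<Rightarrow> 'g"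
  where "Evol mul e A X = (THE g. evolution mul e A X g)"

definition evol ::
    "('g::topological_space \<Rightarrow> 'g \<Rightarrow> 'g) \<Rightarrow> 'g \<Rightarrow> ('g, 'e::real_normed_vector) chart set
      \<Rightarrow> (real \<Rightarrow> 'e) \<Rightarrow> 'g"
  where "evol mul e A \<xi> = Evol mul e A (\<lambda>t. if t \<in> {0..1} then \<xi> t else 0) 1"


section \<open>The weak topology of \<open>L\<^sup>2([0,1], E)\<close>\<close>

definition L2_norm :: "(real \<Rightarrow> 'e::real_normed_vector) \<Rightarrow> real"
  where "L2_norm f = sqrt (integral\<^sup>L (lebesgue_on {0..1}) (\<lambda>t. (norm (f t))\<^sup>2))"

definition L2_dual :: "((real \<Rightarrow> 'e::real_normed_vector) \<Rightarrow> real) set"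
  where "L2_dual = {F.
    (\<forall>f\<in>Lp 2 0 1. \<forall>g\<in>Lp 2 0 1. F (\<lambda>t. f t + g t) = F f + F g) \<and>
    (\<forall>f\<in>Lp 2 0 1. \<forall>r. F (\<lambda>t. r *\<^sub>R f t) = r * F f) \<and>
    (\<exists>K. \<forall>f\<in>Lp 2 0 1. \<bar>F f\<bar> \<le> K * L2_norm f)}"

text \<open>
  As every functional in \<open>L2_dual\<close> is constant on classes of functions agreeing almost everywhere,
  this is the pullback of the weak topology of the quotient.
\<close>

definition L2_weak_topology :: "(real \<Rightarrow> 'e::real_normed_vector) topology"
  where "L2_weak_topology =
    topology_generated_by {{f \<in> Lp 2 0 1. F f \<in> V} | F V. F \<in> L2_dual \<and> open V}"


section \<open>Action and critical value\<close>

definition action ::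
    "('g, 'e::real_normed_vector) chart set \<Rightarrow> ('g \<Rightarrow> 'e \<Rightarrow> real) \<Rightarrow> real \<Rightarrow> (real \<Rightarrow> 'g) \<Rightarrow> real"
  where "action A L T \<gamma> = integral\<^sup>L (lebesgue_on {0..T}) (\<lambda>t. L (\<gamma> t) (velocity A \<gamma> t))"

definition paths ::
    "('g::topological_space, 'e::real_normed_vector) chart set \<Rightarrow> 'g \<Rightarrow> 'g \<Rightarrow> (real \<times> (real \<Rightarrow> 'g)) set"
  where "paths A p q = {(T, \<gamma>). 0 < T \<and> H1_curve A T \<gamma> \<and> \<gamma> 0 = p \<and> \<gamma> T = q}"

text \<open>
  Curves on \<open>\<real>/T\<int>\<close> are curves on \<open>[0,T]\<close> with equal end points.  Infima are taken in the extended
  reals, so that no boundedness is presupposed.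
\<close>

definition mane_critical_value ::
    "('g::topological_space, 'e::real_normed_vector) chart set \<Rightarrow> ('g \<Rightarrow> 'e \<Rightarrow> real) \<Rightarrow> ereal"
  where "mane_critical_value A L =
    - (INF (T, \<gamma>)\<in>{(T, \<gamma>). 0 < T \<and> H1_curve A T \<gamma> \<and> \<gamma> 0 = \<gamma> T}. ereal (1 / T * action A L T \<gamma>))"

end

theory Submission
  imports Defs "HOL-Library.Diagonal_Subsequence"
begin

text \<open>
  Right translations preserve both the metric and the Lagrangian.  So the velocity of a path can be
  moved to the neutral element: a path \<open>\<gamma>\<close> from \<open>p\<close> to \<open>q\<close> is described by its right logarithmic
  derivative \<open>rlog \<gamma>\<close>, a curve in the fixed Hilbert space $T_eG$, and its action only involves the
  function \<open>f = L e + \<kappa>\<close> on that space (\<open>velocity_eq_rlog\<close>, \<open>action_rlog\<close>).  Conversely, by regularity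
  every square integrable \<open>\<xi>\<close> is the logarithmic derivative of a path.  After rescaling to the unit
  interval, paths from \<open>p\<close> to \<open>q\<close> correspond to pairs of a duration \<open>T > 0\<close> and a curve \<open>\<xi>\<close> with
  \<open>evol \<xi> = q \<odot> iv p\<close>, and the action becomes $T\int_0^1 f(\xi(t)/T)\,dt$ (\<open>action_log_path\<close>,
  \<open>evol_log_path\<close>, \<open>path_from_L2\<close>).  It remains to minimize this functional over all \<open>T\<close> and over a
  weakly closed set of curves (\<open>scaled_action_minimizer\<close>).

  The Tonelli condition makes \<open>f\<close> convex with quadratic growth (\<open>tonelli_fibre\<close>).  Consider a minimizing
  sequence.  Since \<open>\<kappa>\<close> exceeds the critical value, closing a path by a fixed path from \<open>q\<close> back to \<open>p\<close>
  shows that the action grows at least linearly with the duration; so the durations are bounded, and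
  then the norms of the curves \<open>\<xi>\<close> are bounded as well.  Short durations would force these norms to be
  small, but \<open>p \<noteq> q\<close> excludes the zero curve from the weakly closed set and therefore a neighbourhood
  of it; so the durations are also bounded away from zero.  Hence a subsequence converges weakly, and
  it can be chosen such that its Cesaro means converge strongly (\<open>L2_weak_Banach_Saks\<close>).  The
  perspective $(T, v) \mapsto T f(v/T)$ is jointly convex (\<open>convex_perspective_sum\<close>), so the averaged
  durations and curves are again minimizing, and Fatou's lemma shows that the weak limit, which
  satisfies the constraint by weak closedness, is a minimizer.

  On a half-Lie group the left translations are merely continuous, so the tangent map of the right
  translation by \<open>x\<close> is not known to depend continuously on \<open>x\<close>.  Two facts make up for this.  The
  logarithmic derivative is the limit of difference quotients that only involve the group operations,
  and is thus strongly measurable (\<open>rlog_strongly_measurable\<close>).  Its length is the length of the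
  velocity in the invariant metric, which is locally comparable to the norm in a chart
  (\<open>rlog_norm_locally_equivalent\<close>), because a bilinear form is its own second derivative at zero and
  second derivatives depend continuously on the point in the operator norm (\<open>C2_bilinear_form\<close>).

  The functions of class $W^{1,p}$ are handled through a fundamental theorem of calculus for absolutely
  continuous functions that are differentiable almost everywhere, which is proved from Henstock's
  lemma (\<open>FTC_absolutely_continuous\<close>).
\<close>

section \<open>Strong measurability\<close>

lemma AE_lebesgue_on_iff_negligible:
  assumes "S \<in> sets lebesgue"
  shows "(AE x in lebesgue_on S. P x) \<longleftrightarrow> negligible {x \<in> S. \<not> P x}"
proof -
  have "(AE x in lebesgue_on S. P x) \<longleftrightarrow> (AE x in lebesgue. x \<in> S \<longrightarrow> P x)"
    using assms by (subst AE_restrict_space_iff) auto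
  also have "\<dots> \<longleftrightarrow> {x \<in> S. \<not> P x} \<in> null_sets lebesgue"
    by (subst completion.AE_iff_null_sets) (simp add: conj_commute)
  finally show ?thesis by (simp add: negligible_iff_null_sets)
qed

lemma complete_measure_lebesgue_on:
  assumes "S \<in> sets lebesgue" shows "complete_measure (lebesgue_on S)"
proof
  fix A B assume BA: "B \<subseteq> A" and A: "A \<in> null_sets (lebesgue_on S)"
  then have "A \<in> null_sets lebesgue" "A \<subseteq> S"
    using assms by (auto simp: null_sets_restrict_space)
  then have "B \<in> null_sets lebesgue" "B \<subseteq> S"
    using BA completion.complete2 by blast+
  then show "B \<in> sets (lebesgue_on S)"
    using assms by (auto simp: sets_restrict_space_iff)
qed

lemma measurable_cong_AE_complete:
  assumes "complete_measure M" "f \<in> borel_measurable M" "AE x in M. f x = g x"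
  shows "g \<in> borel_measurable M"
proof (rule measurableI)
  fix B :: "'b set" assume "B \<in> sets borel"
  then have "f -` B \<inter> space M \<in> sets M" using assms(2) by (rule measurable_sets[rotated])
  then show "g -` B \<inter> space M \<in> sets M"
  proof (rule complete_measure.in_sets_AE[OF assms(1), rotated])
    show "AE x in M. x \<in> f -` B \<inter> space M \<longleftrightarrow> x \<in> g -` B \<inter> space M"
      using assms(3) by eventually_elim simp
  qed simp
qed auto

lemma borel_measurable_AE_LIMSEQ:
  fixes g :: "'a \<Rightarrow> real"
  assumes "complete_measure M" "\<And>n. f n \<in> borel_measurable M" "AE x in M. (\<lambda>n. f n x) \<longlonglongrightarrow> g x"
  shows "g \<in> borel_measurable M"
proof (rule measurable_cong_AE_complete[OF assms(1)])
  show "(\<lambda>x. lim (\<lambda>n. f n x)) \<in> borel_measurable M" using assms(2) by measurable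
  show "AE x in M. lim (\<lambda>n. f n x) = g x" using assms(3) by eventually_elim (rule limI)
qed

lemma strongly_measurable_norm_diff:
  assumes "complete_measure M" "strongly_measurable M f"
  shows "(\<lambda>x. norm (f x - v)) \<in> borel_measurable M"
proof -
  obtain s where s: "\<And>n::nat. simple_function M (s n)" "AE x in M. (\<lambda>n. s n x) \<longlonglongrightarrow> f x"
    using assms(2) by (auto simp: strongly_measurable_def)
  show ?thesis
  proof (rule borel_measurable_AE_LIMSEQ[OF assms(1)])
    show "(\<lambda>x. norm (s n x - v)) \<in> borel_measurable M" for n
      by (rule borel_measurable_simple_function) (rule simple_function_compose1[OF s(1)])
    show "AE x in M. (\<lambda>n. norm (s n x - v)) \<longlonglongrightarrow> norm (f x - v)"
      using s(2) by eventually_elim (intro tendsto_intros)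
  qed
qed

lemmas strongly_measurable_norm = strongly_measurable_norm_diff[where v=0, simplified]

lemma strongly_measurable_separable:
  fixes f :: "'a \<Rightarrow> 'b::real_normed_vector"
  assumes "strongly_measurable M f"
  obtains d :: "nat \<Rightarrow> 'b" where "AE x in M. f x \<in> closure (range d)"
proof -
  obtain s where s: "\<And>n::nat. simple_function M (s n)" "AE x in M. (\<lambda>n. s n x) \<longlonglongrightarrow> f x"
    using assms by (auto simp: strongly_measurable_def)
  define C where "C = insert 0 (\<Union>n. s n ` space M)"
  have "countable C"
    unfolding C_def using s(1) by (intro countable_insert countable_UN) (auto simp: simple_functionD(1) countable_finite)
  then have r: "range (from_nat_into C) = C" by (intro range_from_nat_into) (auto simp: C_def)
  have "AE x in M. f x \<in> closure (range (from_nat_into C))"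
    using s(2) AE_space
  proof eventually_elim
    case (elim x)
    have "\<forall>n. s n x \<in> C" using elim by (auto simp: C_def)
    then show ?case unfolding r closure_sequential using elim by (intro exI[of _ "\<lambda>n. s n x"]) auto
  qed
  then show ?thesis by (rule that)
qed

text \<open>
  Pettis' criterion in the form needed here: a nearest point among the first \<open>n\<close> points of a dense
  sequence is a simple approximation.
\<close>

lemma strongly_measurableI_separable:
  fixes f :: "'a \<Rightarrow> 'b::real_normed_vector" and d :: "nat \<Rightarrow> 'b"
  assumes sep: "AE x in M. f x \<in> closure (range d)"
    and meas: "\<And>n. (\<lambda>x. norm (f x - d n)) \<in> borel_measurable M"
  shows "strongly_measurable M f"
proof -
  define P where "P n x i \<longleftrightarrow> i \<le> n \<and> (\<forall>j\<in>{..n}. norm (f x - d i) \<le> norm (f x - d j))" for n x i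
  define idx where "idx n x = (LEAST i. P n x i)" for n x
  have ex: "\<exists>i. P n x i" for n x
  proof -
    have "\<exists>i\<in>{..n}. \<forall>j\<in>{..n}. norm (f x - d i) \<le> norm (f x - d j)"
      using ex_is_arg_min_if_finite[of "{..n}" "\<lambda>i. norm (f x - d i)"]
      by (auto simp: is_arg_min_linorder)
    then show ?thesis by (auto simp: P_def)
  qed
  have P: "P n x (idx n x)" for n x unfolding idx_def using ex by (rule LeastI_ex)
  have "simple_function M (\<lambda>x. d (idx n x))" for n
  proof (rule simple_function_compose1[where f="idx n" and g=d])
    note meas[measurable]
    have "idx n \<in> measurable M (count_space UNIV)"
      unfolding idx_def P_def by measurable
    moreover have "idx n ` space M \<subseteq> {..n}" using P by (auto simp: P_def)
    ultimately show "simple_function M (idx n)"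
      by (simp add: simple_function_eq_measurable finite_subset)
  qed
  moreover have "AE x in M. (\<lambda>n. d (idx n x)) \<longlonglongrightarrow> f x"
    using sep
  proof eventually_elim
    case (elim x)
    show ?case
    proof (rule LIMSEQ_I)
      fix r :: real assume "0 < r"
      then obtain i where i: "dist (d i) (f x) < r"
        using elim by (auto simp: closure_approachable)
      have "norm (d (idx n x) - f x) < r" if "n \<ge> i" for n
        using P[of n x] that i by (force simp: P_def dist_norm norm_minus_commute)
      then show "\<exists>no. \<forall>n\<ge>no. norm (d (idx n x) - f x) < r" by blast
    qed
  qed
  ultimately show ?thesis unfolding strongly_measurable_def by (intro exI[of _ "\<lambda>n x. d (idx n x)"]) auto
qed

text \<open>
  Dense sequences for the ranges of all \<open>f n\<close>, merged into one sequence, serve the limit.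
\<close>

lemma strongly_measurable_AE_LIMSEQ:
  fixes g :: "'a \<Rightarrow> 'b::real_normed_vector"
  assumes M: "complete_measure M" and f: "\<And>n::nat. strongly_measurable M (f n)"
    and lim: "AE x in M. (\<lambda>n. f n x) \<longlonglongrightarrow> g x"
  shows "strongly_measurable M g"
proof -
  have "\<exists>d::nat \<Rightarrow> 'b. AE x in M. f n x \<in> closure (range d)" for n
    using strongly_measurable_separable[OF f] by metis
  then obtain d :: "nat \<Rightarrow> nat \<Rightarrow> 'b" where d: "\<And>n. AE x in M. f n x \<in> closure (range (d n))"
    by metis
  define D where "D k = (case prod_decode k of (n, i) \<Rightarrow> d n i)" for k
  have "range (d n) \<subseteq> range D" for n
  proof
    fix y assume "y \<in> range (d n)"
    then obtain i where "y = d n i" by auto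
    then have "y = D (prod_encode (n, i))" by (simp add: D_def)
    then show "y \<in> range D" by simp
  qed
  then have cl: "closure (range (d n)) \<subseteq> closure (range D)" for n by (rule closure_mono)
  show ?thesis
  proof (rule strongly_measurableI_separable[where d=D])
    have "AE x in M. \<forall>n. f n x \<in> closure (range (d n))" using d by (simp add: AE_all_countable)
    then show "AE x in M. g x \<in> closure (range D)"
      using lim
    proof eventually_elim
      case (elim x)
      then show ?case using cl by (intro closed_sequentially[OF closed_closure _ elim(2)]) auto
    qed
    show "(\<lambda>x. norm (g x - D n)) \<in> borel_measurable M" for n
    proof (rule borel_measurable_AE_LIMSEQ[OF M strongly_measurable_norm_diff[OF M f]])
      show "AE x in M. (\<lambda>k. norm (f k x - D n)) \<longlonglongrightarrow> norm (g x - D n)"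
        using lim by eventually_elim (intro tendsto_intros)
    qed
  qed
qed

lemma strongly_measurable_cong_AE:
  assumes "AE x in M. f x = g x" "strongly_measurable M f"
  shows "strongly_measurable M g"
proof -
  obtain s where s: "\<And>n::nat. simple_function M (s n)" "AE x in M. (\<lambda>n. s n x) \<longlonglongrightarrow> f x"
    using assms(2) by (auto simp: strongly_measurable_def)
  have "AE x in M. (\<lambda>n. s n x) \<longlonglongrightarrow> g x"
    using s(2) assms(1) by eventually_elim simp
  then show ?thesis using s(1) by (auto simp: strongly_measurable_def)
qed

lemma strongly_measurable_compose2:
  assumes "strongly_measurable M f" "strongly_measurable M g"
    and h: "\<And>u v a b. u \<longlonglongrightarrow> a \<Longrightarrow> v \<longlonglongrightarrow> b \<Longrightarrow> (\<lambda>n::nat. h (u n) (v n)) \<longlonglongrightarrow> h a b"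
  shows "strongly_measurable M (\<lambda>x. h (f x) (g x))"
proof -
  obtain s where s: "\<And>n::nat. simple_function M (s n)" "AE x in M. (\<lambda>n. s n x) \<longlonglongrightarrow> f x"
    using assms(1) by (auto simp: strongly_measurable_def)
  obtain s' where s': "\<And>n::nat. simple_function M (s' n)" "AE x in M. (\<lambda>n. s' n x) \<longlonglongrightarrow> g x"
    using assms(2) by (auto simp: strongly_measurable_def)
  have "AE x in M. (\<lambda>n. h (s n x) (s' n x)) \<longlonglongrightarrow> h (f x) (g x)"
    using s(2) s'(2) by eventually_elim (rule h)
  moreover have "simple_function M (\<lambda>x. h (s n x) (s' n x))" for n
    using s(1) s'(1) by (rule simple_function_compose2)
  ultimately show ?thesis unfolding strongly_measurable_def by (intro exI[of _ "\<lambda>n x. h (s n x) (s' n x)"]) auto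
qed

lemma strongly_measurable_const [simp]: "strongly_measurable M (\<lambda>x. c)"
  unfolding strongly_measurable_def by (intro exI[of _ "\<lambda>n x. c"]) auto

lemma strongly_measurable_compose:
  assumes "strongly_measurable M f" "\<And>u a. u \<longlonglongrightarrow> a \<Longrightarrow> (\<lambda>n::nat. h (u n)) \<longlonglongrightarrow> h a"
  shows "strongly_measurable M (\<lambda>x. h (f x))"
  using strongly_measurable_compose2[of M f "\<lambda>x. 0::real" "\<lambda>x y. h x"] assms by simp

lemma strongly_measurable_add:
  "strongly_measurable M f \<Longrightarrow> strongly_measurable M g \<Longrightarrow> strongly_measurable M (\<lambda>x. f x + g x)"
  by (rule strongly_measurable_compose2) (auto intro: tendsto_add)

lemma strongly_measurable_scaleR:
  "strongly_measurable M f \<Longrightarrow> strongly_measurable M (\<lambda>x. c *\<^sub>R f x)"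
  by (rule strongly_measurable_compose) (auto intro: tendsto_intros)

lemma strongly_measurable_inner:
  "strongly_measurable M f \<Longrightarrow> strongly_measurable M g \<Longrightarrow> strongly_measurable M (\<lambda>x. f x \<bullet> g x)"
  by (rule strongly_measurable_compose2) (auto intro: tendsto_inner)

lemma strongly_measurable_real:
  fixes f :: "'a \<Rightarrow> real"
  assumes "complete_measure M" "strongly_measurable M f"
  shows "f \<in> borel_measurable M"
proof -
  obtain s where s: "\<And>n::nat. simple_function M (s n)" "AE x in M. (\<lambda>n. s n x) \<longlonglongrightarrow> f x"
    using assms(2) by (auto simp: strongly_measurable_def)
  show ?thesis
    by (rule borel_measurable_AE_LIMSEQ[OF assms(1) borel_measurable_simple_function[OF s(1)] s(2)])
qed

text \<open>
  The image of a countable dense set of parameters is dense in the range.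
\<close>

lemma strongly_measurable_continuous_on:
  fixes f :: "real \<Rightarrow> 'b::real_normed_vector"
  assumes f: "continuous_on {a..b} f"
  shows "strongly_measurable (lebesgue_on {a..b}) f"
proof (cases "a \<le> b")
  case True
  obtain T where T: "countable T" "T \<subseteq> {a..b}" "{a..b} \<subseteq> closure T"
    using separable[of "{a..b}"] by metis
  with True have ne: "T \<noteq> {}" by auto
  define d where "d n = f (from_nat_into T n)" for n
  have r: "range d = f ` T"
    using range_from_nat_into[OF ne T(1)] unfolding d_def by (metis image_image)
  show ?thesis
  proof (rule strongly_measurableI_separable[where d=d])
    have "f x \<in> closure (f ` T)" if "x \<in> {a..b}" for x
    proof -
      have "x \<in> closure T" using T that by auto
      then obtain u where u: "\<And>n. u n \<in> T" "u \<longlonglongrightarrow> x" by (auto simp: closure_sequential)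
      then have "(\<lambda>n. f (u n)) \<longlonglongrightarrow> f x"
        using f T(2) that unfolding continuous_on_sequentially o_def by (meson subsetD)
      then show ?thesis using u(1) by (auto simp: closure_sequential intro!: exI[of _ "\<lambda>n. f (u n)"])
    qed
    then show "AE x in lebesgue_on {a..b}. f x \<in> closure (range d)"
      unfolding r by (intro AE_I2) auto
    show "(\<lambda>x. norm (f x - d n)) \<in> borel_measurable (lebesgue_on {a..b})" for n
      by (intro continuous_imp_measurable_on_sets_lebesgue continuous_intros f) auto
  qed
next
  case False
  then have "space (lebesgue_on {a..b}) = {}" by simp
  then show ?thesis
    by (intro strongly_measurable_cong_AE[OF _ strongly_measurable_const[of _ 0]] AE_I2) auto
qed

lemma strongly_measurable_combine:
  fixes f :: "real \<Rightarrow> 'b::real_normed_vector"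
  assumes f: "strongly_measurable (lebesgue_on {a..b}) f" "strongly_measurable (lebesgue_on {b..c}) f"
    and ab: "a \<le> b" "b \<le> c"
  shows "strongly_measurable (lebesgue_on {a..c}) f"
proof -
  obtain s where s: "\<And>n::nat. simple_function (lebesgue_on {a..b}) (s n)" "AE x in lebesgue_on {a..b}. (\<lambda>n. s n x) \<longlonglongrightarrow> f x"
    using f(1) by (auto simp: strongly_measurable_def)
  obtain s' where s': "\<And>n::nat. simple_function (lebesgue_on {b..c}) (s' n)" "AE x in lebesgue_on {b..c}. (\<lambda>n. s' n x) \<longlonglongrightarrow> f x"
    using f(2) by (auto simp: strongly_measurable_def)
  define r where "r n x = (if x \<le> b then s n x else s' n x)" for n x
  have "simple_function (lebesgue_on {a..c}) (r n)" for n
    unfolding simple_function_def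
  proof safe
    have "r n ` {a..c} \<subseteq> s n ` {a..b} \<union> s' n ` {b..c}" by (auto simp: r_def)
    then show "finite (r n ` space (lebesgue_on {a..c}))"
      using s(1)[of n] s'(1)[of n] by (auto simp: simple_function_def intro: finite_subset)
    fix x
    have 1: "(s n -` {y} \<inter> {a..b}) \<in> sets lebesgue" for y
      using simple_functionD(2)[OF s(1), of n "{y}"] by (auto simp: sets_restrict_space_iff)
    have 2: "(s' n -` {y} \<inter> {b..c}) \<in> sets lebesgue" for y
      using simple_functionD(2)[OF s'(1), of n "{y}"] by (auto simp: sets_restrict_space_iff)
    have eq: "r n -` {y} \<inter> {a..c} = (s n -` {y} \<inter> {a..b}) \<union> ((s' n -` {y} \<inter> {b..c}) - {b})" for y
      using ab by (auto simp: r_def split: if_splits)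
    have "r n -` {y} \<inter> {a..c} \<in> sets lebesgue" for y
      unfolding eq by (intro sets.Un sets.Diff 1 2) auto
    then show "r n -` {r n x} \<inter> space (lebesgue_on {a..c}) \<in> sets (lebesgue_on {a..c})"
      by (simp add: sets_restrict_space_iff)
  qed
  moreover have "AE x in lebesgue_on {a..c}. (\<lambda>n. r n x) \<longlonglongrightarrow> f x"
  proof -
    have "{x \<in> {a..c}. \<not> (\<lambda>n. r n x) \<longlonglongrightarrow> f x}
        \<subseteq> {x \<in> {a..b}. \<not> (\<lambda>n. s n x) \<longlonglongrightarrow> f x} \<union> {x \<in> {b..c}. \<not> (\<lambda>n. s' n x) \<longlonglongrightarrow> f x}"
    proof
      fix x assume x: "x \<in> {x \<in> {a..c}. \<not> (\<lambda>n. r n x) \<longlonglongrightarrow> f x}"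
      show "x \<in> {x \<in> {a..b}. \<not> (\<lambda>n. s n x) \<longlonglongrightarrow> f x} \<union> {x \<in> {b..c}. \<not> (\<lambda>n. s' n x) \<longlonglongrightarrow> f x}"
      proof (cases "x \<le> b")
        case True
        then have "(\<lambda>n. r n x) = (\<lambda>n. s n x)" by (simp add: r_def)
        then show ?thesis using x True by auto
      next
        case False
        then have "(\<lambda>n. r n x) = (\<lambda>n. s' n x)" by (simp add: r_def)
        then show ?thesis using x False by auto
      qed
    qed
    then show ?thesis
      using s(2) s'(2) by (simp add: AE_lebesgue_on_iff_negligible)
        (meson negligible_Un negligible_subset)
  qed
  ultimately show ?thesis by (auto simp: strongly_measurable_def)
qed

lemma strongly_measurable_vimage:
  assumes f: "strongly_measurable N f" and T: "T \<in> measurable M N"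
    and ae: "\<And>P. AE y in N. P y \<Longrightarrow> AE x in M. P (T x)"
  shows "strongly_measurable M (\<lambda>x. f (T x))"
proof -
  obtain s where s: "\<And>n::nat. simple_function N (s n)" "AE x in N. (\<lambda>n. s n x) \<longlonglongrightarrow> f x"
    using f by (auto simp: strongly_measurable_def)
  have "simple_function M (\<lambda>x. s n (T x))" for n
    unfolding simple_function_eq_measurable
  proof
    have "(\<lambda>x. s n (T x)) ` space M \<subseteq> s n ` space N" using measurable_space[OF T] by auto
    then show "finite ((\<lambda>x. s n (T x)) ` space M)" using s(1)[of n] by (auto simp: simple_function_def intro: finite_subset)
    show "(\<lambda>x. s n (T x)) \<in> M \<rightarrow>\<^sub>M count_space UNIV"
      using measurable_compose[OF T measurable_simple_function[OF s(1)]] .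
  qed
  then show ?thesis using ae[OF s(2)] unfolding strongly_measurable_def
    by (intro exI[of _ "\<lambda>n x. s n (T x)"]) auto
qed

lemma strongly_measurable_subinterval:
  assumes "strongly_measurable (lebesgue_on {a..b}) f" "{c..d} \<subseteq> {a..b}"
  shows "strongly_measurable (lebesgue_on {c..d::real}) f"
proof (rule strongly_measurable_vimage[where T="\<lambda>x. x", OF assms(1)])
  show "(\<lambda>x. x) \<in> lebesgue_on {c..d} \<rightarrow>\<^sub>M lebesgue_on {a..b}"
    using assms(2) by (intro measurable_restrict_space3) auto
  show "AE x in lebesgue_on {c..d}. P x" if "AE x in lebesgue_on {a..b}. P x" for P
    using that assms(2) by (simp add: AE_lebesgue_on_iff_negligible) (erule negligible_subset, auto)
qed

lemma AE_lebesgue_on_affine: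
  fixes c d :: real
  assumes "AE y in lebesgue_on {d + c * a..d + c * b}. P y" "0 < c"
  shows "AE x in lebesgue_on {a..b}. P (d + c * x)"
proof -
  let ?B = "{y \<in> {d + c * a..d + c * b}. \<not> P y}"
  have "negligible ((\<lambda>y. (y - d) / c) ` ?B)"
    using assms(1)
    by (intro negligible_differentiable_image_negligible)
      (auto simp: AE_lebesgue_on_iff_negligible divide_inverse intro!: derivative_intros)
  moreover have "{x \<in> {a..b}. \<not> P (d + c * x)} \<subseteq> (\<lambda>y. (y - d) / c) ` ?B"
  proof
    fix x assume "x \<in> {x \<in> {a..b}. \<not> P (d + c * x)}"
    then show "x \<in> (\<lambda>y. (y - d) / c) ` ?B"
      using assms(2) by (intro image_eqI[where x="d + c * x"]) auto
  qed
  ultimately show ?thesis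
    by (simp add: AE_lebesgue_on_iff_negligible) (erule negligible_subset)
qed

lemma strongly_measurable_affine:
  fixes c d :: real
  assumes "strongly_measurable (lebesgue_on {d + c * a..d + c * b}) f" "0 < c"
  shows "strongly_measurable (lebesgue_on {a..b}) (\<lambda>x. f (d + c * x))"
proof (rule strongly_measurable_vimage[OF assms(1)])
  have "(\<lambda>x. d + c * x) \<in> lebesgue \<rightarrow>\<^sub>M (lebesgue :: real measure)"
    using lebesgue_affine_measurable[where c="\<lambda>x::real. c" and t=d] assms(2) by simp
  then show "(\<lambda>x. d + c * x) \<in> lebesgue_on {a..b} \<rightarrow>\<^sub>M lebesgue_on {d + c * a..d + c * b}"
    using assms(2) by (intro measurable_restrict_space3) auto
qed (rule AE_lebesgue_on_affine[OF _ assms(2)])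

section \<open>The spaces $L^p$ of an interval\<close>

lemma finite_measure_interval: "finite_measure (lebesgue_on {a..b::real})"
  by (rule finite_measure_lebesgue_on) simp

lemma integrable_const_interval [simp]: "integrable (lebesgue_on {a..b::real}) (\<lambda>x. c::real)"
  by (rule finite_measure.integrable_const[OF finite_measure_interval])

lemma AE_lebesgue_on_subinterval:
  assumes "AE x in lebesgue_on {a..b::real}. P x" "{c..d} \<subseteq> {a..b}"
  shows "AE x in lebesgue_on {c..d}. P x"
  using assms by (simp add: AE_lebesgue_on_iff_negligible) (erule negligible_subset, auto)

lemma AE_lebesgue_on_combine:
  assumes "AE x in lebesgue_on {a..b::real}. P x" "AE x in lebesgue_on {b..c}. P x"
  shows "AE x in lebesgue_on {a..c}. P x"
proof -
  have "{x \<in> {a..c}. \<not> P x} \<subseteq> {x \<in> {a..b}. \<not> P x} \<union> {x \<in> {b..c}. \<not> P x}" by auto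
  then show ?thesis using assms
    by (simp add: AE_lebesgue_on_iff_negligible) (meson negligible_Un negligible_subset)
qed

text \<open>End points, where derivatives see values outside the interval, may be discarded.\<close>

lemma AE_lebesgue_on_interior:
  assumes "\<And>x. a < x \<Longrightarrow> x < b \<Longrightarrow> P x"
  shows "AE x in lebesgue_on {a..b::real}. P x"
proof -
  have "{x \<in> {a..b}. \<not> P x} \<subseteq> {a, b}" using assms by force
  then show ?thesis
    by (simp add: AE_lebesgue_on_iff_negligible) (erule negligible_subset[rotated], simp)
qed

lemma LpD:
  assumes "f \<in> Lp p a b"
  shows Lp_strongly_measurable: "strongly_measurable (lebesgue_on {a..b}) f"
    and Lp_integrable_power: "integrable (lebesgue_on {a..b}) (\<lambda>t. norm (f t) ^ p)"
  using assms by (auto simp: Lp_def)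

lemma Lp_norm_measurable:
  "f \<in> Lp p a b \<Longrightarrow> (\<lambda>t. norm (f t)) \<in> borel_measurable (lebesgue_on {a..b})"
  by (intro strongly_measurable_norm complete_measure_lebesgue_on LpD) auto

lemma Lp_bound:
  assumes g: "g \<in> Lp p a b" and f: "strongly_measurable (lebesgue_on {a..b}) f"
    and le: "AE t in lebesgue_on {a..b}. norm (f t) \<le> K * norm (g t)"
  shows "f \<in> Lp p a b"
proof -
  have [measurable]: "(\<lambda>t. norm (f t)) \<in> borel_measurable (lebesgue_on {a..b})"
    by (intro strongly_measurable_norm complete_measure_lebesgue_on f) auto
  have "integrable (lebesgue_on {a..b}) (\<lambda>t. norm (f t) ^ p)"
  proof (rule Bochner_Integration.integrable_bound)
    show "integrable (lebesgue_on {a..b}) (\<lambda>t. K ^ p * norm (g t) ^ p)"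
      using Lp_integrable_power[OF g] by simp
    show "AE t in lebesgue_on {a..b}. norm (norm (f t) ^ p) \<le> norm (K ^ p * norm (g t) ^ p)"
      using le
    proof eventually_elim
      case (elim t)
      have "norm (f t) ^ p \<le> (K * norm (g t)) ^ p" using elim by (intro power_mono) auto
      then show ?case by (simp add: power_mult_distrib)
    qed
  qed measurable
  then show ?thesis using f by (simp add: Lp_def)
qed

lemma Lp_cong_AE:
  assumes "f \<in> Lp p a b" "AE t in lebesgue_on {a..b}. f t = g t"
  shows "g \<in> Lp p a b"
  by (rule Lp_bound[where K=1, OF assms(1) strongly_measurable_cong_AE[OF assms(2) LpD(1)[OF assms(1)]]])
    (use assms(2) in \<open>eventually_elim, simp\<close>)

lemma Lp_const [simp]: "(\<lambda>t. c) \<in> Lp p a b"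
  by (simp add: Lp_def)

lemma Lp_integrable_norm:
  assumes "f \<in> Lp p a b" "p \<ge> 1"
  shows "integrable (lebesgue_on {a..b}) (\<lambda>t. norm (f t))"
proof (rule Bochner_Integration.integrable_bound)
  show "integrable (lebesgue_on {a..b}) (\<lambda>t. 1 + norm (f t) ^ p)"
    using LpD[OF assms(1)] by simp
  have "x \<le> 1 + x ^ p" if "x \<ge> 0" for x :: real
  proof (cases "x \<le> 1")
    case False
    then have "x ^ 1 \<le> x ^ p" using assms(2) by (intro power_increasing) auto
    then show ?thesis by simp
  qed (use that in \<open>simp add: add_increasing2\<close>)
  then show "AE t in lebesgue_on {a..b}. norm (norm (f t)) \<le> norm (1 + norm (f t) ^ p)"
    by (intro AE_I2) (simp add: abs_of_nonneg add_nonneg_nonneg)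
qed (rule Lp_norm_measurable[OF assms(1)])

lemma Lp_imp_L1: "f \<in> Lp p a b \<Longrightarrow> p \<ge> 1 \<Longrightarrow> f \<in> Lp 1 a b"
  using Lp_integrable_norm[of f p a b] LpD(1)[of f p a b] by (simp add: Lp_def)

lemma L2_add:
  assumes "f \<in> Lp 2 a b" "g \<in> Lp 2 a b"
  shows "(\<lambda>t. f t + g t) \<in> Lp 2 a b"
proof -
  have sm: "strongly_measurable (lebesgue_on {a..b}) (\<lambda>t. f t + g t)"
    using assms by (intro strongly_measurable_add LpD)
  have "integrable (lebesgue_on {a..b}) (\<lambda>t. norm (f t + g t) ^ 2)"
  proof (rule Bochner_Integration.integrable_bound)
    show "integrable (lebesgue_on {a..b}) (\<lambda>t. 2 * norm (f t) ^ 2 + 2 * norm (g t) ^ 2)"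
      using assms by (auto simp: Lp_def)
    have "(norm (u + v))\<^sup>2 \<le> 2 * (norm u)\<^sup>2 + 2 * (norm v)\<^sup>2" for u v :: 'a
    proof -
      have "(norm (u + v))\<^sup>2 \<le> (norm u + norm v)\<^sup>2" by (intro power_mono norm_triangle_ineq) auto
      also have "\<dots> \<le> 2 * (norm u)\<^sup>2 + 2 * (norm v)\<^sup>2"
        using sum_squares_ge_zero[of "norm u - norm v" 0] by (simp add: power2_eq_square algebra_simps)
      finally show ?thesis .
    qed
    then show "AE t in lebesgue_on {a..b}. norm (norm (f t + g t) ^ 2) \<le> norm (2 * norm (f t) ^ 2 + 2 * norm (g t) ^ 2)"
      by (intro AE_I2) (simp add: abs_of_nonneg add_nonneg_nonneg)
    show "(\<lambda>t. norm (f t + g t) ^ 2) \<in> borel_measurable (lebesgue_on {a..b})"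
      by (intro borel_measurable_power strongly_measurable_norm complete_measure_lebesgue_on sm) auto
  qed
  then show ?thesis using sm by (simp add: Lp_def)
qed

lemma Lp_scaleR: "f \<in> Lp p a b \<Longrightarrow> (\<lambda>t. c *\<^sub>R f t) \<in> Lp p a b"
  by (rule Lp_bound[where K="\<bar>c\<bar>"]) (auto intro: strongly_measurable_scaleR LpD)

lemma Lp_uminus: "f \<in> Lp p a b \<Longrightarrow> (\<lambda>t. - f t) \<in> Lp p a b"
  using Lp_scaleR[of f p a b "-1"] by simp

lemma L2_diff: "f \<in> Lp 2 a b \<Longrightarrow> g \<in> Lp 2 a b \<Longrightarrow> (\<lambda>t. f t - g t) \<in> Lp 2 a b"
  using L2_add[of f a b "\<lambda>t. - g t"] Lp_uminus[of g 2 a b] by simp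

lemma L2_sum: "(\<And>i. i \<in> I \<Longrightarrow> f i \<in> Lp 2 a b) \<Longrightarrow> (\<lambda>t. \<Sum>i\<in>I. f i t) \<in> Lp 2 a b"
  by (induction I rule: infinite_finite_induct) (auto intro: L2_add)

lemma L2_inner_integrable:
  fixes f g :: "real \<Rightarrow> 'e::real_inner"
  assumes "f \<in> Lp 2 a b" "g \<in> Lp 2 a b"
  shows "integrable (lebesgue_on {a..b}) (\<lambda>t. f t \<bullet> g t)"
proof (rule Bochner_Integration.integrable_bound)
  show "integrable (lebesgue_on {a..b}) (\<lambda>t. norm (f t) ^ 2 + norm (g t) ^ 2)"
    using assms by (auto simp: Lp_def)
  have "\<bar>u \<bullet> v\<bar> \<le> (norm u)\<^sup>2 + (norm v)\<^sup>2" for u v :: 'e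
  proof -
    have "\<bar>u \<bullet> v\<bar> \<le> norm u * norm v" by (rule Cauchy_Schwarz_ineq2)
    also have "\<dots> \<le> (norm u)\<^sup>2 + (norm v)\<^sup>2"
      using sum_squares_bound[of "norm u" "norm v"] mult_nonneg_nonneg[OF norm_ge_zero[of u] norm_ge_zero[of v]]
      by linarith
    finally show ?thesis .
  qed
  then show "AE t in lebesgue_on {a..b}. norm (f t \<bullet> g t) \<le> norm (norm (f t) ^ 2 + norm (g t) ^ 2)"
    by (intro AE_I2) (simp add: abs_of_nonneg add_nonneg_nonneg)
  show "(\<lambda>t. f t \<bullet> g t) \<in> borel_measurable (lebesgue_on {a..b})"
    by (intro strongly_measurable_real complete_measure_lebesgue_on strongly_measurable_inner LpD(1)[OF assms(1)] LpD(1)[OF assms(2)]) auto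
qed

lemma Lp_combine:
  "f \<in> Lp p a b \<Longrightarrow> f \<in> Lp p b c \<Longrightarrow> a \<le> b \<Longrightarrow> b \<le> c \<Longrightarrow> f \<in> Lp p a c"
  unfolding Lp_def using strongly_measurable_combine[of a b f c] integrable_combine[of a b "\<lambda>t. norm (f t) ^ p" c] by auto

lemma Lp_subinterval:
  assumes "f \<in> Lp p a b" "{c..d} \<subseteq> {a..b}"
  shows "f \<in> Lp p c d"
  using assms strongly_measurable_subinterval[of a b f c d] integrable_subinterval[of a b "\<lambda>t. norm (f t) ^ p" c d]
  unfolding Lp_def by auto

lemma
  fixes h :: "real \<Rightarrow> real" and c d :: real
  assumes "0 < c"
  shows integrable_affine: "integrable (lebesgue_on {d + c * a..d + c * b}) h \<Longrightarrow>
      integrable (lebesgue_on {a..b}) (\<lambda>x. h (d + c * x))"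
    and integral_affine: "integral\<^sup>L (lebesgue_on {d + c * a..d + c * b}) h =
      c * integral\<^sup>L (lebesgue_on {a..b}) (\<lambda>x. h (d + c * x))"
proof -
  let ?h = "\<lambda>x. indicator {d + c * a..d + c * b} x *\<^sub>R h x"
  have eq: "?h (d + c * x) = indicator {a..b} x *\<^sub>R h (d + c * x)" for x
    using assms by (auto simp: indicator_def)
  {
    assume "integrable (lebesgue_on {d + c * a..d + c * b}) h"
    then have "integrable lebesgue ?h" by (simp add: integrable_restrict_space)
    then have "integrable lebesgue (\<lambda>x. ?h (d + c * x))"
      using lebesgue_integrable_real_affine[of ?h c d] assms by simp
    then show "integrable (lebesgue_on {a..b}) (\<lambda>x. h (d + c * x))"
      unfolding eq by (simp add: integrable_restrict_space)
  }
  have "integral\<^sup>L lebesgue ?h = \<bar>c\<bar> *\<^sub>R integral\<^sup>L lebesgue (\<lambda>x. ?h (d + c * x))"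
    using assms by (intro lebesgue_integral_real_affine) auto
  then show "integral\<^sup>L (lebesgue_on {d + c * a..d + c * b}) h = c * integral\<^sup>L (lebesgue_on {a..b}) (\<lambda>x. h (d + c * x))"
    unfolding eq using assms by (simp add: integral_restrict_space)
qed

lemma Lp_affine:
  fixes c d :: real
  assumes "f \<in> Lp p (d + c * a) (d + c * b)" "0 < c"
  shows "(\<lambda>x. f (d + c * x)) \<in> Lp p a b"
  using assms strongly_measurable_affine[of d c a b f] integrable_affine[of c d a b "\<lambda>t. norm (f t) ^ p"]
  by (auto simp: Lp_def)

lemma Lp_extend_zero:
  assumes "f \<in> Lp p 0 1"
  shows "(\<lambda>t. if t \<in> {0..1} then f t else 0) \<in> Lp p a b" (is "?g \<in> _")
proof -
  have "?g \<in> Lp p (min a 0) 0" "?g \<in> Lp p 1 (max b 1)"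
    by (rule Lp_cong_AE[where f="\<lambda>t. 0"], simp, rule AE_lebesgue_on_interior, simp)+
  moreover have "?g \<in> Lp p 0 1"
    by (rule Lp_cong_AE[OF assms]) (rule AE_lebesgue_on_interior, simp)
  ultimately have "?g \<in> Lp p (min a 0) (max b 1)"
    using Lp_combine[of ?g p "min a 0" 0 1] Lp_combine[of ?g p "min a 0" 1 "max b 1"] by linarith
  then show ?thesis by (rule Lp_subinterval) auto
qed

section \<open>Weak compactness and Cesaro means in Hilbert spaces\<close>

text \<open>
  By the smallness of the inner products, a further summand increases the squared norm of the sum by
  at most \<open>B\<^sup>2 + 2\<close>.  So this square grows only linearly, while the mean divides it by the square of
  the number of summands.
\<close>

lemma Cesaro_means_tendsto_zero:
  fixes y :: "nat \<Rightarrow> 'h::real_inner"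
  assumes B: "\<And>i. norm (y i) \<le> B"
    and orth: "\<And>i j. i < j \<Longrightarrow> \<bar>y i \<bullet> y j\<bar> \<le> 1 / real (Suc j)"
  shows "(\<lambda>n. (1 / real (Suc n)) *\<^sub>R (\<Sum>i\<le>n. y i)) \<longlonglongrightarrow> 0"
proof -
  have sq: "(norm (\<Sum>i\<le>n. y i))\<^sup>2 \<le> (B\<^sup>2 + 2) * real (Suc n)" for n
  proof (induction n)
    case 0
    have "(norm (y 0))\<^sup>2 \<le> B\<^sup>2" using B[of 0] by (intro power_mono) auto
    then show ?case by simp
  next
    case (Suc n)
    have "(norm (\<Sum>i\<le>Suc n. y i))\<^sup>2 = (norm (\<Sum>i\<le>n. y i))\<^sup>2 + (norm (y (Suc n)))\<^sup>2 + 2 * (\<Sum>i\<le>n. y i \<bullet> y (Suc n))"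
    proof -
      have "(norm (a + b))\<^sup>2 = (norm a)\<^sup>2 + (norm b)\<^sup>2 + 2 * (a \<bullet> b)" for a b :: 'h
        by (simp add: power2_norm_eq_inner inner_add_left inner_add_right inner_commute)
      then show ?thesis by (simp add: inner_sum_left)
    qed
    moreover have "(norm (y (Suc n)))\<^sup>2 \<le> B\<^sup>2" using B by (intro power_mono) auto
    moreover have "(\<Sum>i\<le>n. y i \<bullet> y (Suc n)) \<le> 1"
    proof -
      have "(\<Sum>i\<le>n. y i \<bullet> y (Suc n)) \<le> (\<Sum>i\<le>n. 1 / real (Suc (Suc n)))"
        using orth[of _ "Suc n"] by (intro sum_mono) (auto simp: abs_le_iff)
      also have "\<dots> \<le> 1" by (simp add: field_simps)
      finally show ?thesis .
    qed
    ultimately show ?case using Suc.IH by (simp add: algebra_simps)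
  qed
  have "(\<lambda>n. (norm ((1 / real (Suc n)) *\<^sub>R (\<Sum>i\<le>n. y i)))\<^sup>2) \<longlonglongrightarrow> 0"
  proof (rule Lim_null_comparison[OF always_eventually])
    show "\<forall>n. norm ((norm ((1 / real (Suc n)) *\<^sub>R (\<Sum>i\<le>n. y i)))\<^sup>2) \<le> (B\<^sup>2 + 2) * inverse (real (Suc n))"
    proof
      fix n
      have "(norm ((1 / real (Suc n)) *\<^sub>R (\<Sum>i\<le>n. y i)))\<^sup>2 = (norm (\<Sum>i\<le>n. y i))\<^sup>2 / (real (Suc n))\<^sup>2"
        by (simp add: power_divide)
      also have "\<dots> \<le> (B\<^sup>2 + 2) * real (Suc n) / (real (Suc n))\<^sup>2"
        by (intro divide_right_mono sq) auto
      also have "\<dots> = (B\<^sup>2 + 2) * inverse (real (Suc n))" by (simp add: power2_eq_square divide_inverse)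
      finally show "norm ((norm ((1 / real (Suc n)) *\<^sub>R (\<Sum>i\<le>n. y i)))\<^sup>2) \<le> (B\<^sup>2 + 2) * inverse (real (Suc n))" by simp
    qed
    show "(\<lambda>n. (B\<^sup>2 + 2) * inverse (real (Suc n))) \<longlonglongrightarrow> 0"
      using tendsto_mult_right_zero[OF LIMSEQ_inverse_real_of_nat] .
  qed
  then have "(\<lambda>n. norm ((1 / real (Suc n)) *\<^sub>R (\<Sum>i\<le>n. y i))) \<longlonglongrightarrow> 0"
    by (subst (asm) power_tendsto_0_iff) simp_all
  then show ?thesis by (rule tendsto_norm_zero_cancel)
qed

text \<open>
  Every index is chosen so large that its vector is almost orthogonal to all vectors up to the
  preceding index.  The bound refers to the later of the two positions, so that it is inherited by
  further subsequences.
\<close>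

lemma almost_orthogonal_subsequence:
  fixes w :: "nat \<Rightarrow> 'h::real_inner"
  assumes "\<And>m. (\<lambda>n. w n \<bullet> w m) \<longlonglongrightarrow> 0"
  obtains s :: "nat \<Rightarrow> nat" where "strict_mono s" "\<And>i j. i < j \<Longrightarrow> \<bar>w (s i) \<bullet> w (s j)\<bar> \<le> 1 / real (Suc j)"
proof -
  define Q where "Q j a b \<longleftrightarrow> a < b \<and> (\<forall>m\<le>a. \<bar>w m \<bullet> w b\<bar> \<le> 1 / real (Suc (Suc j)))" for j a b
  have "\<exists>b. Q j a b" for j a
  proof -
    have "\<forall>\<^sub>F n in sequentially. \<forall>m\<in>{..a}. \<bar>w n \<bullet> w m\<bar> < 1 / real (Suc (Suc j))"
    proof (rule eventually_ball_finite)
      show "\<forall>m\<in>{..a}. \<forall>\<^sub>F n in sequentially. \<bar>w n \<bullet> w m\<bar> < 1 / real (Suc (Suc j))"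
        using tendstoD[OF assms, of "1 / real (Suc (Suc j))"] by (auto simp: dist_real_def)
    qed simp
    then have "\<forall>\<^sub>F n in sequentially. Q j a n"
      using eventually_gt_at_top[of a]
      by eventually_elim (auto simp: Q_def inner_commute intro: less_imp_le)
    then show ?thesis by (auto simp: eventually_sequentially)
  qed
  then have "\<exists>s. \<forall>j. True \<and> Q j (s j) (s (Suc j))"
    by (intro dependent_nat_choice) auto
  then obtain s where s: "\<And>j. Q j (s j) (s (Suc j))" by blast
  have sm: "strict_mono s" using s by (auto simp: strict_mono_Suc_iff Q_def)
  show ?thesis
  proof (rule that[OF sm])
    fix i j :: nat assume "i < j"
    then obtain k where k: "j = Suc k" "i \<le> k" by (cases j) auto
    then have "s i \<le> s k" using sm by (simp add: strict_mono_less_eq)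
    then show "\<bar>w (s i) \<bullet> w (s j)\<bar> \<le> 1 / real (Suc j)" using s[of k] k by (auto simp: Q_def)
  qed
qed

text \<open>
  The points of almost minimal norm in the convex hulls of the tails converge, by the parallelogram
  identity.  Their limit is the candidate for the weak limit.
\<close>

lemma tail_hulls_common_limit:
  fixes z :: "nat \<Rightarrow> 'h::{real_inner, complete_space}"
  assumes B: "\<And>n. norm (z n) \<le> B"
  obtains u v where "v \<longlonglongrightarrow> u" "\<And>n. v n \<in> convex hull (z ` {n..})"
proof -
  define K where "K n = convex hull (z ` {n..})" for n
  define d where "d n = (INF x\<in>K n. norm x)" for n
  have zK: "z n \<in> K n" for n unfolding K_def by (rule hull_inc) auto
  have ne: "K n \<noteq> {}" for n using zK[of n] by auto
  have bdd: "bdd_below (norm ` K n)" for n by (rule bdd_belowI[of _ 0]) auto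
  have mono: "K n \<subseteq> K m" if "m \<le> n" for m n unfolding K_def using that by (intro hull_mono image_mono) auto
  have dmono: "incseq d"
    unfolding d_def by (intro monoI cINF_superset_mono ne bdd mono) auto
  have d_le: "d n \<le> norm x" if "x \<in> K n" for n x unfolding d_def using that by (intro cINF_lower bdd)
  have d0: "0 \<le> d n" for n unfolding d_def using ne by (intro cINF_greatest) auto
  have "d n \<le> B" for n using d_le[OF zK] B order.trans by blast
  then have "Bseq d" using d0 by (intro BseqI'[of _ B]) auto
  then obtain D where D: "d \<longlonglongrightarrow> D"
    using Bseq_mono_convergent[of d] dmono by (auto simp: convergent_def incseq_def)
  have "\<exists>x\<in>K n. norm x < d n + 1 / real (Suc n)" for n
    using cINF_less_iff[OF ne bdd, of n "d n + 1 / real (Suc n)"] by (simp add: d_def)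
  then obtain v where v: "\<And>n. v n \<in> K n" "\<And>n. norm (v n) < d n + 1 / real (Suc n)" by metis
  have dD: "d n \<le> D" for n using incseq_le[OF dmono D] .
  define r where "r n = 2 * ((d n + 1 / real (Suc n))\<^sup>2 + (D + 1 / real (Suc n))\<^sup>2 - 2 * (d n)\<^sup>2)" for n
  have close: "(norm (v m - v n))\<^sup>2 \<le> r n" if "n \<le> m" for m n
  proof -
    have "(1/2) *\<^sub>R v m + (1/2) *\<^sub>R v n \<in> K n"
      using v(1)[of n] v(1)[of m] mono[OF that]
      unfolding K_def by (intro convexD[OF convex_convex_hull]) auto
    then have "d n \<le> norm ((1/2) *\<^sub>R (v m + v n))" using d_le by (simp add: scaleR_add_right)
    then have "(2 * d n)\<^sup>2 \<le> (norm (v m + v n))\<^sup>2" using d0 by (intro power_mono) auto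
    moreover have "(norm (v m + v n))\<^sup>2 + (norm (v m - v n))\<^sup>2 = 2 * (norm (v m))\<^sup>2 + 2 * (norm (v n))\<^sup>2"
      by (simp add: power2_norm_eq_inner inner_add_left inner_add_right inner_diff_left inner_diff_right inner_commute)
    moreover have "(norm (v m))\<^sup>2 \<le> (D + 1 / real (Suc n))\<^sup>2"
    proof (rule power_mono)
      have "1 / real (Suc m) \<le> 1 / real (Suc n)" using that by (simp add: field_simps)
      then show "norm (v m) \<le> D + 1 / real (Suc n)" using v(2)[of m] dD[of m] by linarith
    qed simp
    moreover have "(norm (v n))\<^sup>2 \<le> (d n + 1 / real (Suc n))\<^sup>2" using v(2)[of n] by (intro power_mono) auto
    ultimately show ?thesis by (simp add: r_def power_mult_distrib)
  qed
  have r0: "r \<longlonglongrightarrow> 0"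
  proof -
    have "r \<longlonglongrightarrow> 2 * ((D + 0)\<^sup>2 + (D + 0)\<^sup>2 - 2 * D\<^sup>2)"
      unfolding r_def using LIMSEQ_inverse_real_of_nat
      by (intro tendsto_intros D) (simp_all add: divide_inverse)
    then show ?thesis by simp
  qed
  have "Cauchy v"
  proof (rule CauchyI')
    fix e :: real assume e: "0 < e"
    then have "\<forall>\<^sub>F n in sequentially. r n < e\<^sup>2" using r0 by (intro order_tendstoD) auto
    then obtain N where N: "r N < e\<^sup>2" "\<And>n. n \<ge> N \<Longrightarrow> r n < e\<^sup>2" by (auto simp: eventually_sequentially)
    have "dist (v m) (v n) < e" if "m \<ge> N" "n > m" for m n
    proof -
      have "(norm (v n - v m))\<^sup>2 < e\<^sup>2" using close[of m n] N(2)[of m] that by force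
      then show ?thesis using e by (simp add: dist_norm norm_minus_commute power_less_imp_less_base)
    qed
    then show "\<exists>M. \<forall>m\<ge>M. \<forall>n>m. dist (v m) (v n) < e" by blast
  qed
  then obtain u where "v \<longlonglongrightarrow> u" using Cauchy_convergent_iff convergent_def by blast
  then show ?thesis using v(1) that by (auto simp: K_def)
qed

lemma subsequence_inner_convergent:
  fixes x :: "nat \<Rightarrow> 'h::real_inner"
  assumes B: "\<And>n. norm (x n) \<le> B"
  obtains r :: "nat \<Rightarrow> nat" where "strict_mono r" "\<And>m. convergent (\<lambda>n. x (r n) \<bullet> x m)"
proof -
  interpret subseqs "\<lambda>m s. convergent (\<lambda>n. x (s n) \<bullet> x m)"
  proof
    fix m and s :: "nat \<Rightarrow> nat" assume "strict_mono s"
    have "bounded (range (\<lambda>n. x (s n) \<bullet> x m))"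
    proof (rule boundedI)
      fix c assume "c \<in> range (\<lambda>n. x (s n) \<bullet> x m)"
      then obtain n where "c = x (s n) \<bullet> x m" by auto
      then show "norm c \<le> B * B"
        using Cauchy_Schwarz_ineq2[of "x (s n)" "x m"] mult_mono[OF B[of "s n"] B[of m]] norm_ge_zero[of "x m"] B[of m]
        by (smt (verit) norm_ge_zero real_norm_def)
    qed
    then obtain l r where "strict_mono r" "((\<lambda>n. x (s n) \<bullet> x m) \<circ> r) \<longlonglongrightarrow> l"
      using bounded_imp_convergent_subsequence by blast
    then show "\<exists>r'. strict_mono r' \<and> convergent (\<lambda>n. x ((s \<circ> r') n) \<bullet> x m)"
      by (auto simp: convergent_def o_def)
  qed
  show ?thesis
  proof (rule that[OF subseq_diagseq])
    fix m
    have "convergent (\<lambda>n. x ((diagseq \<circ> ((+) (Suc m))) n) \<bullet> x m)"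
    proof (rule diagseq_holds)
      fix r s :: "nat \<Rightarrow> nat" and n
      assume "strict_mono r" "convergent (\<lambda>k. x (s k) \<bullet> x n)"
      then show "convergent (\<lambda>k. x ((s \<circ> r) k) \<bullet> x n)"
        using convergent_subseq_convergent[of "\<lambda>k. x (s k) \<bullet> x n" r] by (simp add: o_def)
    qed
    then have "convergent (\<lambda>n. x (diagseq (n + Suc m)) \<bullet> x m)" by (simp add: add.commute)
    then show "convergent (\<lambda>n. x (diagseq n) \<bullet> x m)"
      by (subst (asm) convergent_ignore_initial_segment)
  qed
qed

text \<open>
  Sequential weak compactness of balls together with the Banach--Saks property.  The differences to
  the candidate \<open>u\<close> become orthogonal to each of them, hence have a subsequence all of whose
  subsequences have Cesaro means tending to zero.  This also gives weak convergence without the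
  Riesz representation: a functional that stayed away from its value at the limit along a
  subsequence would stay away from it on the Cesaro means of that subsequence.
\<close>

theorem bounded_sequence_weak_Banach_Saks:
  fixes x :: "nat \<Rightarrow> 'h::{real_inner, complete_space}"
  assumes B: "\<And>n. norm (x n) \<le> B"
  obtains r u where "strict_mono (r :: nat \<Rightarrow> nat)"
    "\<And>F :: 'h \<Rightarrow> real. bounded_linear F \<Longrightarrow> (\<lambda>n. F (x (r n))) \<longlonglongrightarrow> F u"
    "(\<lambda>n. (1 / real (Suc n)) *\<^sub>R (\<Sum>i\<le>n. x (r i))) \<longlonglongrightarrow> u"
proof -
  obtain q :: "nat \<Rightarrow> nat" where q: "strict_mono q" "\<And>m. convergent (\<lambda>n. x (q n) \<bullet> x m)"
    using subsequence_inner_convergent[of x B, OF B] by blast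
  define z where "z n = x (q n)" for n
  have zB: "norm (z n) \<le> B" for n using B by (simp add: z_def)
  obtain c where c: "\<And>m. (\<lambda>n. z n \<bullet> z m) \<longlonglongrightarrow> c m"
    using q(2) unfolding z_def convergent_def by metis
  obtain u v where v: "v \<longlonglongrightarrow> u" "\<And>n. v n \<in> convex hull (z ` {n..})"
    using tail_hulls_common_limit[of z B, OF zB] by blast
  have hull_mem: "v n \<in> S" if "convex S" "\<And>k. k \<ge> n \<Longrightarrow> z k \<in> S" for S n
    using v(2)[of n] hull_minimal[of "z ` {n..}" S convex] that by auto
  \<comment> \<open>half-spaces are convex: what holds for the inner products of a tail with \<open>z m\<close> holds on its hull\<close>
  have uz: "u \<bullet> z m = c m" for m
  proof (rule LIMSEQ_unique)
    show "(\<lambda>n. v n \<bullet> z m) \<longlonglongrightarrow> u \<bullet> z m" using v(1) by (intro tendsto_intros)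
    show "(\<lambda>n. v n \<bullet> z m) \<longlonglongrightarrow> c m"
    proof (rule LIMSEQ_I)
      fix e :: real assume e: "0 < e"
      obtain N where N: "\<And>n. n \<ge> N \<Longrightarrow> \<bar>z n \<bullet> z m - c m\<bar> < e"
        using LIMSEQ_D[OF c e] by auto
      have conv: "convex {x. x \<bullet> z m < c m + e}" "convex {x. x \<bullet> z m > c m - e}"
        using convex_halfspace_lt[of "z m" "c m + e"] convex_halfspace_gt[of "c m - e" "z m"]
        by (simp_all add: inner_commute)
      have "norm (v n \<bullet> z m - c m) < e" if "n \<ge> N" for n
      proof -
        have "z k \<bullet> z m < c m + e \<and> c m - e < z k \<bullet> z m" if "k \<ge> n" for k
          using N[of k] \<open>n \<ge> N\<close> that by (simp add: abs_less_iff)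
        then have "v n \<in> {x. x \<bullet> z m < c m + e}" "v n \<in> {x. x \<bullet> z m > c m - e}"
          using hull_mem[OF conv(1), of n] hull_mem[OF conv(2), of n] by auto
        then show ?thesis by (simp add: abs_less_iff)
      qed
      then show "\<exists>no. \<forall>n\<ge>no. norm (v n \<bullet> z m - c m) < e" by blast
    qed
  qed
  define w where "w n = z n - u" for n
  have wz: "(\<lambda>n. w n \<bullet> z m) \<longlonglongrightarrow> 0" for m
    using tendsto_diff[OF c[of m] tendsto_const[of "u \<bullet> z m"]] by (simp add: w_def inner_diff_left uz)
  have wB: "norm (w n) \<le> B + norm u" for n
    using norm_triangle_ineq4[of "z n" u] zB[of n] by (simp add: w_def)
  have wv: "(\<lambda>n. w n \<bullet> v k) \<longlonglongrightarrow> 0" for k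
  proof -
    have "convex {x. (\<lambda>n. w n \<bullet> x) \<longlonglongrightarrow> 0}"
    proof (rule convexI)
      fix x y and a b :: real
      assume "x \<in> {x. (\<lambda>n. w n \<bullet> x) \<longlonglongrightarrow> 0}" "y \<in> {x. (\<lambda>n. w n \<bullet> x) \<longlonglongrightarrow> 0}"
      then have "(\<lambda>n. a * (w n \<bullet> x) + b * (w n \<bullet> y)) \<longlonglongrightarrow> a * 0 + b * 0"
        by (intro tendsto_intros) auto
      then show "a *\<^sub>R x + b *\<^sub>R y \<in> {x. (\<lambda>n. w n \<bullet> x) \<longlonglongrightarrow> 0}" by (simp add: inner_add_right)
    qed
    then have "v k \<in> {x. (\<lambda>n. w n \<bullet> x) \<longlonglongrightarrow> 0}" by (rule hull_mem) (simp add: wz)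
    then show ?thesis by simp
  qed
  have wu: "(\<lambda>n. w n \<bullet> u) \<longlonglongrightarrow> 0"
  proof (rule LIMSEQ_I)
    fix e :: real assume e: "0 < e"
    define C where "C = B + norm u + 1"
    have C: "C > 0" unfolding C_def using wB[of 0] norm_ge_zero[of "w 0"] by linarith
    obtain k where k: "norm (v k - u) < e / 2 / C"
      using LIMSEQ_D[OF v(1), of "e / 2 / C"] e C by auto
    obtain N where N: "\<And>n. n \<ge> N \<Longrightarrow> \<bar>w n \<bullet> v k\<bar> < e / 2"
      using LIMSEQ_D[OF wv[of k], of "e / 2"] e by auto
    have "norm (w n \<bullet> u - 0) < e" if "n \<ge> N" for n
    proof -
      have "\<bar>w n \<bullet> (v k - u)\<bar> \<le> norm (w n) * norm (v k - u)" by (rule Cauchy_Schwarz_ineq2)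
      also have "\<dots> \<le> C * norm (v k - u)" using wB[of n] by (intro mult_right_mono) (auto simp: C_def)
      also have "\<dots> < e / 2" using k C by (simp add: field_simps)
      finally show ?thesis using N[OF that] unfolding inner_diff_right real_norm_def by linarith
    qed
    then show "\<exists>no. \<forall>n\<ge>no. norm (w n \<bullet> u - 0) < e" by blast
  qed
  have ww: "(\<lambda>n. w n \<bullet> w m) \<longlonglongrightarrow> 0" for m
    using tendsto_diff[OF wz[of m] wu] by (simp add: w_def[of m] inner_diff_right)
  obtain s :: "nat \<Rightarrow> nat" where s: "strict_mono s"
    "\<And>i j. i < j \<Longrightarrow> \<bar>w (s i) \<bullet> w (s j)\<bar> \<le> 1 / real (Suc j)"
    using almost_orthogonal_subsequence[of w, OF ww] by blast
  have Cesaro: "(\<lambda>n. (1 / real (Suc n)) *\<^sub>R (\<Sum>i\<le>n. w (s (p i)))) \<longlonglongrightarrow> 0" if "strict_mono p" for p :: "nat \<Rightarrow> nat"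
  proof (rule Cesaro_means_tendsto_zero[where y="\<lambda>i. w (s (p i))", OF wB])
    fix i j :: nat assume "i < j"
    then have "\<bar>w (s (p i)) \<bullet> w (s (p j))\<bar> \<le> 1 / real (Suc (p j))"
      using s(2) that by (simp add: strict_mono_less)
    also have "\<dots> \<le> 1 / real (Suc j)" using seq_suble[OF that, of j] by (simp add: field_simps)
    finally show "\<bar>w (s (p i)) \<bullet> w (s (p j))\<bar> \<le> 1 / real (Suc j)" .
  qed
  show ?thesis
  proof (rule that[of "q \<circ> s" u])
    show "strict_mono (q \<circ> s)" using q(1) s(1) by (rule strict_mono_o)
    have "(1 / real (Suc n)) *\<^sub>R (\<Sum>i\<le>n. x ((q \<circ> s) i)) = (1 / real (Suc n)) *\<^sub>R (\<Sum>i\<le>n. w (s (id i))) + u" for n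
      using of_nat_neq_0[of n, where 'a=real]
      by (simp add: w_def z_def sum_subtractf scaleR_diff_right sum_constant_scaleR)
    then show "(\<lambda>n. (1 / real (Suc n)) *\<^sub>R (\<Sum>i\<le>n. x ((q \<circ> s) i))) \<longlonglongrightarrow> u"
      using tendsto_add[OF Cesaro[of id] tendsto_const[of u]] by (simp add: strict_mono_id)
    fix F :: "'h \<Rightarrow> real" assume F: "bounded_linear F"
    interpret F: bounded_linear F by (rule F)
    \<comment> \<open>a functional bounded away from \<open>0\<close> on a subsequence is bounded away from \<open>0\<close> on its means\<close>
    have no_gap: False if e: "0 < e" and p: "strict_mono p" "\<And>i. e \<le> G (w (s (p i)))" and G: "bounded_linear G" for e :: real and p :: "nat \<Rightarrow> nat" and G :: "'h \<Rightarrow> real"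
    proof -
      interpret G: bounded_linear G by (rule G)
      have "(\<lambda>n. G ((1 / real (Suc n)) *\<^sub>R (\<Sum>i\<le>n. w (s (p i))))) \<longlonglongrightarrow> G 0"
        by (rule G.tendsto[OF Cesaro[OF p(1)]])
      moreover have "e \<le> G ((1 / real (Suc n)) *\<^sub>R (\<Sum>i\<le>n. w (s (p i))))" for n
      proof -
        have "(\<Sum>i\<le>n. e) \<le> (\<Sum>i\<le>n. G (w (s (p i))))" by (intro sum_mono p(2))
        then show ?thesis by (simp add: G.scaleR G.sum field_simps)
      qed
      ultimately have "e \<le> G 0" by (intro LIMSEQ_le_const) auto
      then show False using e by (simp add: G.zero)
    qed
    have "(\<lambda>n. F (w (s n))) \<longlonglongrightarrow> 0"
    proof (rule ccontr)
      assume "\<not> (\<lambda>n. F (w (s n))) \<longlonglongrightarrow> 0"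
      then obtain e where e: "e > 0" "\<exists>\<^sub>F n in sequentially. \<bar>F (w (s n))\<bar> \<ge> e"
        unfolding tendsto_iff by (auto simp: dist_real_def frequently_def not_le)
      then have "\<exists>\<^sub>F n in sequentially. F (w (s n)) \<ge> e \<or> - F (w (s n)) \<ge> e"
        by (auto elim!: frequently_elim1)
      then consider "\<exists>\<^sub>F n in sequentially. F (w (s n)) \<ge> e" | "\<exists>\<^sub>F n in sequentially. - F (w (s n)) \<ge> e"
        by (auto simp: frequently_disj_iff)
      then show False
      proof cases
        case 1
        then have "infinite {n. F (w (s n)) \<ge> e}" by (simp add: frequently_cofinite cofinite_eq_sequentially[symmetric])
        then show False using no_gap[OF e(1) _ _ F, of "enumerate {n. F (w (s n)) \<ge> e}"]
          enumerate_in_set strict_mono_enumerate by blast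
      next
        case 2
        then have "infinite {n. - F (w (s n)) \<ge> e}" by (simp add: frequently_cofinite cofinite_eq_sequentially[symmetric])
        then show False using no_gap[OF e(1) _ _ bounded_linear_minus[OF F], of "enumerate {n. - F (w (s n)) \<ge> e}"]
          enumerate_in_set strict_mono_enumerate by blast
      qed
    qed
    then have "(\<lambda>n. F (w (s n)) + F u) \<longlonglongrightarrow> 0 + F u" by (intro tendsto_intros)
    then show "(\<lambda>n. F (x ((q \<circ> s) n))) \<longlonglongrightarrow> F u"
      by (simp add: w_def z_def F.diff)
  qed
qed

section \<open>The Hilbert space of square integrable curves\<close>

lemma Fatou_integral:
  fixes h :: "nat \<Rightarrow> 'a \<Rightarrow> real"
  assumes h: "\<And>k. integrable M (h k)" "\<And>k x. 0 \<le> h k x"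
    and H: "H \<in> borel_measurable M" "\<And>x. 0 \<le> H x"
    and lim: "AE x in M. (\<lambda>k. h k x) \<longlonglongrightarrow> H x"
    and bound: "\<forall>\<^sub>F k in sequentially. integral\<^sup>L M (h k) \<le> C"
  shows "integrable M H \<and> integral\<^sup>L M H \<le> C"
proof -
  have C: "0 \<le> C"
  proof -
    obtain k where "integral\<^sup>L M (h k) \<le> C" using bound by (auto simp: eventually_sequentially)
    then show ?thesis using Bochner_Integration.integral_nonneg[of M "h k", OF h(2)] by linarith
  qed
  have "(\<integral>\<^sup>+x. ennreal (H x) \<partial>M) = (\<integral>\<^sup>+x. liminf (\<lambda>k. ennreal (h k x)) \<partial>M)"
  proof (rule nn_integral_cong_AE)
    show "AE x in M. ennreal (H x) = liminf (\<lambda>k. ennreal (h k x))"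
      using lim by eventually_elim (rule lim_imp_Liminf[symmetric], auto intro: tendsto_ennrealI)
  qed
  also have "\<dots> \<le> liminf (\<lambda>k. \<integral>\<^sup>+x. ennreal (h k x) \<partial>M)"
    using h(1) by (intro nn_integral_liminf) auto
  also have "\<dots> = liminf (\<lambda>k. ennreal (integral\<^sup>L M (h k)))"
    using h by (intro arg_cong[where f=liminf] ext nn_integral_eq_integral) auto
  also have "\<dots> \<le> ennreal C"
  proof (rule Liminf_le)
    show "\<forall>\<^sub>F k in sequentially. ennreal (integral\<^sup>L M (h k)) \<le> ennreal C"
      using bound by eventually_elim (simp add: ennreal_leI)
  qed simp
  finally have le: "(\<integral>\<^sup>+x. ennreal (H x) \<partial>M) \<le> ennreal C" .
  then have int: "integrable M H"
    using H by (intro integrableI_nonneg) (auto simp: top_unique less_top[symmetric])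
  then have "ennreal (integral\<^sup>L M H) \<le> ennreal C"
    using le H(2) by (simp add: nn_integral_eq_integral)
  then show ?thesis using int C by (simp add: ennreal_le_iff)
qed

lemma L2_norm_power2:
  "(L2_norm f)\<^sup>2 = integral\<^sup>L (lebesgue_on {0..1}) (\<lambda>t. (norm (f t))\<^sup>2)"
  by (simp add: L2_norm_def)

lemma L2_norm_cong_AE:
  assumes "f \<in> Lp 2 0 1" "AE t in lebesgue_on {0..1}. f t = g t"
  shows "L2_norm f = L2_norm g"
proof -
  have g: "g \<in> Lp 2 0 1" using assms by (rule Lp_cong_AE)
  show ?thesis
    unfolding L2_norm_def
    by (intro arg_cong[where f=sqrt] integral_cong_AE borel_measurable_power Lp_norm_measurable[OF assms(1)] Lp_norm_measurable[OF g])
      (use assms(2) in \<open>eventually_elim, simp\<close>)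
qed

text \<open>
  The Riesz--Fischer theorem.  Along a subsequence with increments of norm at most \<open>(1/2) ^ k\<close>, the
  increments are summable almost everywhere, which provides the limit; Fatou's lemma shows that it is
  a limit in the norm.
\<close>

lemma L2_Cauchy_has_limit:
  fixes f :: "nat \<Rightarrow> real \<Rightarrow> 'e::{real_inner, complete_space}"
  assumes f: "\<And>n. f n \<in> Lp 2 0 1"
    and Cau: "\<And>e. 0 < e \<Longrightarrow> \<exists>N. \<forall>m\<ge>N. \<forall>n\<ge>N. L2_norm (\<lambda>t. f m t - f n t) < e"
  shows "\<exists>g\<in>Lp 2 0 1. (\<lambda>n. L2_norm (\<lambda>t. f n t - g t)) \<longlonglongrightarrow> 0"
proof -
  let ?M = "lebesgue_on {0..1::real}"
  have Mc: "complete_measure ?M" by (rule complete_measure_lebesgue_on) simp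
  have M1: "integral\<^sup>L ?M (\<lambda>t. c) = c" for c :: real
    by (simp add: measure_restrict_space)
  define Q where "Q k n \<longleftrightarrow> (\<forall>m\<ge>n. \<forall>m'\<ge>n. L2_norm (\<lambda>t. f m t - f m' t) < (1/2) ^ k)" for k n
  have "\<exists>r. \<forall>k. Q k (r k) \<and> r k < r (Suc k)"
  proof (rule dependent_nat_choice)
    show "\<exists>n. Q 0 n" using Cau[of 1] by (auto simp: Q_def)
    fix n k
    obtain N where "Q (Suc k) N" using Cau[of "(1/2) ^ Suc k"] by (auto simp: Q_def)
    then have "Q (Suc k) (max N (Suc n))" by (auto simp: Q_def)
    then show "\<exists>n'. Q (Suc k) n' \<and> n < n'" by (intro exI[of _ "max N (Suc n)"]) auto
  qed
  then obtain r where r: "\<And>k. Q k (r k)" "\<And>k. r k < r (Suc k)" by blast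
  have mono: "strict_mono r" using r(2) by (simp add: strict_mono_Suc_iff)
  define h where "h k t = norm (f (r (Suc k)) t - f (r k) t)" for k t
  have diff: "(\<lambda>t. f m t - f n t) \<in> Lp 2 0 1" for m n by (intro L2_diff f)
  have h_int: "integrable ?M (h k)" for k
    unfolding h_def using Lp_integrable_norm[OF diff] by simp
  have h_le: "integral\<^sup>L ?M (h k) \<le> (1/2) ^ k" for k
  proof -
    define \<epsilon> :: real where "\<epsilon> = (1/2) ^ k"
    have e: "\<epsilon> > 0" by (simp add: \<epsilon>_def)
    have sq_int: "integrable ?M (\<lambda>t. (h k t)\<^sup>2)"
      unfolding h_def using Lp_integrable_power[OF diff] by simp
    have "L2_norm (\<lambda>t. f (r (Suc k)) t - f (r k) t) \<le> \<epsilon>"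
      using r(1)[of k] r(2)[of k] by (auto simp: Q_def \<epsilon>_def intro: less_imp_le)
    then have sq: "integral\<^sup>L ?M (\<lambda>t. (h k t)\<^sup>2) \<le> \<epsilon>\<^sup>2"
      unfolding h_def L2_norm_power2[symmetric] by (intro power_mono) (auto simp: L2_norm_def)
    \<comment> \<open>Cauchy--Schwarz against the constant \<open>1\<close>, in the form of Young's inequality\<close>
    have "integral\<^sup>L ?M (h k) \<le> integral\<^sup>L ?M (\<lambda>t. (\<epsilon> + (h k t)\<^sup>2 / \<epsilon>) / 2)"
    proof (rule integral_mono[OF h_int])
      show "integrable ?M (\<lambda>t. (\<epsilon> + (h k t)\<^sup>2 / \<epsilon>) / 2)" using sq_int by simp
      fix t
      have "2 * \<epsilon> * h k t \<le> \<epsilon>\<^sup>2 + (h k t)\<^sup>2" using sum_squares_bound[of \<epsilon> "h k t"] by simp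
      then show "h k t \<le> (\<epsilon> + (h k t)\<^sup>2 / \<epsilon>) / 2" using e by (simp add: field_simps power2_eq_square)
    qed
    also have "\<dots> = (\<epsilon> + integral\<^sup>L ?M (\<lambda>t. (h k t)\<^sup>2) / \<epsilon>) / 2"
      using sq_int by (simp add: measure_restrict_space)
    also have "\<dots> \<le> (\<epsilon> + \<epsilon>\<^sup>2 / \<epsilon>) / 2"
      using sq e by (intro divide_right_mono add_left_mono) auto
    also have "\<dots> = \<epsilon>" using e by (simp add: power2_eq_square)
    finally show ?thesis by (simp add: \<epsilon>_def)
  qed
  have [measurable]: "h k \<in> borel_measurable ?M" for k using h_int by auto
  have h0: "0 \<le> h k t" for k t by (simp add: h_def)
  have "(\<integral>\<^sup>+t. (\<Sum>k. ennreal (h k t)) \<partial>?M) = (\<Sum>k. \<integral>\<^sup>+t. ennreal (h k t) \<partial>?M)"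
    by (rule nn_integral_suminf) measurable
  also have "\<dots> \<le> (\<Sum>k. ennreal ((1/2) ^ k))"
  proof (rule suminf_le)
    show "(\<integral>\<^sup>+t. ennreal (h k t) \<partial>?M) \<le> ennreal ((1/2) ^ k)" for k
      using h_le[of k] h0 by (simp add: nn_integral_eq_integral[OF h_int] ennreal_leI)
  qed auto
  also have "\<dots> = ennreal (\<Sum>k. (1/2) ^ k)"
    by (rule suminf_ennreal2) auto
  finally have "(\<integral>\<^sup>+t. (\<Sum>k. ennreal (h k t)) \<partial>?M) \<noteq> \<infinity>" by (auto simp: top_unique)
  then have "AE t in ?M. (\<Sum>k. ennreal (h k t)) \<noteq> \<infinity>"
    by (intro nn_integral_PInf_AE) auto
  then have conv: "AE t in ?M. convergent (\<lambda>k. f (r k) t)"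
  proof eventually_elim
    case (elim t)
    then have "summable (\<lambda>k. h k t)" using h0 by (intro summable_suminf_not_top) auto
    then have H: "Cauchy (\<lambda>n. \<Sum>k<n. h k t)"
      using convergent_Cauchy summable_iff_convergent by blast
    have tri: "norm (f (r m) t - f (r n) t) \<le> \<bar>(\<Sum>k<m. h k t) - (\<Sum>k<n. h k t)\<bar>" if "n \<le> m" for m n
      using that
    proof (induction m rule: dec_induct)
      case (step m)
      have "norm (f (r (Suc m)) t - f (r n) t) \<le> h m t + norm (f (r m) t - f (r n) t)"
        using norm_triangle_ineq[of "f (r (Suc m)) t - f (r m) t" "f (r m) t - f (r n) t"] by (simp add: h_def)
      moreover have "(\<Sum>k<n. h k t) \<le> (\<Sum>k<m. h k t)"
        using step.hyps h0 by (intro sum_mono2) auto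
      ultimately show ?case using step.IH h0[of m t] by simp
    qed simp
    have "Cauchy (\<lambda>n. f (r n) t)"
    proof (rule CauchyI')
      fix e :: real assume "0 < e"
      then obtain N where N: "\<And>m n. m \<ge> N \<Longrightarrow> n \<ge> N \<Longrightarrow> \<bar>(\<Sum>k<m. h k t) - (\<Sum>k<n. h k t)\<bar> < e"
        using CauchyD[OF H] by (metis real_norm_def)
      have "dist (f (r m) t) (f (r n) t) < e" if "m \<ge> N" "n > m" for m n
        using tri[of m n] N[of n m] that by (simp add: dist_norm norm_minus_commute)
      then show "\<exists>M. \<forall>m\<ge>M. \<forall>n>m. dist (f (r m) t) (f (r n) t) < e" by blast
    qed
    then show ?case by (rule Cauchy_convergent)
  qed
  define g where "g t = lim (\<lambda>k. f (r k) t)" for t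
  have lim: "AE t in ?M. (\<lambda>k. f (r k) t) \<longlonglongrightarrow> g t"
    using conv unfolding g_def by eventually_elim (simp add: convergent_LIMSEQ_iff)
  have g_sm: "strongly_measurable ?M g"
    by (rule strongly_measurable_AE_LIMSEQ[OF Mc _ lim]) (rule LpD(1)[OF f])
  have fg_sm: "strongly_measurable ?M (\<lambda>t. f n t - g t)" for n
    using strongly_measurable_add[OF LpD(1)[OF f] strongly_measurable_scaleR[OF g_sm, of "-1"]] by simp
  have est: "integrable ?M (\<lambda>t. (norm (f n t - g t))\<^sup>2) \<and> integral\<^sup>L ?M (\<lambda>t. (norm (f n t - g t))\<^sup>2) \<le> ((1/2) ^ k)\<^sup>2"
    if "n \<ge> r k" for n k
  proof (rule Fatou_integral[where h="\<lambda>j t. (norm (f n t - f (r j) t))\<^sup>2"])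
    show "integrable ?M (\<lambda>t. (norm (f n t - f (r j) t))\<^sup>2)" for j
      using Lp_integrable_power[OF diff] by simp
    show "(\<lambda>t. (norm (f n t - g t))\<^sup>2) \<in> borel_measurable ?M"
      by (intro borel_measurable_power strongly_measurable_norm Mc fg_sm)
    show "AE t in ?M. (\<lambda>j. (norm (f n t - f (r j) t))\<^sup>2) \<longlonglongrightarrow> (norm (f n t - g t))\<^sup>2"
      using lim by eventually_elim (intro tendsto_intros)
    show "\<forall>\<^sub>F j in sequentially. integral\<^sup>L ?M (\<lambda>t. (norm (f n t - f (r j) t))\<^sup>2) \<le> ((1/2) ^ k)\<^sup>2"
      using eventually_ge_at_top[of k]
    proof eventually_elim
      case (elim j)
      then have "r k \<le> r j" using mono by (simp add: strict_mono_less_eq)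
      then have "L2_norm (\<lambda>t. f n t - f (r j) t) \<le> (1/2) ^ k"
        using r(1)[of k] that by (auto simp: Q_def intro: less_imp_le)
      then show ?case unfolding L2_norm_power2[symmetric] by (intro power_mono) (auto simp: L2_norm_def)
    qed
  qed auto
  have "(\<lambda>t. f (r 0) t - g t) \<in> Lp 2 0 1" using est[of 0 "r 0"] fg_sm by (simp add: Lp_def)
  then have g: "g \<in> Lp 2 0 1" using L2_diff[OF f[of "r 0"]] by fastforce
  have "(\<lambda>n. L2_norm (\<lambda>t. f n t - g t)) \<longlonglongrightarrow> 0"
  proof (rule LIMSEQ_I)
    fix e :: real assume "0 < e"
    then obtain k where k: "(1/2) ^ k < e" using real_arch_pow_inv[of e "1/2"] by auto
    have "norm (L2_norm (\<lambda>t. f n t - g t) - 0) < e" if "n \<ge> r k" for n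
    proof -
      have "L2_norm (\<lambda>t. f n t - g t) \<le> sqrt (((1/2) ^ k)\<^sup>2)"
        unfolding L2_norm_def using est[OF that] by (intro real_sqrt_le_mono) auto
      then show ?thesis using k by (simp add: L2_norm_def)
    qed
    then show "\<exists>no. \<forall>n\<ge>no. norm (L2_norm (\<lambda>t. f n t - g t) - 0) < e" by blast
  qed
  with g show ?thesis by blast
qed

text \<open>
  Square integrable curves modulo equality almost everywhere are made a type, so that facts about
  Hilbert spaces apply to them as they stand.  On the curves themselves there is only a seminorm.
\<close>

definition L2_eq :: "(real \<Rightarrow> 'e::real_inner) \<Rightarrow> (real \<Rightarrow> 'e) \<Rightarrow> bool"
  where "L2_eq f g \<longleftrightarrow> f \<in> Lp 2 0 1 \<and> g \<in> Lp 2 0 1 \<and> (AE t in lebesgue_on {0..1}. f t = g t)"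

quotient_type (overloaded) 'e L2 = "real \<Rightarrow> 'e::real_inner" / partial: L2_eq
proof (rule part_equivpI)
  show "\<exists>f :: real \<Rightarrow> 'e. L2_eq f f" by (rule exI[of _ "\<lambda>t. 0"]) (simp add: L2_eq_def)
  show "symp (L2_eq :: (real \<Rightarrow> 'e) \<Rightarrow> _)" by (auto simp: symp_def L2_eq_def elim!: eventually_mono)
  show "transp (L2_eq :: (real \<Rightarrow> 'e) \<Rightarrow> _)"
    by (auto simp: transp_def L2_eq_def elim: eventually_elim2)
qed

instantiation L2 :: (real_inner) real_inner
begin

lift_definition zero_L2 :: "'a L2" is "\<lambda>t. 0"
  by (simp add: L2_eq_def)

lift_definition plus_L2 :: "'a L2 \<Rightarrow> 'a L2 \<Rightarrow> 'a L2" is "\<lambda>f g t. f t + g t"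
  by (auto simp: L2_eq_def intro: L2_add elim: eventually_elim2)

lift_definition minus_L2 :: "'a L2 \<Rightarrow> 'a L2 \<Rightarrow> 'a L2" is "\<lambda>f g t. f t - g t"
  by (auto simp: L2_eq_def intro: L2_diff elim: eventually_elim2)

lift_definition uminus_L2 :: "'a L2 \<Rightarrow> 'a L2" is "\<lambda>f t. - f t"
  by (auto simp: L2_eq_def intro: Lp_uminus elim: eventually_mono)

lift_definition scaleR_L2 :: "real \<Rightarrow> 'a L2 \<Rightarrow> 'a L2" is "\<lambda>c f t. c *\<^sub>R f t"
  by (auto simp: L2_eq_def intro: Lp_scaleR elim: eventually_mono)

lift_definition inner_L2 :: "'a L2 \<Rightarrow> 'a L2 \<Rightarrow> real" is
  "\<lambda>f g. integral\<^sup>L (lebesgue_on {0..1}) (\<lambda>t. f t \<bullet> g t)"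
proof -
  fix f f' g g' :: "real \<Rightarrow> 'a" assume eq: "L2_eq f f'" "L2_eq g g'"
  have "AE t in lebesgue_on {0..1}. f t = f' t" "AE t in lebesgue_on {0..1}. g t = g' t"
    using eq by (auto simp: L2_eq_def)
  then have "AE t in lebesgue_on {0..1}. f t \<bullet> g t = f' t \<bullet> g' t" by eventually_elim simp
  then show "integral\<^sup>L (lebesgue_on {0..1}) (\<lambda>t. f t \<bullet> g t) = integral\<^sup>L (lebesgue_on {0..1}) (\<lambda>t. f' t \<bullet> g' t)"
    using eq by (intro integral_cong_AE borel_measurable_integrable L2_inner_integrable) (auto simp: L2_eq_def)
qed

definition norm_L2 :: "'a L2 \<Rightarrow> real" where "norm_L2 x = sqrt (x \<bullet> x)"
definition sgn_L2 :: "'a L2 \<Rightarrow> 'a L2" where "sgn_L2 x = inverse (norm x) *\<^sub>R x"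
definition dist_L2 :: "'a L2 \<Rightarrow> 'a L2 \<Rightarrow> real" where "dist_L2 x y = norm (x - y)"
definition uniformity_L2 :: "('a L2 \<times> 'a L2) filter"
  where "uniformity_L2 = (INF e\<in>{0<..}. principal {(x, y). dist x y < e})"
definition open_L2 :: "'a L2 set \<Rightarrow> bool"
  where "open_L2 U \<longleftrightarrow> (\<forall>x\<in>U. \<forall>\<^sub>F (x', y) in uniformity. x' = x \<longrightarrow> y \<in> U)"

instance
proof
  fix x y z :: "'a L2" and a b :: real
  show "x + y + z = x + (y + z)"
    by transfer (auto simp: L2_eq_def add.assoc intro!: L2_add)
  show "x + y = y + x"
    by transfer (auto simp: L2_eq_def add.commute intro!: L2_add)
  show "0 + x = x" by transfer (auto simp: L2_eq_def)
  show "- x + x = 0" by transfer (auto simp: L2_eq_def)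
  show "x - y = x + - y" by transfer (auto simp: L2_eq_def intro!: L2_diff)
  show "a *\<^sub>R (x + y) = a *\<^sub>R x + a *\<^sub>R y"
    by transfer (auto simp: L2_eq_def scaleR_add_right intro!: L2_add Lp_scaleR)
  show "(a + b) *\<^sub>R x = a *\<^sub>R x + b *\<^sub>R x"
    by transfer (auto simp: L2_eq_def scaleR_add_left intro!: L2_add Lp_scaleR)
  show "a *\<^sub>R b *\<^sub>R x = (a * b) *\<^sub>R x"
    by transfer (auto simp: L2_eq_def intro!: Lp_scaleR)
  show "1 *\<^sub>R x = x" by transfer (auto simp: L2_eq_def)
  show "x \<bullet> y = y \<bullet> x" by transfer (simp add: inner_commute)
  show "(x + y) \<bullet> z = x \<bullet> z + y \<bullet> z"
    by transfer (auto simp: L2_eq_def inner_add_left L2_inner_integrable)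
  show "a *\<^sub>R x \<bullet> y = a * (x \<bullet> y)"
    by transfer (auto simp: L2_eq_def)
  show "0 \<le> x \<bullet> x" by transfer (auto intro!: Bochner_Integration.integral_nonneg)
  show "(x \<bullet> x = 0) = (x = 0)"
  proof transfer
    fix f :: "real \<Rightarrow> 'a" assume "L2_eq f f"
    then have f: "f \<in> Lp 2 0 1" by (simp add: L2_eq_def)
    have "integral\<^sup>L (lebesgue_on {0..1}) (\<lambda>t. f t \<bullet> f t) = 0 \<longleftrightarrow> (AE t in lebesgue_on {0..1}. f t \<bullet> f t = 0)"
      by (rule integral_nonneg_eq_0_iff_AE[OF L2_inner_integrable[OF f f]]) auto
    then show "integral\<^sup>L (lebesgue_on {0..1}) (\<lambda>t. f t \<bullet> f t) = 0 \<longleftrightarrow> L2_eq f (\<lambda>t. 0)"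
      using f by (simp add: L2_eq_def)
  qed
qed (simp_all add: norm_L2_def sgn_L2_def dist_L2_def uniformity_L2_def open_L2_def)

end

lemma L2_eq_rep: "L2_eq (rep_L2 x) (rep_L2 x)"
  using Quotient3_rep_reflp[OF Quotient3_L2] .

lemma rep_L2_in_Lp: "rep_L2 x \<in> Lp 2 0 1"
  using L2_eq_rep[of x] by (simp add: L2_eq_def)

lemma abs_rep_L2 [simp]: "abs_L2 (rep_L2 x) = x"
  by (rule Quotient3_abs_rep[OF Quotient3_L2])

lemma rep_abs_L2: "f \<in> Lp 2 0 1 \<Longrightarrow> AE t in lebesgue_on {0..1}. rep_L2 (abs_L2 f) t = f t"
  using Quotient3_rep_abs[OF Quotient3_L2, of f] by (simp add: L2_eq_def)

lemma norm_abs_L2: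
  assumes "f \<in> Lp 2 0 1" shows "norm (abs_L2 f) = L2_norm f"
proof -
  have "L2_eq f f" using assms by (simp add: L2_eq_def)
  then show ?thesis
    by (simp add: norm_L2_def inner_L2.abs_eq L2_norm_def power2_norm_eq_inner)
qed

lemma abs_L2_diff:
  "f \<in> Lp 2 0 1 \<Longrightarrow> g \<in> Lp 2 0 1 \<Longrightarrow> abs_L2 f - abs_L2 g = abs_L2 (\<lambda>t. f t - g t)"
  by (rule minus_L2.abs_eq) (auto simp: L2_eq_def)

lemma abs_L2_scaleR: "f \<in> Lp 2 0 1 \<Longrightarrow> c *\<^sub>R abs_L2 f = abs_L2 (\<lambda>t. c *\<^sub>R f t)"
  by (rule scaleR_L2.abs_eq) (auto simp: L2_eq_def)

lemma abs_L2_sum: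
  "(\<And>i. i \<in> I \<Longrightarrow> f i \<in> Lp 2 0 1) \<Longrightarrow> (\<Sum>i\<in>I. abs_L2 (f i)) = abs_L2 (\<lambda>t. \<Sum>i\<in>I. f i t)"
proof (induction I rule: infinite_finite_induct)
  case (insert i I)
  have "abs_L2 (f i) + abs_L2 (\<lambda>t. \<Sum>i\<in>I. f i t) = abs_L2 (\<lambda>t. f i t + (\<Sum>i\<in>I. f i t))"
    using insert by (intro plus_L2.abs_eq) (auto simp: L2_eq_def intro!: L2_sum)
  then show ?case using insert by simp
qed (simp_all add: zero_L2_def)

instance L2 :: ("{real_inner, complete_space}") complete_space
proof
  fix X :: "nat \<Rightarrow> 'a L2" assume X: "Cauchy X"
  have "\<exists>g\<in>Lp 2 0 1. (\<lambda>n. L2_norm (\<lambda>t. rep_L2 (X n) t - g t)) \<longlonglongrightarrow> 0"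
  proof (rule L2_Cauchy_has_limit[OF rep_L2_in_Lp])
    fix e :: real assume "0 < e"
    then obtain N where "\<forall>m\<ge>N. \<forall>n\<ge>N. norm (X m - X n) < e" using CauchyD[OF X] by blast
    moreover have "norm (X m - X n) = L2_norm (\<lambda>t. rep_L2 (X m) t - rep_L2 (X n) t)" for m n
      using abs_L2_diff[OF rep_L2_in_Lp[of "X m"] rep_L2_in_Lp[of "X n"]]
      by (simp add: norm_abs_L2 L2_diff rep_L2_in_Lp)
    ultimately show "\<exists>N. \<forall>m\<ge>N. \<forall>n\<ge>N. L2_norm (\<lambda>t. rep_L2 (X m) t - rep_L2 (X n) t) < e" by auto
  qed
  then obtain g where g: "g \<in> Lp 2 0 1" "(\<lambda>n. L2_norm (\<lambda>t. rep_L2 (X n) t - g t)) \<longlonglongrightarrow> 0" by blast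
  have "norm (X n - abs_L2 g) = L2_norm (\<lambda>t. rep_L2 (X n) t - g t)" for n
    using abs_L2_diff[OF rep_L2_in_Lp[of "X n"] g(1)]
    by (simp add: norm_abs_L2 L2_diff rep_L2_in_Lp g(1))
  then have "(\<lambda>n. norm (X n - abs_L2 g)) \<longlonglongrightarrow> 0" using g(2) by simp
  then have "(\<lambda>n. X n - abs_L2 g) \<longlonglongrightarrow> 0" by (rule tendsto_norm_zero_cancel)
  then show "convergent X" unfolding convergent_def using LIM_zero_iff[of X "abs_L2 g" sequentially] by blast
qed

section \<open>Sobolev functions on an interval\<close>

lemma integrable_on_subinterval_lebesgue:
  fixes k :: "real \<Rightarrow> real"
  assumes "integrable (lebesgue_on {a..b}) k" "a \<le> s" "t \<le> b"
  shows "k integrable_on {s..t}"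
  using integrable_on_subinterval[OF integrable_on_lebesgue_on[OF assms(1)], of s t] assms by auto

text \<open>
  The fundamental theorem of calculus for absolutely continuous functions which are differentiable
  almost everywhere.  At the exceptional points the majorant \<open>k\<close> is replaced by zero; Henstock's
  lemma then says that the intervals tagged there contribute little to the integral of \<open>k\<close>, hence
  to the increments of \<open>h\<close>.
\<close>

lemma FTC_absolutely_continuous:
  fixes h :: "real \<Rightarrow> 'b::real_normed_vector" and k :: "real \<Rightarrow> real"
  assumes ab: "a \<le> b"
    and k: "integrable (lebesgue_on {a..b}) k"
    and le: "\<And>s t. a \<le> s \<Longrightarrow> s \<le> t \<Longrightarrow> t \<le> b \<Longrightarrow> norm (h t - h s) \<le> integral {s..t} k"
    and diff: "AE t in lebesgue_on {a..b}. h differentiable (at t)"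
  shows "((\<lambda>r. vector_derivative h (at r)) has_integral (h b - h a)) {a..b}"
proof -
  define N where "N = {t \<in> {a..b}. \<not> h differentiable (at t)}"
  have N: "negligible N" using diff by (simp add: AE_lebesgue_on_iff_negligible N_def)
  define k' where "k' t = (if t \<in> N then 0 else k t)" for t
  define h' where "h' t = (if t \<in> N then 0 else vector_derivative h (at t))" for t
  have k'_int: "k' integrable_on {a..b}"
    by (rule integrable_spike[OF integrable_on_subinterval_lebesgue[OF k order.refl order.refl] N]) (simp add: k'_def)
  have k'_eq: "integral S k' = integral S k" for S
    by (rule integral_spike[OF N]) (simp add: k'_def)
  have "(h' has_integral (h b - h a)) {a..b}"
    unfolding has_integral_real
  proof (intro allI impI)
    fix e :: real assume e: "e > 0"
    define \<epsilon> where "\<epsilon> = e / (2 * (b - a + 1))"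
    have \<epsilon>: "\<epsilon> > 0" "\<epsilon> * (b - a) \<le> e / 2"
      using e ab by (auto simp: \<epsilon>_def field_simps)
    obtain \<gamma>1 where \<gamma>1: "gauge \<gamma>1" "\<And>p. p tagged_partial_division_of {a..b} \<Longrightarrow> \<gamma>1 fine p \<Longrightarrow>
        (\<Sum>(x, K)\<in>p. norm (measure lborel K *\<^sub>R k' x - integral K k')) < e / 2"
      using Henstock_lemma[of k' a b "e / 2"] k'_int e unfolding box_real by auto
    have "\<exists>d>0. x \<in> {a..b} - N \<longrightarrow> (\<forall>y. \<bar>y - x\<bar> < d \<longrightarrow> norm (h y - h x - (y - x) *\<^sub>R h' x) \<le> \<epsilon> * \<bar>y - x\<bar>)" for x
    proof (cases "x \<in> {a..b} - N")
      case True
      then have "(h has_vector_derivative h' x) (at x)"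
        by (auto simp: N_def h'_def vector_derivative_works[symmetric])
      then have "\<exists>d>0. \<forall>y. norm (y - x) < d \<longrightarrow> norm (h y - h x - (y - x) *\<^sub>R h' x) \<le> \<epsilon> * norm (y - x)"
        using \<epsilon>(1) unfolding has_vector_derivative_def has_derivative_at_alt by blast
      then show ?thesis by auto
    next
      case False
      then show ?thesis by (intro exI[of _ 1]) auto
    qed
    then obtain d where d: "\<And>x. d x > 0" "\<And>x y. x \<in> {a..b} - N \<Longrightarrow> \<bar>y - x\<bar> < d x \<Longrightarrow>
        norm (h y - h x - (y - x) *\<^sub>R h' x) \<le> \<epsilon> * \<bar>y - x\<bar>"
      by metis
    define \<gamma> where "\<gamma> x = \<gamma>1 x \<inter> ball x (d x)" for x
    have gauge: "gauge \<gamma>" unfolding \<gamma>_def using \<gamma>1(1) d(1) by (intro gauge_Int gauge_ball_dependent) auto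
    have est: "norm ((\<Sum>(x, K)\<in>D. measure lborel K *\<^sub>R h' x) - (h b - h a)) < e"
      if D: "D tagged_division_of {a..b}" "\<gamma> fine D" for D
    proof -
      have fine: "\<gamma>1 fine D" "(\<lambda>x. ball x (d x)) fine D"
        using D(2) by (auto simp: \<gamma>_def fine_def)
      have H: "(\<Sum>(x, K)\<in>D. norm (measure lborel K *\<^sub>R k' x - integral K k')) < e / 2"
        using D(1) fine(1) by (intro \<gamma>1(2)) (auto simp: tagged_division_of_def)
      have single: "norm (measure lborel K *\<^sub>R h' x - (h (Sup K) - h (Inf K)))
          \<le> norm (measure lborel K *\<^sub>R k' x - integral K k') + \<epsilon> * measure lborel K" if xK: "(x, K) \<in> D" for x K
      proof -
        obtain u v where K: "K = {u..v}" using tagged_division_ofD(4)[OF D(1) xK] by auto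
        have x: "x \<in> {u..v}" "{u..v} \<subseteq> {a..b}"
          using tagged_division_ofD(2,3)[OF D(1) xK] K by auto
        then have uv: "u \<le> v" "a \<le> u" "v \<le> b" by auto
        have ball: "{u..v} \<subseteq> ball x (d x)" using fine(2) xK K by (auto simp: fine_def)
        have cK: "measure lborel K = v - u" "Sup K = v" "Inf K = u" using uv by (simp_all add: K)
        show ?thesis
        proof (cases "x \<in> N")
          case True
          have "norm (h v - h u) \<le> integral K k'" unfolding k'_eq K using le uv by auto
          moreover have "\<epsilon> * measure lborel K \<ge> 0" using \<epsilon> uv cK by simp
          ultimately show ?thesis using True by (simp add: h'_def k'_def cK norm_minus_commute)
        next
          case False
          have xab: "x \<in> {a..b} - N" using False x by auto
          have "u \<in> ball x (d x)" "v \<in> ball x (d x)" using ball uv by auto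
          then have *: "\<bar>v - x\<bar> < d x" "\<bar>u - x\<bar> < d x" by (auto simp: dist_real_def abs_minus_commute)
          have "measure lborel K *\<^sub>R h' x - (h v - h u) = (h u - h x - (u - x) *\<^sub>R h' x) - (h v - h x - (v - x) *\<^sub>R h' x)"
            by (simp add: cK algebra_simps)
          also have "norm \<dots> \<le> \<epsilon> * \<bar>u - x\<bar> + \<epsilon> * \<bar>v - x\<bar>"
            using d(2)[OF xab *(2)] d(2)[OF xab *(1)] by (intro norm_triangle_le_diff) auto
          also have "\<dots> = \<epsilon> * measure lborel K" using x by (simp add: cK algebra_simps)
          finally show ?thesis using cK by (simp add: add_increasing)
        qed
      qed
      have "(\<Sum>(x, K)\<in>D. measure lborel K *\<^sub>R h' x) - (h b - h a)
          = (\<Sum>(x, K)\<in>D. measure lborel K *\<^sub>R h' x - (h (Sup K) - h (Inf K)))"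
        using additive_tagged_division_1[OF ab D(1), of h]
        by (simp add: split_def sum_subtractf)
      also have "norm \<dots> \<le> (\<Sum>(x, K)\<in>D. norm (measure lborel K *\<^sub>R k' x - integral K k') + \<epsilon> * measure lborel K)"
        unfolding split_def by (rule sum_norm_le) (use single in auto)
      also have "\<dots> = (\<Sum>(x, K)\<in>D. norm (measure lborel K *\<^sub>R k' x - integral K k')) + \<epsilon> * (\<Sum>(x, K)\<in>D. measure lborel K)"
        by (simp add: split_def sum.distrib sum_distrib_left)
      also have "(\<Sum>(x, K)\<in>D. measure lborel K) = b - a"
        using additive_content_tagged_division[of D a b] D(1) ab by (simp add: box_real)
      also have "(\<Sum>(x, K)\<in>D. norm (measure lborel K *\<^sub>R k' x - integral K k')) + \<epsilon> * (b - a) < e"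
        using H \<epsilon>(2) by linarith
      finally show ?thesis .
    qed
    show "\<exists>\<gamma>. gauge \<gamma> \<and> (\<forall>D. D tagged_division_of {a..b} \<and> \<gamma> fine D \<longrightarrow>
        norm ((\<Sum>(x, K)\<in>D. measure lborel K *\<^sub>R h' x) - (h b - h a)) < e)"
    proof (intro exI conjI allI impI)
      show "gauge \<gamma>" by (rule gauge)
    qed (rule est, auto)
  qed
  moreover have "vector_derivative h (at x) = h' x" if "x \<in> {a..b} - N" for x
    using that by (simp add: h'_def)
  ultimately show ?thesis using has_integral_spike[OF N, of "{a..b}" "\<lambda>r. vector_derivative h (at r)" h'] by blast
qed

lemma vector_difference_quotient:
  assumes "(f has_vector_derivative D) (at t)"
  shows "((\<lambda>s. (f (t + s) - f t) /\<^sub>R s) \<longlongrightarrow> D) (at 0)"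
proof -
  have "((\<lambda>s. norm (f (t + s) - f t - s *\<^sub>R D) / norm s) \<longlongrightarrow> 0) (at 0)"
    using assms by (simp add: has_vector_derivative_def has_derivative_at)
  moreover have "\<forall>\<^sub>F s in at 0. norm (f (t + s) - f t - s *\<^sub>R D) / norm s = norm ((f (t + s) - f t) /\<^sub>R s - D)"
    unfolding eventually_at_filter
  proof (intro always_eventually allI impI)
    fix s :: real assume "s \<noteq> 0"
    then have "(f (t + s) - f t) /\<^sub>R s - D = (f (t + s) - f t - s *\<^sub>R D) /\<^sub>R s"
      by (simp add: scaleR_diff_right)
    then show "norm (f (t + s) - f t - s *\<^sub>R D) / norm s = norm ((f (t + s) - f t) /\<^sub>R s - D)"
      by (simp add: divide_inverse mult.commute)
  qed
  ultimately have "((\<lambda>s. norm ((f (t + s) - f t) /\<^sub>R s - D)) \<longlongrightarrow> 0) (at 0)"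
    by (rule Lim_transform_eventually)
  then have "((\<lambda>s. (f (t + s) - f t) /\<^sub>R s - D) \<longlongrightarrow> 0) (at 0)"
    by (rule tendsto_norm_zero_cancel)
  then show ?thesis by (rule LIM_zero_cancel)
qed

text \<open>
  Derivatives are limits of difference quotients; the base point of the quotients may enter the
  differentiated function as a parameter.
\<close>

lemma strongly_measurable_diagonal_derivative:
  fixes h :: "real \<Rightarrow> real \<Rightarrow> 'b::real_normed_vector"
  assumes h: "continuous_on ({a..b} \<times> {a..b}) (\<lambda>(s, t). h s t)"
    and diff: "AE t in lebesgue_on {a..b}. (\<lambda>s. h s t) differentiable (at t)"
  shows "strongly_measurable (lebesgue_on {a..b}) (\<lambda>t. vector_derivative (\<lambda>s. h s t) (at t))"
proof (rule strongly_measurable_AE_LIMSEQ)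
  define u where "u n t = real (Suc n) *\<^sub>R (h (min (t + 1 / real (Suc n)) b) t - h t t)" for n t
  show "complete_measure (lebesgue_on {a..b})" by (rule complete_measure_lebesgue_on) simp
  have hc: "continuous_on {a..b} (\<lambda>t. h (\<tau> t) t)"
    if "continuous_on {a..b} \<tau>" "\<tau> ` {a..b} \<subseteq> {a..b}" for \<tau>
  proof -
    have "continuous_on {a..b} (\<lambda>t. (\<tau> t, t))" using that(1) by (intro continuous_intros)
    moreover have "(\<lambda>t. (\<tau> t, t)) ` {a..b} \<subseteq> {a..b} \<times> {a..b}" using that(2) by auto
    ultimately show ?thesis using continuous_on_compose2[OF h, of "{a..b}" "\<lambda>t. (\<tau> t, t)"] by simp
  qed
  show "strongly_measurable (lebesgue_on {a..b}) (u n)" for n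
    unfolding u_def
    by (intro strongly_measurable_continuous_on continuous_intros hc)
      (auto simp: min_def intro!: add_increasing2 divide_nonneg_nonneg)
  have "AE t in lebesgue_on {a..b}. a < t \<and> t < b" by (rule AE_lebesgue_on_interior) auto
  then show "AE t in lebesgue_on {a..b}. (\<lambda>n. u n t) \<longlonglongrightarrow> vector_derivative (\<lambda>s. h s t) (at t)"
    using diff
  proof eventually_elim
    case (elim t)
    then have D: "((\<lambda>s. h s t) has_vector_derivative vector_derivative (\<lambda>s. h s t) (at t)) (at t)"
      by (simp add: vector_derivative_works[symmetric])
    have f: "filterlim (\<lambda>n. inverse (real (Suc n))) (at 0) sequentially"
      using LIMSEQ_inverse_real_of_nat by (simp add: filterlim_at)
    have "((\<lambda>s. (h (t + s) t - h t t) /\<^sub>R s) \<longlongrightarrow> vector_derivative (\<lambda>s. h s t) (at t)) (at 0)"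
      by (rule vector_difference_quotient[OF D])
    then have "(\<lambda>n. (h (t + inverse (real (Suc n))) t - h t t) /\<^sub>R inverse (real (Suc n)))
        \<longlonglongrightarrow> vector_derivative (\<lambda>s. h s t) (at t)"
      by (rule filterlim_compose[OF _ f])
    moreover have "\<forall>\<^sub>F n in sequentially. inverse (real (Suc n)) < b - t"
      using LIMSEQ_inverse_real_of_nat elim by (intro order_tendstoD) auto
    then have "\<forall>\<^sub>F n in sequentially. u n t = (h (t + inverse (real (Suc n))) t - h t t) /\<^sub>R inverse (real (Suc n))"
      by eventually_elim (simp add: u_def min_def divide_inverse)
    ultimately show ?case by (simp add: tendsto_cong)
  qed
qed

lemma strongly_measurable_vector_derivative:
  fixes h :: "real \<Rightarrow> 'b::real_normed_vector"
  assumes "continuous_on {a..b} h" "AE t in lebesgue_on {a..b}. h differentiable (at t)"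
  shows "strongly_measurable (lebesgue_on {a..b}) (\<lambda>t. vector_derivative h (at t))"
proof (rule strongly_measurable_diagonal_derivative[where h="\<lambda>s t. h s"])
  show "continuous_on ({a..b} \<times> {a..b}) (\<lambda>(s, t). h s)"
    unfolding split_def
    by (rule continuous_on_compose2[OF assms(1)]) (auto intro!: continuous_intros)
qed (rule assms(2))

lemma W1pD:
  assumes "f \<in> W1p p a b"
  shows W1p_differentiable: "AE t in lebesgue_on {a..b}. f differentiable (at t)"
    and W1p_derivative_Lp: "(\<lambda>t. vector_derivative f (at t)) \<in> Lp p a b"
    and W1p_FTC: "\<And>s t. a \<le> s \<Longrightarrow> s \<le> t \<Longrightarrow> t \<le> b \<Longrightarrow>
      ((\<lambda>r. vector_derivative f (at r)) has_integral (f t - f s)) {s..t}"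
  using assms by (auto simp: W1p_def)

lemma W1p_derivative_integrable:
  "f \<in> W1p p a b \<Longrightarrow> 1 \<le> p \<Longrightarrow> integrable (lebesgue_on {a..b}) (\<lambda>t. norm (vector_derivative f (at t)))"
  by (intro Lp_integrable_norm W1pD)

text \<open>
  The norm of the increment is its inner product with a unit vector, which reduces the estimate to
  real integrals.
\<close>

lemma W1p_increment:
  fixes f :: "real \<Rightarrow> 'e::real_inner"
  assumes f: "f \<in> W1p p a b" "1 \<le> p" and st: "a \<le> s" "s \<le> t" "t \<le> b"
  shows "norm (f t - f s) \<le> integral {s..t} (\<lambda>r. norm (vector_derivative f (at r)))"
proof -
  define v where "v = f t - f s"
  let ?k = "\<lambda>r. norm (vector_derivative f (at r))"
  have k: "?k integrable_on {s..t}"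
    by (rule integrable_on_subinterval_lebesgue[OF W1p_derivative_integrable[OF f] st(1,3)])
  have "((\<lambda>x. x \<bullet> v) \<circ> (\<lambda>r. vector_derivative f (at r)) has_integral (v \<bullet> v)) {s..t}"
    unfolding v_def by (rule has_integral_linear[OF W1p_FTC[OF f(1) st] bounded_linear_inner_left])
  moreover have "((\<lambda>r. norm v * ?k r) has_integral (norm v * integral {s..t} ?k)) {s..t}"
    using k by (intro has_integral_mult_right) (simp add: integrable_integral)
  ultimately have "v \<bullet> v \<le> norm v * integral {s..t} ?k"
  proof (rule has_integral_le)
    fix r
    show "((\<lambda>x. x \<bullet> v) \<circ> (\<lambda>r. vector_derivative f (at r))) r \<le> norm v * ?k r"
      using norm_cauchy_schwarz[of "vector_derivative f (at r)" v] by (simp add: mult.commute)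
  qed
  then have "norm v * norm v \<le> norm v * integral {s..t} ?k"
    by (simp add: power2_norm_eq_inner[symmetric] power2_eq_square)
  then show ?thesis
    using integral_nonneg[OF k] by (cases "v = 0") (auto simp: v_def[symmetric])
qed

lemma W1p_continuous_on:
  fixes f :: "real \<Rightarrow> 'e::real_inner"
  assumes f: "f \<in> W1p p a b" "1 \<le> p"
  shows "continuous_on {a..b} f"
proof -
  let ?k = "\<lambda>r. norm (vector_derivative f (at r))"
  define \<Phi> where "\<Phi> t = integral {a..t} ?k" for t
  have k: "?k integrable_on {a..b}"
    by (rule integrable_on_subinterval_lebesgue[OF W1p_derivative_integrable[OF f]]) auto
  then have \<Phi>: "continuous_on {a..b} \<Phi>" unfolding \<Phi>_def by (rule indefinite_integral_continuous_1)
  have le: "norm (f t - f s) \<le> \<bar>\<Phi> t - \<Phi> s\<bar>" if "s \<in> {a..b}" "t \<in> {a..b}" "s \<le> t" for s t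
  proof -
    have "\<Phi> s + integral {s..t} ?k = \<Phi> t"
      unfolding \<Phi>_def using that integrable_on_subinterval[OF k, of a t]
      by (intro Henstock_Kurzweil_Integration.integral_combine) auto
    then show ?thesis using W1p_increment[OF f, of s t] that by auto
  qed
  have le': "norm (f t - f s) \<le> \<bar>\<Phi> t - \<Phi> s\<bar>" if "s \<in> {a..b}" "t \<in> {a..b}" for s t
    using le[of s t] le[of t s] that by (cases "s \<le> t") (auto simp: norm_minus_commute abs_minus_commute)
  show ?thesis
    unfolding continuous_on_iff
  proof (intro ballI allI impI)
    fix x e :: real assume "x \<in> {a..b}" "0 < e"
    then obtain d where "d > 0" "\<forall>x'\<in>{a..b}. dist x' x < d \<longrightarrow> dist (\<Phi> x') (\<Phi> x) < e"
      using \<Phi> unfolding continuous_on_iff by blast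
    moreover have "dist (f x') (f x) \<le> dist (\<Phi> x') (\<Phi> x)" if "x' \<in> {a..b}" for x'
      using le'[OF \<open>x \<in> {a..b}\<close> that] by (simp add: dist_norm)
    ultimately show "\<exists>d>0. \<forall>x'\<in>{a..b}. dist x' x < d \<longrightarrow> dist (f x') (f x) < e"
      by (meson le_less_trans)
  qed
qed

text \<open>
  The derivative of \<open>f\<close> dominates both the derivative of \<open>h\<close>, which is therefore in \<open>L\<^sup>p\<close>, and, after
  integration, the increments of \<open>h\<close>, as required by the fundamental theorem.
\<close>

lemma W1pI_Lipschitz:
  fixes f :: "real \<Rightarrow> 'e::real_inner" and h :: "real \<Rightarrow> 'b::real_inner"
  assumes f: "f \<in> W1p p a b" "1 \<le> p"
    and lip: "\<And>s t. a \<le> s \<Longrightarrow> s \<le> t \<Longrightarrow> t \<le> b \<Longrightarrow> norm (h t - h s) \<le> K * norm (f t - f s)"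
    and diff: "AE t in lebesgue_on {a..b}. h differentiable (at t)"
  shows "h \<in> W1p p a b"
proof -
  let ?k = "\<lambda>r. norm (vector_derivative f (at r))"
  define K' where "K' = max K 0"
  have K': "0 \<le> K'" by (simp add: K'_def)
  have lip': "norm (h t - h s) \<le> K' * norm (f t - f s)" if "s \<in> {a..b}" "t \<in> {a..b}" for s t
  proof -
    have "K * norm (f t - f s) \<le> K' * norm (f t - f s)" by (intro mult_right_mono) (auto simp: K'_def)
    then show ?thesis using lip[of s t] lip[of t s] that
      by (cases "s \<le> t") (auto simp: norm_minus_commute)
  qed
  have hc: "continuous_on {a..b} h"
    unfolding continuous_on_iff
  proof (intro ballI allI impI)
    fix x e :: real assume x: "x \<in> {a..b}" and e: "0 < e"
    then obtain d where d: "d > 0" "\<forall>x'\<in>{a..b}. dist x' x < d \<longrightarrow> dist (f x') (f x) < e / (K' + 1)"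
      using W1p_continuous_on[OF f] K' unfolding continuous_on_iff
      by (metis add_nonneg_pos zero_less_divide_iff zero_less_one)
    have "dist (h x') (h x) < e" if "x' \<in> {a..b}" "dist x' x < d" for x'
    proof -
      have "norm (h x' - h x) \<le> (K' + 1) * norm (f x' - f x)"
        using lip'[OF x that(1)] norm_ge_zero[of "f x' - f x"] unfolding distrib_right by linarith
      also have "\<dots> < e" using d(2) that K' by (auto simp: dist_norm field_simps)
      finally show ?thesis by (simp add: dist_norm)
    qed
    then show "\<exists>d>0. \<forall>x'\<in>{a..b}. dist x' x < d \<longrightarrow> dist (h x') (h x) < e" using d(1) by blast
  qed
  have sm: "strongly_measurable (lebesgue_on {a..b}) (\<lambda>t. vector_derivative h (at t))"
    by (rule strongly_measurable_vector_derivative[OF hc diff])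
  have "AE t in lebesgue_on {a..b}. a < t \<and> t < b" by (rule AE_lebesgue_on_interior) auto
  then have "AE t in lebesgue_on {a..b}. norm (vector_derivative h (at t)) \<le> K' * ?k t"
    using diff W1p_differentiable[OF f(1)]
  proof eventually_elim
    case (elim t)
    have lim: "((\<lambda>s. norm ((g (t + s) - g t) /\<^sub>R s)) \<longlongrightarrow> norm (vector_derivative g (at t))) (at 0)"
      if "g differentiable (at t)" for g :: "real \<Rightarrow> 'x::real_normed_vector"
      by (intro tendsto_norm vector_difference_quotient) (use that in \<open>simp add: vector_derivative_works\<close>)
    show ?case
    proof (rule tendsto_le[OF _ _ lim[OF elim(2)]])
      show "((\<lambda>s. K' * norm ((f (t + s) - f t) /\<^sub>R s)) \<longlongrightarrow> K' * norm (vector_derivative f (at t))) (at 0)"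
        by (intro tendsto_intros lim elim(3))
      have "\<forall>\<^sub>F s in at 0. s \<in> {a - t<..<b - t} - {0}"
        using elim(1) by (intro eventually_at_in_open) auto
      then show "\<forall>\<^sub>F s in at 0. norm ((h (t + s) - h t) /\<^sub>R s) \<le> K' * norm ((f (t + s) - f t) /\<^sub>R s)"
      proof eventually_elim
        case (elim s)
        then have "norm (h (t + s) - h t) \<le> K' * norm (f (t + s) - f t)"
          using \<open>a < t \<and> t < b\<close> by (intro lip') auto
        then have "inverse \<bar>s\<bar> * norm (h (t + s) - h t) \<le> inverse \<bar>s\<bar> * (K' * norm (f (t + s) - f t))"
          by (rule mult_left_mono) simp
        then show ?case by (simp add: mult.left_commute)
      qed
    qed simp
  qed
  then have Lp: "(\<lambda>t. vector_derivative h (at t)) \<in> Lp p a b"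
    by (rule Lp_bound[OF W1p_derivative_Lp[OF f(1)] sm])
  have int: "integrable (lebesgue_on {a..b}) (\<lambda>r. K' * ?k r)"
    using W1p_derivative_integrable[OF f] by simp
  have "((\<lambda>r. vector_derivative h (at r)) has_integral (h t - h s)) {s..t}"
    if st: "a \<le> s" "s \<le> t" "t \<le> b" for s t
  proof (rule FTC_absolutely_continuous[OF st(2)])
    show "integrable (lebesgue_on {s..t}) (\<lambda>r. K' * ?k r)"
      using integrable_subinterval[OF int, of s t] st by auto
    show "AE t in lebesgue_on {s..t}. h differentiable at t"
      using diff by (rule AE_lebesgue_on_subinterval) (use st in auto)
    fix u v assume uv: "s \<le> u" "u \<le> v" "v \<le> t"
    then have "norm (h v - h u) \<le> K' * norm (f v - f u)" using st by (intro lip') auto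
    also have "\<dots> \<le> K' * integral {u..v} ?k"
      using uv st K' by (intro mult_left_mono W1p_increment[OF f]) auto
    finally show "norm (h v - h u) \<le> integral {u..v} (\<lambda>r. K' * ?k r)" by simp
  qed
  then show ?thesis using diff Lp by (auto simp: W1p_def)
qed

lemma vector_derivative_cong_interval:
  fixes f g :: "real \<Rightarrow> 'e::real_normed_vector"
  assumes eq: "\<And>t. t \<in> {a..b} \<Longrightarrow> f t = g t" and t: "a < t" "t < b"
  shows "f differentiable (at t) \<longleftrightarrow> g differentiable (at t)"
    and "vector_derivative f (at t) = vector_derivative g (at t)"
proof -
  have iff: "(f has_vector_derivative D) (at t) \<longleftrightarrow> (g has_vector_derivative D) (at t)" for D
    using has_vector_derivative_transform_within_open[of f D t "{a<..<b}" g]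
      has_vector_derivative_transform_within_open[of g D t "{a<..<b}" f] eq t by auto
  show "vector_derivative f (at t) = vector_derivative g (at t)"
    unfolding vector_derivative_def iff ..
  then show "f differentiable (at t) \<longleftrightarrow> g differentiable (at t)"
    unfolding vector_derivative_works iff by simp
qed

lemma W1p_cong:
  fixes f g :: "real \<Rightarrow> 'e::real_normed_vector"
  assumes f: "f \<in> W1p p a b" and eq: "\<And>t. t \<in> {a..b} \<Longrightarrow> f t = g t"
  shows "g \<in> W1p p a b"
proof -
  have ae: "AE t in lebesgue_on {a..b}. (f differentiable (at t) \<longleftrightarrow> g differentiable (at t)) \<and>
      vector_derivative f (at t) = vector_derivative g (at t)"
    by (rule AE_lebesgue_on_interior) (use vector_derivative_cong_interval[of a b f g] eq in blast)
  have "AE t in lebesgue_on {a..b}. g differentiable (at t)"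
    using ae W1p_differentiable[OF f] by eventually_elim simp
  moreover have "(\<lambda>t. vector_derivative g (at t)) \<in> Lp p a b"
    by (rule Lp_cong_AE[OF W1p_derivative_Lp[OF f]]) (use ae in \<open>eventually_elim, simp\<close>)
  moreover have "((\<lambda>r. vector_derivative g (at r)) has_integral (g t - g s)) {s..t}"
    if st: "a \<le> s" "s \<le> t" "t \<le> b" for s t
  proof -
    have "((\<lambda>r. vector_derivative f (at r)) has_integral (g t - g s)) {s..t}"
      using W1p_FTC[OF f st] eq[of s] eq[of t] st by simp
    then show ?thesis
    proof (rule has_integral_spike[of "{s, t}", rotated 2])
      show "vector_derivative g (at x) = vector_derivative f (at x)" if "x \<in> {s..t} - {s, t}" for x
        using vector_derivative_cong_interval(2)[of a b f g x] eq that st by auto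
    qed simp
  qed
  ultimately show ?thesis by (auto simp: W1p_def)
qed

lemma W1p_subinterval:
  assumes f: "f \<in> W1p p a b" and sub: "{c..d} \<subseteq> {a..b}"
  shows "f \<in> W1p p c d"
  using AE_lebesgue_on_subinterval[OF W1p_differentiable[OF f] sub] Lp_subinterval[OF W1p_derivative_Lp[OF f] sub]
    W1p_FTC[OF f] sub
  unfolding W1p_def by (auto simp: atLeastatMost_subset_iff)

lemma W1p_combine:
  fixes f :: "real \<Rightarrow> 'e::real_inner"
  assumes f: "f \<in> W1p p a b" "f \<in> W1p p b c" and p: "1 \<le> p" and ab: "a \<le> b" "b \<le> c"
  shows "f \<in> W1p p a c"
proof -
  let ?k = "\<lambda>r. norm (vector_derivative f (at r))"
  have diff: "AE t in lebesgue_on {a..c}. f differentiable (at t)"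
    by (rule AE_lebesgue_on_combine[OF f[THEN W1p_differentiable]])
  have Lp: "(\<lambda>t. vector_derivative f (at t)) \<in> Lp p a c"
    by (rule Lp_combine[OF f[THEN W1p_derivative_Lp] ab])
  have int: "integrable (lebesgue_on {a..c}) ?k" by (rule Lp_integrable_norm[OF Lp p])
  have incr: "norm (f t - f s) \<le> integral {s..t} ?k" if st: "a \<le> s" "s \<le> t" "t \<le> c" for s t
  proof -
    consider "t \<le> b" | "b \<le> s" | "s \<le> b" "b \<le> t" by linarith
    then show ?thesis
    proof cases
      case 3
      have "norm (f t - f s) \<le> norm (f t - f b) + norm (f b - f s)"
        using norm_triangle_ineq[of "f t - f b" "f b - f s"] by simp
      also have "\<dots> \<le> integral {b..t} ?k + integral {s..b} ?k"
        using 3 st by (intro add_mono W1p_increment[OF f(1) p] W1p_increment[OF f(2) p]) auto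
      also have "\<dots> = integral {s..t} ?k"
        using 3 st Henstock_Kurzweil_Integration.integral_combine[of s b t ?k]
          integrable_on_subinterval_lebesgue[OF int, of s t] by simp
      finally show ?thesis .
    qed (use W1p_increment[OF f(1) p, of s t] W1p_increment[OF f(2) p, of s t] st in auto)
  qed
  have "((\<lambda>r. vector_derivative f (at r)) has_integral (f t - f s)) {s..t}"
    if st: "a \<le> s" "s \<le> t" "t \<le> c" for s t
  proof (rule FTC_absolutely_continuous[OF st(2)])
    show "integrable (lebesgue_on {s..t}) ?k" using integrable_subinterval[OF int, of s t] st by auto
    show "AE t in lebesgue_on {s..t}. f differentiable at t"
      using diff by (rule AE_lebesgue_on_subinterval) (use st in auto)
  qed (use incr st in auto)
  then show ?thesis using diff Lp by (auto simp: W1p_def)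
qed

lemma vector_derivative_affine:
  fixes f :: "real \<Rightarrow> 'e::real_normed_vector"
  assumes "f differentiable (at (d + c * t))"
  shows "((\<lambda>t. f (d + c * t)) has_vector_derivative c *\<^sub>R vector_derivative f (at (d + c * t))) (at t)"
proof -
  have "((\<lambda>t. d + c * t) has_vector_derivative c) (at t)"
    by (auto intro!: derivative_eq_intros simp: has_vector_derivative_def mult.commute)
  moreover have "(f has_vector_derivative vector_derivative f (at (d + c * t))) (at (d + c * t))"
    using assms by (simp add: vector_derivative_works)
  ultimately have "(f \<circ> (\<lambda>t. d + c * t) has_vector_derivative c *\<^sub>R vector_derivative f (at (d + c * t))) (at t)"
    by (rule vector_diff_chain_at)
  then show ?thesis by (simp add: o_def)
qed

lemma W1p_affine:
  fixes f :: "real \<Rightarrow> 'e::real_normed_vector"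
  assumes f: "f \<in> W1p p (d + c * a) (d + c * b)" and c: "0 < c"
  shows "(\<lambda>t. f (d + c * t)) \<in> W1p p a b"
proof -
  let ?g = "\<lambda>t. f (d + c * t)"
  have diff: "AE t in lebesgue_on {a..b}. f differentiable (at (d + c * t))"
    by (rule AE_lebesgue_on_affine[OF W1p_differentiable[OF f] c])
  then have ae: "AE t in lebesgue_on {a..b}. c *\<^sub>R vector_derivative f (at (d + c * t)) = vector_derivative ?g (at t)"
    by eventually_elim (rule vector_derivative_at[OF vector_derivative_affine, symmetric])
  have "AE t in lebesgue_on {a..b}. ?g differentiable (at t)"
    using diff by eventually_elim (rule differentiableI_vector[OF vector_derivative_affine])
  moreover have "(\<lambda>t. vector_derivative ?g (at t)) \<in> Lp p a b"
    by (rule Lp_cong_AE[OF Lp_scaleR[OF Lp_affine[OF W1p_derivative_Lp[OF f] c]] ae])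
  moreover have "((\<lambda>r. vector_derivative ?g (at r)) has_integral (?g t - ?g s)) {s..t}"
    if st: "a \<le> s" "s \<le> t" "t \<le> b" for s t
  proof -
    let ?N = "{x \<in> {a..b}. \<not> c *\<^sub>R vector_derivative f (at (d + c * x)) = vector_derivative ?g (at x)}"
    have N: "negligible ?N" using ae by (simp add: AE_lebesgue_on_iff_negligible)
    have "((\<lambda>r. vector_derivative f (at r)) has_integral (?g t - ?g s)) (cbox (d + c * s) (d + c * t))"
      using W1p_FTC[OF f, of "d + c * s" "d + c * t"] st c by simp
    from has_integral_affinity[OF this, of c d]
    have A: "((\<lambda>r. vector_derivative f (at (d + c * r))) has_integral (1 / c) *\<^sub>R (?g t - ?g s))
        ((\<lambda>x. x / c - d / c) ` {d + c * s..d + c * t})"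
      using c by (simp add: add.commute)
    have I: "(\<lambda>x. x / c - d / c) ` {d + c * s..d + c * t} = {s..t}"
    proof -
      have "x \<in> (\<lambda>x. x / c - d / c) ` {d + c * s..d + c * t}" if "x \<in> {s..t}" for x
        using that c by (intro image_eqI[of _ _ "d + c * x"]) (auto simp: field_simps)
      then show ?thesis using c by (auto simp: field_simps)
    qed
    have B: "((\<lambda>r. c *\<^sub>R vector_derivative f (at (d + c * r))) has_integral c *\<^sub>R (1 / c) *\<^sub>R (?g t - ?g s)) {s..t}"
      by (rule has_integral_cmul[OF A[unfolded I]])
    have "((\<lambda>r. vector_derivative ?g (at r)) has_integral c *\<^sub>R (1 / c) *\<^sub>R (?g t - ?g s)) {s..t}"
    proof (rule has_integral_spike[OF N _ B])
      show "vector_derivative ?g (at x) = c *\<^sub>R vector_derivative f (at (d + c * x))" if "x \<in> {s..t} - ?N" for x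
        using that st by auto
    qed
    then show ?thesis using c by simp
  qed
  ultimately show ?thesis by (auto simp: W1p_def)
qed

lemma W1p_line: "(\<lambda>t. u + (t * m) *\<^sub>R v) \<in> W1p p a b"
proof -
  have D: "((\<lambda>t. u + (t * m) *\<^sub>R v) has_vector_derivative m *\<^sub>R v) (at t)" for t
    by (auto intro!: derivative_eq_intros simp: has_vector_derivative_def)
  then have eq: "vector_derivative (\<lambda>t. u + (t * m) *\<^sub>R v) (at t) = m *\<^sub>R v" for t
    by (rule vector_derivative_at)
  have "((\<lambda>r. m *\<^sub>R v) has_integral (u + (t * m) *\<^sub>R v - (u + (s * m) *\<^sub>R v))) {s..t}" if "s \<le> t" for s t
    using has_integral_const_real[of "m *\<^sub>R v" s t] that by (simp add: algebra_simps)
  then show ?thesis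
    unfolding W1p_def eq using differentiableI_vector[OF D] by auto
qed

lemma W1p_const [simp]: "(\<lambda>t. u) \<in> W1p p a b"
  using W1p_line[of u 0 0 p a b] by simp

lemma W1p_exponent:
  "f \<in> W1p q a b \<Longrightarrow> (\<lambda>t. vector_derivative f (at t)) \<in> Lp p a b \<Longrightarrow> f \<in> W1p p a b"
  by (simp add: W1p_def)

lemma W1p_imp_W11: "f \<in> W1p p a b \<Longrightarrow> 1 \<le> p \<Longrightarrow> f \<in> W1p 1 a b"
  by (rule W1p_exponent) (auto intro: Lp_imp_L1[simplified] W1pD)

definition locally_Lipschitz_on :: "'a::real_normed_vector set \<Rightarrow> ('a \<Rightarrow> 'b::real_normed_vector) \<Rightarrow> bool"
  where "locally_Lipschitz_on S F \<longleftrightarrow>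
    (\<forall>y\<in>S. \<exists>\<delta>>0. \<exists>K. \<forall>u\<in>ball y \<delta> \<inter> S. \<forall>v\<in>ball y \<delta> \<inter> S. norm (F u - F v) \<le> K * norm (u - v))"

text \<open>
  Curves in a manifold can be described in one chart near each parameter only.  This form of Bolzano's
  principle extends what holds there to compact intervals.
\<close>

lemma interval_localization:
  fixes P :: "real \<Rightarrow> real \<Rightarrow> bool"
  assumes ab: "a \<le> b"
    and trans: "\<And>c d e. a \<le> c \<Longrightarrow> c \<le> d \<Longrightarrow> d \<le> e \<Longrightarrow> e \<le> b \<Longrightarrow> P c d \<Longrightarrow> P d e \<Longrightarrow> P c e"
    and local: "\<And>x. x \<in> {a..b} \<Longrightarrow> \<exists>\<delta>>0. \<forall>c d. a \<le> c \<and> c \<le> x \<and> x \<le> d \<and> d \<le> b \<and> d - c < \<delta> \<longrightarrow> P c d"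
  shows "P a b"
proof -
  have "a \<le> a \<and> b \<le> b \<longrightarrow> P a b"
  proof (rule Bolzano[where P="\<lambda>c d. a \<le> c \<and> d \<le> b \<longrightarrow> P c d", OF ab])
    show "a \<le> c \<and> e \<le> b \<longrightarrow> P c e"
      if "a \<le> c \<and> d \<le> b \<longrightarrow> P c d" "a \<le> d \<and> e \<le> b \<longrightarrow> P d e" "c \<le> d" "d \<le> e" for c d e
      using trans[of c d e] that by linarith
    show "\<exists>\<delta>>0. \<forall>c d. c \<le> x \<and> x \<le> d \<and> d - c < \<delta> \<longrightarrow> a \<le> c \<and> d \<le> b \<longrightarrow> P c d" if "a \<le> x" "x \<le> b" for x
      using local[of x] that by auto
  qed
  then show ?thesis by simp
qed

text \<open>
  Near each parameter one Lipschitz constant of \<open>F\<close> suffices.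
\<close>

lemma W1p_compose:
  fixes f :: "real \<Rightarrow> 'e::real_inner" and F :: "'e \<Rightarrow> 'b::real_inner"
  assumes f: "f \<in> W1p p a b" "1 \<le> p" and ab: "a \<le> b" and im: "f ` {a..b} \<subseteq> S"
    and F: "\<And>y. y \<in> S \<Longrightarrow> F differentiable (at y)" "locally_Lipschitz_on S F"
  shows "F \<circ> f \<in> W1p p a b"
proof -
  show ?thesis
    using ab
  proof (rule interval_localization)
    show "F \<circ> f \<in> W1p p c e" if "c \<le> d" "d \<le> e" "F \<circ> f \<in> W1p p c d" "F \<circ> f \<in> W1p p d e" for c d e
      using W1p_combine[of "F \<circ> f" p c d e] f(2) that by blast
  next
    fix x assume x: "x \<in> {a..b}"
    obtain \<delta> K where \<delta>: "\<delta> > 0" "\<And>u v. u \<in> ball (f x) \<delta> \<inter> S \<Longrightarrow> v \<in> ball (f x) \<delta> \<inter> S \<Longrightarrow> norm (F u - F v) \<le> K * norm (u - v)"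
      using F(2) im x unfolding locally_Lipschitz_on_def by blast
    obtain d where d: "d > 0" "\<forall>x'\<in>{a..b}. dist x' x < d \<longrightarrow> dist (f x') (f x) < \<delta>"
      using W1p_continuous_on[OF f] x \<delta>(1) unfolding continuous_on_iff by blast
    have "F \<circ> f \<in> W1p p c e" if ce: "c \<le> x" "x \<le> e" "e - c < d" "a \<le> c" "e \<le> b" for c e
    proof (rule W1pI_Lipschitz[OF W1p_subinterval[OF f(1)] f(2)])
      show "{c..e} \<subseteq> {a..b}" using ce by auto
      fix s t assume st: "c \<le> s" "s \<le> t" "t \<le> e"
      then have "dist s x < d" "dist t x < d" "s \<in> {a..b}" "t \<in> {a..b}"
        using ce by (auto simp: dist_real_def)
      then have "f s \<in> ball (f x) \<delta> \<inter> S" "f t \<in> ball (f x) \<delta> \<inter> S"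
        using d(2) im by (auto simp: dist_commute)
      then show "norm ((F \<circ> f) t - (F \<circ> f) s) \<le> K * norm (f t - f s)" using \<delta>(2) by simp
    next
      have "AE t in lebesgue_on {a..b}. t \<in> {a..b}" using AE_space[of "lebesgue_on {a..b}"] by simp
      then have "AE t in lebesgue_on {a..b}. (F \<circ> f) differentiable at t"
        using W1p_differentiable[OF f(1)] by eventually_elim (intro differentiable_chain_at F(1) subsetD[OF im] imageI)
      then show "AE t in lebesgue_on {c..e}. (F \<circ> f) differentiable at t"
        by (rule AE_lebesgue_on_subinterval) (use ce in auto)
    qed
    then show "\<exists>d>0. \<forall>c e. a \<le> c \<and> c \<le> x \<and> x \<le> e \<and> e \<le> b \<and> e - c < d \<longrightarrow> F \<circ> f \<in> W1p p c e"
      using d(1) by blast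
  qed
qed

section \<open>Calculus of class $C^2$\<close>

text \<open>
  The condition on the witness in \<open>Ck_on\<close>, so that the derivatives get a name.
\<close>

definition derivative_tower ::
    "nat \<Rightarrow> 'a::real_normed_vector set \<Rightarrow> ('a \<Rightarrow> 'b::real_normed_vector) \<Rightarrow> (nat \<Rightarrow> 'a \<Rightarrow> 'a list \<Rightarrow> 'b) \<Rightarrow> bool"
  where "derivative_tower k S f D \<longleftrightarrow>
    (\<forall>x\<in>S. D 0 x [] = f x) \<and>
    (\<forall>j\<le>k. \<forall>x\<in>S. bounded_multilinear j (D j x)) \<and>
    (\<forall>j<k. \<forall>x\<in>S. \<forall>\<epsilon>>0. \<forall>\<^sub>F y in at x within S. \<forall>vs. length vs = j \<longrightarrow>
       norm (D j y vs - D j x vs - D (Suc j) x ((y - x) # vs))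
         \<le> \<epsilon> * norm (y - x) * (\<Prod>v\<leftarrow>vs. norm v)) \<and>
    (\<forall>x\<in>S. \<forall>\<epsilon>>0. \<forall>\<^sub>F y in at x within S. \<forall>vs. length vs = k \<longrightarrow>
       norm (D k y vs - D k x vs) \<le> \<epsilon> * (\<Prod>v\<leftarrow>vs. norm v))"

lemma Ck_on_iff_tower: "Ck_on k S f \<longleftrightarrow> (\<exists>D. derivative_tower k S f D)"
  unfolding Ck_on_def derivative_tower_def ..

lemma bounded_multilinear_head:
  assumes "bounded_multilinear (Suc j) F" "length vs = j"
  shows "bounded_linear (\<lambda>v. F (v # vs))"
proof -
  obtain K where lin: "\<And>vs i. length vs = Suc j \<Longrightarrow> i < Suc j \<Longrightarrow> linear (\<lambda>v. F (vs[i := v]))"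
    and K: "\<And>vs. length vs = Suc j \<Longrightarrow> norm (F vs) \<le> K * (\<Prod>v\<leftarrow>vs. norm v)"
    using assms(1) by (auto simp: bounded_multilinear_def)
  have l: "linear (\<lambda>v. F (v # vs))" using lin[of "0 # vs" 0] assms(2) by simp
  have "norm (F (v # vs)) \<le> norm v * (K * (\<Prod>v\<leftarrow>vs. norm v))" for v
    using K[of "v # vs"] assms(2) by (simp add: mult.left_commute)
  then show ?thesis
    by (intro bounded_linear_intro[where K="K * (\<Prod>v\<leftarrow>vs. norm v)"]) (use linear_add[OF l] linear_scale[OF l] in auto)
qed

lemma tower_has_derivative:
  assumes T: "derivative_tower k S f D" and S: "open S" and j: "j < k" and x: "x \<in> S" and vs: "length vs = j"
  shows "((\<lambda>y. D j y vs) has_derivative (\<lambda>v. D (Suc j) x (v # vs))) (at x)"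
proof -
  have bl: "bounded_linear (\<lambda>v. D (Suc j) x (v # vs))"
    using T j x vs by (intro bounded_multilinear_head) (auto simp: derivative_tower_def)
  define P where "P = (\<Prod>v\<leftarrow>vs. norm v)"
  have P0: "0 \<le> P" unfolding P_def by (induction vs) auto
  have "((\<lambda>y. D j y vs) has_derivative (\<lambda>v. D (Suc j) x (v # vs))) (at x within S)"
    unfolding has_derivative_within_alt
  proof (intro conjI allI impI bl)
    fix e :: real assume e: "0 < e"
    then have "0 < e / (P + 1)" using P0 by simp
    then have "\<forall>\<^sub>F y in at x within S. \<forall>vs. length vs = j \<longrightarrow>
       norm (D j y vs - D j x vs - D (Suc j) x ((y - x) # vs)) \<le> e / (P + 1) * norm (y - x) * (\<Prod>v\<leftarrow>vs. norm v)"
      using T j x unfolding derivative_tower_def by blast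
    then obtain d where d: "d > 0" "\<And>y. y \<in> S \<Longrightarrow> y \<noteq> x \<Longrightarrow> dist y x < d \<Longrightarrow>
        norm (D j y vs - D j x vs - D (Suc j) x ((y - x) # vs)) \<le> e / (P + 1) * norm (y - x) * P"
      unfolding eventually_at P_def using vs by blast
    have "norm (D j y vs - D j x vs - D (Suc j) x ((y - x) # vs)) \<le> e * norm (y - x)"
      if "y \<in> S" "norm (y - x) < d" for y
    proof (cases "y = x")
      case True
      then show ?thesis using linear_0[OF bounded_linear.linear[OF bl]] by simp
    next
      case False
      have "e / (P + 1) * P \<le> e" using P0 e by (simp add: field_simps)
      then have "e / (P + 1) * P * norm (y - x) \<le> e * norm (y - x)" by (rule mult_right_mono) simp
      then show ?thesis using d(2)[OF that(1) False] that(2) by (simp add: dist_norm mult.commute mult.left_commute)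
    qed
    then show "\<exists>d>0. \<forall>y\<in>S. norm (y - x) < d \<longrightarrow>
        norm (D j y vs - D j x vs - D (Suc j) x ((y - x) # vs)) \<le> e * norm (y - x)"
      using d(1) by blast
  qed
  then show ?thesis using at_within_open[OF x S] by simp
qed

lemma tower_0_has_derivative:
  assumes T: "derivative_tower k S f D" and S: "open S" and k: "0 < k" and x: "x \<in> S"
  shows "(f has_derivative (\<lambda>v. D 1 x [v])) (at x)"
proof -
  have "((\<lambda>y. D 0 y []) has_derivative (\<lambda>v. D (Suc 0) x [v])) (at x)"
    by (rule tower_has_derivative[OF T S k x]) simp
  then have "(f has_derivative (\<lambda>v. D (Suc 0) x [v])) (at x)"
    by (rule has_derivative_transform_within_open[OF _ S x]) (use T in \<open>simp add: derivative_tower_def\<close>)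
  then show ?thesis by simp
qed

lemma Ck_on_differentiable:
  "Ck_on k S f \<Longrightarrow> open S \<Longrightarrow> 0 < k \<Longrightarrow> x \<in> S \<Longrightarrow> f differentiable (at x)"
  unfolding Ck_on_iff_tower using tower_0_has_derivative differentiableI by blast

text \<open>
  Continuity in the operator norm bounds the derivative near each point, and the mean value inequality
  on a ball does the rest.
\<close>

lemma C1_on_locally_Lipschitz:
  assumes F: "Ck_on 1 S F" and S: "open S"
  shows "locally_Lipschitz_on S F"
  unfolding locally_Lipschitz_on_def
proof
  fix y assume y: "y \<in> S"
  obtain D where T: "derivative_tower 1 S F D" using F by (auto simp: Ck_on_iff_tower)
  obtain K where K0: "0 \<le> K" and K: "\<And>v. norm (D 1 y [v]) \<le> K * norm v"
  proof -
    have "bounded_multilinear 1 (D 1 y)" using T y by (auto simp: derivative_tower_def)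
    then obtain K where "\<And>vs. length vs = 1 \<Longrightarrow> norm (D 1 y vs) \<le> K * (\<Prod>v\<leftarrow>vs. norm v)"
      by (auto simp: bounded_multilinear_def)
    from this[of "[_]"] have "norm (D 1 y [v]) \<le> K * norm v" for v by simp
    moreover have "K * norm v \<le> \<bar>K\<bar> * norm v" for v :: 'a by (intro mult_right_mono) auto
    ultimately show ?thesis by (intro that[of "\<bar>K\<bar>"]) (auto intro: order.trans)
  qed
  have "\<forall>\<^sub>F z in at y within S. \<forall>vs. length vs = 1 \<longrightarrow> norm (D 1 z vs - D 1 y vs) \<le> 1 * (\<Prod>v\<leftarrow>vs. norm v)"
    using T y zero_less_one unfolding derivative_tower_def by blast
  then obtain d where d0: "d > 0" "\<And>z vs. z \<in> S \<Longrightarrow> z \<noteq> y \<Longrightarrow> dist z y < d \<Longrightarrow> length vs = 1 \<Longrightarrow>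
      norm (D 1 z vs - D 1 y vs) \<le> 1 * (\<Prod>v\<leftarrow>vs. norm v)"
    unfolding eventually_at by blast
  have d: "norm (D 1 z [v] - D 1 y [v]) \<le> norm v" if "z \<in> S" "z \<noteq> y" "dist z y < d" for z v
    using d0(2)[OF that, of "[v]"] by simp
  obtain r where r: "r > 0" "ball y r \<subseteq> S" using S y open_contains_ball by blast
  define \<delta> where "\<delta> = min d r"
  have ball: "ball y \<delta> \<subseteq> S" using r by (auto simp: \<delta>_def)
  have "norm (F u - F v) \<le> (K + 1) * norm (u - v)" if "u \<in> ball y \<delta>" "v \<in> ball y \<delta>" for u v
  proof (rule differentiable_bound[where S="ball y \<delta>" and f'="\<lambda>z v. D 1 z [v]"])
    fix z assume z: "z \<in> ball y \<delta>"
    then have "(F has_derivative (\<lambda>v. D 1 z [v])) (at z)"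
      using ball by (intro tower_0_has_derivative[OF T S]) auto
    then show "(F has_derivative (\<lambda>v. D 1 z [v])) (at z within ball y \<delta>)"
      by (rule has_derivative_at_withinI)
    have "norm (D 1 z [v]) \<le> (K + 1) * norm v" for v
    proof (cases "z = y")
      case False
      then have "norm (D 1 z [v] - D 1 y [v]) \<le> norm v"
        using z ball by (intro d) (auto simp: \<delta>_def dist_commute)
      then show ?thesis using K[of v] norm_triangle_sub[of "D 1 z [v]" "D 1 y [v]"] by (simp add: algebra_simps)
    next
      case True
      show ?thesis using K[of v] norm_ge_zero[of v] unfolding distrib_right True by linarith
    qed
    then show "onorm (\<lambda>v. D 1 z [v]) \<le> K + 1" using K0 by (intro onorm_bound) auto
  qed (use that in auto)
  moreover have "\<delta> > 0" using d0 r by (simp add: \<delta>_def)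
  ultimately show "\<exists>\<delta>>0. \<exists>K. \<forall>u\<in>ball y \<delta> \<inter> S. \<forall>v\<in>ball y \<delta> \<inter> S. norm (F u - F v) \<le> K * norm (u - v)"
    by blast
qed

lemma has_derivative_along_line:
  assumes "(F has_derivative F') (at x)" "\<And>t. F (x + t *\<^sub>R u) = c + t *\<^sub>R d"
  shows "F' u = d"
proof -
  interpret F': bounded_linear F' by (rule has_derivative_bounded_linear[OF assms(1)])
  have l: "((\<lambda>t. x + t *\<^sub>R u) has_derivative (\<lambda>t. t *\<^sub>R u)) (at 0)"
    by (auto intro!: derivative_eq_intros)
  have "((\<lambda>t. F (x + t *\<^sub>R u)) has_derivative (\<lambda>t. F' (t *\<^sub>R u))) (at 0)"
    by (rule has_derivative_compose[OF l]) (simp add: assms(1))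
  then have "((\<lambda>t. c + t *\<^sub>R d) has_vector_derivative F' u) (at 0)"
    by (simp add: assms(2) has_vector_derivative_def F'.scaleR)
  moreover have "((\<lambda>t. c + t *\<^sub>R d) has_vector_derivative d) (at 0)"
    by (auto intro!: derivative_eq_intros simp: has_vector_derivative_def)
  ultimately show ?thesis by (rule vector_derivative_unique_at)
qed

text \<open>
  A bilinear form in \<open>(v, w)\<close> is its own second derivative at \<open>(0, 0)\<close>.  So a form depending
  \<open>C\<^sup>2\<close> on a parameter jointly with its arguments is bounded and depends continuously on the
  parameter in the operator norm.
\<close>

lemma C2_bilinear_form:
  fixes \<Phi> :: "'a::real_normed_vector \<times> 'e::real_normed_vector \<times> 'e \<Rightarrow> real"
  assumes C2: "Ck_on 2 (W \<times> UNIV \<times> UNIV) \<Phi>" and W: "open W"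
    and bil: "\<And>y. y \<in> W \<Longrightarrow> bilinear (\<lambda>v w. \<Phi> (y, v, w))" and y0: "y0 \<in> W"
  shows "(\<exists>K. \<forall>v w. \<bar>\<Phi> (y0, v, w)\<bar> \<le> K * (norm v * norm w)) \<and>
    (\<forall>\<epsilon>>0. \<exists>\<delta>>0. \<forall>y\<in>W. dist y y0 < \<delta> \<longrightarrow>
      (\<forall>v w. \<bar>\<Phi> (y, v, w) - \<Phi> (y0, v, w)\<bar> \<le> \<epsilon> * (norm v * norm w)))"
proof -
  let ?S = "W \<times> (UNIV :: 'e set) \<times> (UNIV :: 'e set)"
  have S: "open ?S" using W by (intro open_Times) auto
  obtain D where T: "derivative_tower 2 ?S \<Phi> D" using C2 by (auto simp: Ck_on_iff_tower)
  have lin: "\<Phi> (y, t *\<^sub>R v, w) = t *\<^sub>R \<Phi> (y, v, w)" "\<Phi> (y, v, t *\<^sub>R w) = t *\<^sub>R \<Phi> (y, v, w)" if "y \<in> W" for y v w t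
    using bil[OF that] by (simp_all add: bilinear_lmul[of "\<lambda>v w. \<Phi> (y, v, w)"] bilinear_rmul[of "\<lambda>v w. \<Phi> (y, v, w)"])
  have D1: "D 1 (y, 0, w) [(0, v, 0)] = \<Phi> (y, v, w)" if "y \<in> W" for y v w
  proof (rule has_derivative_along_line[where c=0 and F=\<Phi> and x="(y, 0, w)" and u="(0, v, 0)"
        and F'="\<lambda>u. D 1 (y, 0, w) [u]"])
    show "(\<Phi> has_derivative (\<lambda>u. D 1 (y, 0, w) [u])) (at (y, 0, w))"
      by (rule tower_0_has_derivative[OF T S]) (use that in auto)
    show "\<Phi> ((y, 0, w) + t *\<^sub>R (0, v, 0)) = 0 + t *\<^sub>R \<Phi> (y, v, w)" for t
      using lin(1)[OF that, of t v w] by simp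
  qed
  have D2: "D 2 (y, 0, 0) [(0, 0, w), (0, v, 0)] = \<Phi> (y, v, w)" if "y \<in> W" for y v w
  proof (rule has_derivative_along_line[where c=0 and F="\<lambda>z. D 1 z [(0, v, 0)]" and x="(y, 0, 0)"
        and u="(0, 0, w)" and F'="\<lambda>u. D 2 (y, 0, 0) [u, (0, v, 0)]"])
    have "((\<lambda>z. D 1 z [(0, v, 0)]) has_derivative (\<lambda>u. D (Suc 1) (y, 0, 0) [u, (0, v, 0)])) (at (y, 0, 0))"
      by (rule tower_has_derivative[OF T S]) (use that in auto)
    then show "((\<lambda>z. D 1 z [(0, v, 0)]) has_derivative (\<lambda>u. D 2 (y, 0, 0) [u, (0, v, 0)])) (at (y, 0, 0))"
      by (simp add: numeral_2_eq_2)
    show "D 1 ((y, 0, 0) + t *\<^sub>R (0, 0, w)) [(0, v, 0)] = 0 + t *\<^sub>R \<Phi> (y, v, w)" for t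
      using D1[OF that, of "t *\<^sub>R w" v] lin(2)[OF that, of v t w] by simp
  qed
  show ?thesis
  proof (intro conjI allI impI)
    have "bounded_multilinear 2 (D 2 (y0, 0, 0))" using T y0 by (auto simp: derivative_tower_def)
    then obtain K where K: "\<And>vs. length vs = 2 \<Longrightarrow> norm (D 2 (y0, 0, 0) vs) \<le> K * (\<Prod>v\<leftarrow>vs. norm v)"
      by (auto simp: bounded_multilinear_def)
    have "\<bar>\<Phi> (y0, v, w)\<bar> \<le> K * (norm v * norm w)" for v w
      using K[of "[(0, 0, w), (0, v, 0)]"] by (simp add: D2[OF y0] norm_Pair mult.commute)
    then show "\<exists>K. \<forall>v w. \<bar>\<Phi> (y0, v, w)\<bar> \<le> K * (norm v * norm w)" by blast
    fix \<epsilon> :: real assume \<epsilon>: "0 < \<epsilon>"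
    define P where "P z \<longleftrightarrow> (\<forall>vs. length vs = 2 \<longrightarrow> norm (D 2 z vs - D 2 (y0, 0, 0) vs) \<le> \<epsilon> * (\<Prod>v\<leftarrow>vs. norm v))" for z
    have "(y0, 0, 0) \<in> ?S" using y0 by simp
    then have "\<forall>\<^sub>F z in at (y0, 0, 0) within ?S. P z"
      using T \<epsilon> unfolding derivative_tower_def P_def by blast
    then obtain \<delta> where \<delta>: "\<delta> > 0" "\<And>z. z \<in> ?S \<Longrightarrow> z \<noteq> (y0, 0, 0) \<Longrightarrow> dist z (y0, 0, 0) < \<delta> \<Longrightarrow> P z"
      unfolding eventually_at by metis
    have "\<bar>\<Phi> (y, v, w) - \<Phi> (y0, v, w)\<bar> \<le> \<epsilon> * (norm v * norm w)" if y: "y \<in> W" "dist y y0 < \<delta>" for y v w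
    proof (cases "y = y0")
      case False
      then have "P (y, 0, 0)" using y by (intro \<delta>(2)) (auto simp: dist_Pair_Pair)
      then have "norm (D 2 (y, 0, 0) [(0, 0, w), (0, v, 0)] - D 2 (y0, 0, 0) [(0, 0, w), (0, v, 0)])
          \<le> \<epsilon> * (\<Prod>v\<leftarrow>[(0, 0, w), (0, v, 0 :: 'e)]. norm v)"
        unfolding P_def by (elim allE[of _ "[(0, 0, w), (0, v, 0)]"]) simp
      then show ?thesis
        by (simp add: D2[OF y0] D2[OF y(1)] norm_Pair mult.commute)
    qed (use \<epsilon> in simp)
    then show "\<exists>\<delta>>0. \<forall>y\<in>W. dist y y0 < \<delta> \<longrightarrow> (\<forall>v w. \<bar>\<Phi> (y, v, w) - \<Phi> (y0, v, w)\<bar> \<le> \<epsilon> * (norm v * norm w))"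
      using \<delta>(1) by blast
  qed
qed

text \<open>
  The derivatives of \<open>f\<close> are those of \<open>\<Psi>\<close> in the directions of the fibre.  In particular the iterated
  derivative \<open>second_derivative\<close> is a genuine second derivative.
\<close>

lemma C2_fibre_second_derivative:
  fixes \<Psi> :: "'a::real_normed_vector \<times> 'e::real_normed_vector \<Rightarrow> real"
  assumes C2: "Ck_on 2 (W \<times> UNIV) \<Psi>" and W: "open W" and y0: "y0 \<in> W"
    and f: "\<And>v. f v = \<Psi> (y0, v)"
  obtains f1 f2 where "\<And>u. (f has_derivative f1 u) (at u)"
    "\<And>v w. ((\<lambda>u. f1 u w) has_derivative f2 v w) (at v)"
    "\<And>v w. second_derivative f v w = f2 v w w"
proof -
  let ?S = "W \<times> (UNIV :: 'e set)"
  have S: "open ?S" using W by (intro open_Times) auto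
  obtain D where T: "derivative_tower 2 ?S \<Psi> D" using C2 by (auto simp: Ck_on_iff_tower)
  define f1 where "f1 u w = D 1 (y0, u) [(0, w)]" for u w
  define f2 where "f2 v w z = D 2 (y0, v) [(0, z), (0, w)]" for v w z
  have inc: "((\<lambda>u. (y0, u)) has_derivative (\<lambda>w. (0, w))) (at u)" for u :: 'e
    by (auto intro!: derivative_eq_intros)
  have d1: "(f has_derivative f1 u) (at u)" for u
  proof -
    have "(\<Psi> has_derivative (\<lambda>v. D 1 (y0, u) [v])) (at (y0, u))"
      by (rule tower_0_has_derivative[OF T S]) (use y0 in auto)
    from has_derivative_compose[OF inc this] show ?thesis
      unfolding f1_def f[abs_def] .
  qed
  have d2: "((\<lambda>u. f1 u w) has_derivative f2 v w) (at v)" for v w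
  proof -
    have "((\<lambda>z. D 1 z [(0, w)]) has_derivative (\<lambda>u. D (Suc 1) (y0, v) [u, (0, w)])) (at (y0, v))"
      by (rule tower_has_derivative[OF T S]) (use y0 in auto)
    from has_derivative_compose[OF inc this] show ?thesis
      unfolding f1_def f2_def by (simp add: numeral_2_eq_2)
  qed
  have "frechet_derivative f (at u) = f1 u" for u using frechet_derivative_at[OF d1] by simp
  then have "second_derivative f v w = f2 v w w" for v w
    using frechet_derivative_at[OF d2] by (simp add: second_derivative_def)
  then show ?thesis using d1 d2 that by blast
qed

lemma second_order_Taylor:
  assumes d1: "\<And>u. (f has_derivative f1 u) (at u)"
    and d2: "\<And>v w. ((\<lambda>u. f1 u w) has_derivative f2 v w) (at v)"
  obtains z :: "'e::real_normed_vector" where "f (v + w) = f v + f1 v w + f2 z w w / (2::real)"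
proof -
  have l: "((\<lambda>t. v + t *\<^sub>R w) has_derivative (\<lambda>s. s *\<^sub>R w)) (at t)" for t :: real
    by (auto intro!: derivative_eq_intros)
  define diff where "diff = (\<lambda>(n::nat) t. if n = 0 then f (v + t *\<^sub>R w) else if n = 1 then f1 (v + t *\<^sub>R w) w else f2 (v + t *\<^sub>R w) w w)"
  have D0: "((\<lambda>t. f (v + t *\<^sub>R w)) has_real_derivative f1 (v + t *\<^sub>R w) w) (at t)" for t
  proof -
    have "((\<lambda>t. f (v + t *\<^sub>R w)) has_derivative (\<lambda>s. f1 (v + t *\<^sub>R w) (s *\<^sub>R w))) (at t)"
      by (rule has_derivative_compose[OF l d1])
    moreover have "f1 (v + t *\<^sub>R w) (s *\<^sub>R w) = s * f1 (v + t *\<^sub>R w) w" for s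
      using linear_scale[OF has_derivative_linear[OF d1]] by simp
    ultimately show ?thesis by (simp add: has_field_derivative_def mult.commute[of _ "f1 (v + t *\<^sub>R w) w"])
  qed
  have D1: "((\<lambda>t. f1 (v + t *\<^sub>R w) w) has_real_derivative f2 (v + t *\<^sub>R w) w w) (at t)" for t
  proof -
    have "((\<lambda>t. f1 (v + t *\<^sub>R w) w) has_derivative (\<lambda>s. f2 (v + t *\<^sub>R w) w (s *\<^sub>R w))) (at t)"
      by (rule has_derivative_compose[OF l d2])
    moreover have "f2 (v + t *\<^sub>R w) w (s *\<^sub>R w) = s * f2 (v + t *\<^sub>R w) w w" for s
      using linear_scale[OF has_derivative_linear[OF d2]] by simp
    ultimately show ?thesis by (simp add: has_field_derivative_def mult.commute[of _ "f2 (v + t *\<^sub>R w) w w"])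
  qed
  have "\<exists>t>0. t < 1 \<and> f (v + 1 *\<^sub>R w) = (\<Sum>m<(2::nat). diff m 0 / fact m * 1 ^ m) + diff 2 t / fact 2 * 1 ^ 2"
  proof (rule Maclaurin)
    show "\<forall>m t. m < 2 \<and> 0 \<le> t \<and> t \<le> 1 \<longrightarrow> DERIV (diff m) t :> diff (Suc m) t"
      using D0 D1 by (auto simp: diff_def less_2_cases_iff)
  qed (auto simp: diff_def)
  then obtain t where "f (v + w) = f v + f1 v w + f2 (v + t *\<^sub>R w) w w / 2"
    by (auto simp: diff_def numeral_2_eq_2)
  then show ?thesis by (rule that)
qed

text \<open>
  By Taylor's formula the graph lies above its tangents, which is convexity, and \<open>f\<close> has quadratic
  growth from above and below.
\<close>

lemma pinched_second_derivative:
  fixes f :: "'e::real_normed_vector \<Rightarrow> real"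
  assumes d1: "\<And>u. (f has_derivative f1 u) (at u)"
    and d2: "\<And>v w. ((\<lambda>u. f1 u w) has_derivative f2 v w) (at v)"
    and a: "0 < a" and pinch: "\<And>v w. a * (norm w)\<^sup>2 \<le> f2 v w w" "\<And>v w. f2 v w w \<le> b * (norm w)\<^sup>2"
  shows "convex_on UNIV f" "continuous_on UNIV f"
    and "\<exists>c B. 0 < c \<and> 0 \<le> B \<and> (\<forall>w. c * (norm w)\<^sup>2 - B \<le> f w)"
    and "\<exists>C. \<forall>w. \<bar>f w\<bar> \<le> C * (1 + (norm w)\<^sup>2)"
proof -
  have low: "f v + f1 v w + a / 2 * (norm w)\<^sup>2 \<le> f (v + w)" for v w
  proof -
    obtain z where "f (v + w) = f v + f1 v w + f2 z w w / 2" by (rule second_order_Taylor[OF d1 d2])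
    then show ?thesis using pinch(1)[of w z] by simp
  qed
  have up: "f (v + w) \<le> f v + f1 v w + b / 2 * (norm w)\<^sup>2" for v w
  proof -
    obtain z where "f (v + w) = f v + f1 v w + f2 z w w / 2" by (rule second_order_Taylor[OF d1 d2])
    then show ?thesis using pinch(2)[of z w] by simp
  qed
  show "convex_on UNIV f"
  proof (rule convex_onI)
    fix t :: real and x y :: 'e assume t: "0 < t" "t < 1"
    define z where "z = (1 - t) *\<^sub>R x + t *\<^sub>R y"
    interpret L: bounded_linear "f1 z" by (rule has_derivative_bounded_linear[OF d1])
    have tangent: "f z + f1 z (u - z) \<le> f u" for u
    proof -
      have "0 \<le> a / 2 * (norm (u - z))\<^sup>2" using a by simp
      then show ?thesis using low[of z "u - z"] by simp
    qed
    have "f z = (1 - t) * (f z + f1 z (x - z)) + t * (f z + f1 z (y - z))"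
    proof -
      have "(1 - t) * f1 z (x - z) + t * f1 z (y - z) = f1 z ((1 - t) *\<^sub>R (x - z) + t *\<^sub>R (y - z))"
        by (simp add: L.add L.scaleR)
      also have "(1 - t) *\<^sub>R (x - z) + t *\<^sub>R (y - z) = 0" by (simp add: z_def algebra_simps)
      finally show ?thesis by (simp add: L.zero algebra_simps)
    qed
    also have "\<dots> \<le> (1 - t) * f x + t * f y" using t tangent by (intro add_mono mult_left_mono) auto
    finally show "f ((1 - t) *\<^sub>R x + t *\<^sub>R y) \<le> (1 - t) * f x + t * f y" by (simp add: z_def)
  qed simp
  show "continuous_on UNIV f"
    by (intro continuous_at_imp_continuous_on ballI has_derivative_continuous[OF d1])
  interpret L: bounded_linear "f1 0" by (rule has_derivative_bounded_linear[OF d1])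
  obtain K where K: "K > 0" "\<And>w. norm (f1 0 w) \<le> norm w * K" using L.pos_bounded by blast
  \<comment> \<open>half of the quadratic term absorbs the linear one by Young's inequality\<close>
  have low0: "a / 4 * (norm w)\<^sup>2 - (\<bar>f 0\<bar> + K\<^sup>2 / a) \<le> f w" for w
  proof -
    have "0 \<le> a * (norm w / 2 - K / a)\<^sup>2" using a by simp
    also have "a * (norm w / 2 - K / a)\<^sup>2 = a / 4 * (norm w)\<^sup>2 - norm w * K + K\<^sup>2 / a"
      using a by (simp add: power2_eq_square field_simps)
    finally have "norm w * K \<le> a / 4 * (norm w)\<^sup>2 + K\<^sup>2 / a" by simp
    then show ?thesis using low[of 0 w] K(2)[of w] by simp
  qed
  then show "\<exists>c B. 0 < c \<and> 0 \<le> B \<and> (\<forall>w. c * (norm w)\<^sup>2 - B \<le> f w)"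
    using a by (intro exI[of _ "a / 4"] exI[of _ "\<bar>f 0\<bar> + K\<^sup>2 / a"]) auto
  define B where "B = \<bar>f 0\<bar> + K\<^sup>2 / a"
  have "\<bar>f w\<bar> \<le> (B + \<bar>f 0\<bar> + K + \<bar>b\<bar>) * (1 + (norm w)\<^sup>2)" for w
  proof -
    have B0: "B \<ge> 0" using a by (simp add: B_def)
    have "2 * norm w \<le> 1 + (norm w)\<^sup>2" using sum_squares_bound[of 1 "norm w"] by simp
    then have "norm w \<le> 1 + (norm w)\<^sup>2" using norm_ge_zero[of w] by linarith
    then have "norm w * K \<le> K * (1 + (norm w)\<^sup>2)" using K(1) by (simp add: mult.commute)
    moreover have "b / 2 * (norm w)\<^sup>2 \<le> \<bar>b\<bar> * (1 + (norm w)\<^sup>2)" by (intro mult_mono) auto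
    moreover have "\<bar>f 0\<bar> \<le> \<bar>f 0\<bar> * (1 + (norm w)\<^sup>2)" "B \<le> B * (1 + (norm w)\<^sup>2)"
      using B0 by (auto simp: algebra_simps)
    moreover have "- B \<le> f w"
    proof -
      have "0 \<le> a / 4 * (norm w)\<^sup>2" using a by simp
      then show ?thesis using low0[of w] unfolding B_def by linarith
    qed
    moreover have "f w \<le> \<bar>f 0\<bar> + norm w * K + b / 2 * (norm w)\<^sup>2"
      using up[of 0 w] K(2)[of w] by simp
    moreover have "0 \<le> \<bar>b\<bar> * (1 + (norm w)\<^sup>2)" "0 \<le> norm w * K" using K(1) by auto
    moreover note B0
    ultimately show ?thesis unfolding distrib_right by linarith
  qed
  then show "\<exists>C. \<forall>w. \<bar>f w\<bar> \<le> C * (1 + (norm w)\<^sup>2)" by blast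
qed

section \<open>Charts\<close>

lemma chartD:
  assumes "smooth_atlas A" "(U, \<phi>) \<in> A"
  shows "open U" "open (\<phi> ` U)" "continuous_on U \<phi>" "continuous_on (\<phi> ` U) (inv_into U \<phi>)"
    "\<And>x. x \<in> U \<Longrightarrow> inv_into U \<phi> (\<phi> x) = x"
  using assms by (force simp: smooth_atlas_def is_chart_def homeomorphism_def)+

lemma chart_image_open:
  assumes A: "smooth_atlas A" "(U, \<phi>) \<in> A" and W: "open W"
  shows "open (\<phi> ` (U \<inter> W))"
proof -
  have "\<phi> ` (U \<inter> W) = \<phi> ` U \<inter> inv_into U \<phi> -` W"
    using chartD(5)[OF A] by force
  then show ?thesis
    using continuous_open_preimage[OF chartD(4)[OF A] chartD(2)[OF A] W] by simp
qed

lemma chart_at_mem: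
  assumes "smooth_atlas A"
  shows "chart_at A x \<in> A" "x \<in> fst (chart_at A x)"
proof -
  have "x \<in> (\<Union>c\<in>A. fst c)" using assms by (simp add: smooth_atlas_def)
  then obtain c where "c \<in> A \<and> x \<in> fst c" by blast
  then have "chart_at A x \<in> A \<and> x \<in> fst (chart_at A x)" unfolding chart_at_def by (rule someI)
  then show "chart_at A x \<in> A" "x \<in> fst (chart_at A x)" by auto
qed

lemma chart_rep_facts:
  assumes A: "smooth_atlas A" "(U, \<phi>) \<in> A" "(V, \<psi>) \<in> A"
    and R: "smooth_in_charts A R" "continuous_on UNIV R"
  defines "S \<equiv> \<phi> ` (U \<inter> R -` V)" and "F \<equiv> \<psi> \<circ> R \<circ> inv_into U \<phi>"
  shows "open S" "\<And>y. y \<in> S \<Longrightarrow> F differentiable (at y)" "locally_Lipschitz_on S F"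
proof -
  have "open (R -` V)" using R(2) chartD(1)[OF A(1,3)] by (simp add: continuous_on_open_vimage)
  then show S: "open S" unfolding S_def by (rule chart_image_open[OF A(1,2)])
  have "Ck_on 1 S F"
    using R(1) A unfolding smooth_in_charts_def smooth_on_def S_def F_def by blast
  then show "\<And>y. y \<in> S \<Longrightarrow> F differentiable (at y)" "locally_Lipschitz_on S F"
    using Ck_on_differentiable[OF _ S] C1_on_locally_Lipschitz[OF _ S] by auto
qed

section \<open>Curves in the manifold\<close>

lemma W1p_change_chart:
  fixes A :: "('g::topological_space, 'e::real_inner) chart set"
  assumes A: "smooth_atlas A" "(U, \<phi>) \<in> A" "(V, \<psi>) \<in> A"
    and R: "smooth_in_charts A R" "continuous_on UNIV R"
    and \<gamma>: "\<phi> \<circ> \<gamma> \<in> W1p p a b" "1 \<le> p" "a \<le> b" "\<gamma> ` {a..b} \<subseteq> U \<inter> R -` V"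
  shows "\<psi> \<circ> (R \<circ> \<gamma>) \<in> W1p p a b"
proof -
  have "(\<psi> \<circ> R \<circ> inv_into U \<phi>) \<circ> (\<phi> \<circ> \<gamma>) \<in> W1p p a b"
  proof (rule W1p_compose[OF \<gamma>(1-3)])
    show "(\<phi> \<circ> \<gamma>) ` {a..b} \<subseteq> \<phi> ` (U \<inter> R -` V)" using image_mono[OF \<gamma>(4), of \<phi>] by (simp add: image_comp)
  qed (rule chart_rep_facts(2,3)[OF A R]; assumption)+
  then show ?thesis
    by (rule W1p_cong) (use \<gamma>(4) chartD(5)[OF A(1,2)] in \<open>auto simp: image_subset_iff\<close>)
qed

lemma smooth_id: "smooth_atlas A \<Longrightarrow> smooth_in_charts A id" "continuous_on UNIV id"
  by (auto simp: smooth_atlas_def continuous_on_id)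

lemma curve_near:
  assumes cont: "continuous_on {a..b} (\<gamma> :: real \<Rightarrow> 'g::topological_space)" and x: "x \<in> {a..b}" and W: "open W" "\<gamma> x \<in> W"
  obtains \<delta> where "\<delta> > 0" "\<And>c d. a \<le> c \<Longrightarrow> c \<le> x \<Longrightarrow> x \<le> d \<Longrightarrow> d \<le> b \<Longrightarrow> d - c < \<delta> \<Longrightarrow> \<gamma> ` {c..d} \<subseteq> W"
proof -
  have "\<forall>\<^sub>F y in at x within {a..b}. \<gamma> y \<in> W"
    using cont x W unfolding continuous_on_def by (blast intro: topological_tendstoD)
  then obtain \<eta> where \<eta>: "\<eta> > 0" "\<forall>y\<in>{a..b}. y \<noteq> x \<and> dist y x < \<eta> \<longrightarrow> \<gamma> y \<in> W"
    unfolding eventually_at by blast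
  show ?thesis
  proof (rule that[OF \<eta>(1)])
    fix c d assume cd: "a \<le> c" "c \<le> x" "x \<le> d" "d \<le> b" "d - c < \<eta>"
    show "\<gamma> ` {c..d} \<subseteq> W"
    proof
      fix z assume "z \<in> \<gamma> ` {c..d}"
      then obtain y where y: "z = \<gamma> y" "y \<in> {c..d}" by auto
      then have "y \<in> {a..b}" "dist y x < \<eta>" using cd by (auto simp: dist_real_def)
      then show "z \<in> W" using \<eta>(2) W(2) y(1) by (cases "y = x") auto
    qed
  qed
qed

text \<open>
  Although the definition quantifies over all charts, one chart near each parameter is enough: charts
  are related by smooth transition maps.
\<close>

lemma W1p_curveI_local:
  fixes A :: "('g::topological_space, 'e::real_inner) chart set"
  assumes A: "smooth_atlas A" and p: "1 \<le> p" and cont: "continuous_on {a..b} \<gamma>"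
    and loc: "\<And>x. x \<in> {a..b} \<Longrightarrow> \<exists>(U, \<phi>)\<in>A. \<gamma> x \<in> U \<and> (\<exists>\<delta>>0. \<forall>c d. a \<le> c \<and> c \<le> x \<and> x \<le> d \<and> d \<le> b \<and> d - c < \<delta> \<longrightarrow> \<phi> \<circ> \<gamma> \<in> W1p p c d)"
  shows "W1p_curve p A {a..b} \<gamma>"
proof -
  have "\<psi> \<circ> \<gamma> \<in> W1p p c d"
    if V: "(V, \<psi>) \<in> A" and cd: "c \<le> d" "{c..d} \<subseteq> {a..b}" "\<gamma> ` {c..d} \<subseteq> V" for V \<psi> c d
  proof (rule interval_localization[OF cd(1)])
    show "\<psi> \<circ> \<gamma> \<in> W1p p r t" if "r \<le> s" "s \<le> t" "\<psi> \<circ> \<gamma> \<in> W1p p r s" "\<psi> \<circ> \<gamma> \<in> W1p p s t" for r s t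
      using W1p_combine[OF that(3,4) p that(1,2)] .
  next
    fix x assume x: "x \<in> {c..d}"
    then have xab: "x \<in> {a..b}" using cd(2) by auto
    obtain U \<phi> \<delta> where U: "(U, \<phi>) \<in> A" "\<gamma> x \<in> U" "0 < \<delta>"
      and \<delta>: "\<And>c d. a \<le> c \<Longrightarrow> c \<le> x \<Longrightarrow> x \<le> d \<Longrightarrow> d \<le> b \<Longrightarrow> d - c < \<delta> \<Longrightarrow> \<phi> \<circ> \<gamma> \<in> W1p p c d"
      using loc[OF xab] by blast
    obtain \<eta> where \<eta>: "\<eta> > 0" "\<And>c d. a \<le> c \<Longrightarrow> c \<le> x \<Longrightarrow> x \<le> d \<Longrightarrow> d \<le> b \<Longrightarrow> d - c < \<eta> \<Longrightarrow> \<gamma> ` {c..d} \<subseteq> U"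
      using curve_near[OF cont xab chartD(1)[OF A U(1)] U(2)] by blast
    have "\<psi> \<circ> \<gamma> \<in> W1p p r t"
      if rt: "c \<le> r" "r \<le> x" "x \<le> t" "t \<le> d" "t - r < min \<delta> \<eta>" for r t
    proof -
      have ab: "a \<le> r" "t \<le> b" using rt cd x by (auto simp: atLeastatMost_subset_iff)
      have "\<gamma> ` {r..t} \<subseteq> U" using \<eta>(2)[of r t] rt ab by simp
      moreover have "\<gamma> ` {r..t} \<subseteq> V" using cd(3) rt by force
      ultimately have "\<psi> \<circ> (id \<circ> \<gamma>) \<in> W1p p r t"
        using \<delta>[of r t] rt ab by (intro W1p_change_chart[OF A U(1) V smooth_id(1)[OF A] smooth_id(2) _ p]) auto
      then show ?thesis by simp
    qed
    then show "\<exists>\<delta>>0. \<forall>r t. c \<le> r \<and> r \<le> x \<and> x \<le> t \<and> t \<le> d \<and> t - r < \<delta> \<longrightarrow> \<psi> \<circ> \<gamma> \<in> W1p p r t"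
      using U(3) \<eta>(1) by (intro exI[of _ "min \<delta> \<eta>"]) auto
  qed
  then show ?thesis using cont unfolding W1p_curve_def by auto
qed

lemma W1p_curve_compose_smooth:
  fixes A :: "('g::topological_space, 'e::real_inner) chart set"
  assumes A: "smooth_atlas A" and p: "1 \<le> p" and \<gamma>: "W1p_curve p A {a..b} \<gamma>"
    and R: "smooth_in_charts A R" "continuous_on UNIV R"
  shows "W1p_curve p A {a..b} (\<lambda>t. R (\<gamma> t))"
proof (rule W1p_curveI_local[OF A p])
  have cont: "continuous_on {a..b} \<gamma>" using \<gamma> by (simp add: W1p_curve_def)
  show "continuous_on {a..b} (\<lambda>t. R (\<gamma> t))" by (rule continuous_on_compose2[OF R(2) cont]) auto
  fix x assume x: "x \<in> {a..b}"
  obtain U \<phi> where U: "(U, \<phi>) \<in> A" "\<gamma> x \<in> U" using chart_at_mem[OF A] by (metis prod.collapse)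
  obtain V \<psi> where V: "(V, \<psi>) \<in> A" "R (\<gamma> x) \<in> V" using chart_at_mem[OF A] by (metis prod.collapse)
  have "open (R -` V)" using R(2) chartD(1)[OF A V(1)] by (simp add: continuous_on_open_vimage)
  then have W: "open (U \<inter> R -` V)" "\<gamma> x \<in> U \<inter> R -` V" using chartD(1)[OF A U(1)] U(2) V(2) by auto
  obtain \<delta> where \<delta>: "\<delta> > 0" "\<And>c d. a \<le> c \<Longrightarrow> c \<le> x \<Longrightarrow> x \<le> d \<Longrightarrow> d \<le> b \<Longrightarrow> d - c < \<delta> \<Longrightarrow> \<gamma> ` {c..d} \<subseteq> U \<inter> R -` V"
    using curve_near[OF cont x W] by blast
  have "\<psi> \<circ> (\<lambda>t. R (\<gamma> t)) \<in> W1p p c d" if cd: "a \<le> c" "c \<le> x" "x \<le> d" "d \<le> b" "d - c < \<delta>" for c d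
  proof -
    have "\<phi> \<circ> \<gamma> \<in> W1p p c d"
      using \<gamma> U(1) \<delta>(2)[OF cd] cd unfolding W1p_curve_def by force
    then have "\<psi> \<circ> (R \<circ> \<gamma>) \<in> W1p p c d"
      using \<delta>(2)[OF cd] cd by (intro W1p_change_chart[OF A U(1) V(1) R _ p]) auto
    then show ?thesis by (simp add: o_def)
  qed
  then show "\<exists>(V, \<psi>)\<in>A. R (\<gamma> x) \<in> V \<and> (\<exists>\<delta>>0. \<forall>c d. a \<le> c \<and> c \<le> x \<and> x \<le> d \<and> d \<le> b \<and> d - c < \<delta> \<longrightarrow> \<psi> \<circ> (\<lambda>t. R (\<gamma> t)) \<in> W1p p c d)"
    using V \<delta>(1) by blast
qed

lemma W1p_curve_combine:
  fixes A :: "('g::topological_space, 'e::real_inner) chart set"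
  assumes \<gamma>: "W1p_curve p A {a..b} \<gamma>" "W1p_curve p A {b..c} \<gamma>" and p: "1 \<le> p" and ab: "a \<le> b" "b \<le> c"
  shows "W1p_curve p A {a..c} \<gamma>"
proof -
  have "{a..c} = {a..b} \<union> {b..c}" using ab by auto
  then have "continuous_on {a..c} \<gamma>"
    using \<gamma> unfolding W1p_curve_def by (simp add: continuous_on_closed_Un)
  moreover have "\<phi> \<circ> \<gamma> \<in> W1p p s t"
    if U: "(U, \<phi>) \<in> A" and st: "s \<le> t" "{s..t} \<subseteq> {a..c}" "\<gamma> ` {s..t} \<subseteq> U" for U \<phi> s t
  proof -
    have w: "\<phi> \<circ> \<gamma> \<in> W1p p s' t'" if "s \<le> s'" "s' \<le> t'" "t' \<le> t" "t' \<le> b \<or> b \<le> s'" for s' t'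
    proof -
      have "\<gamma> ` {s'..t'} \<subseteq> U" using st(3) that by auto
      moreover have "{s'..t'} \<subseteq> {a..b} \<or> {s'..t'} \<subseteq> {b..c}"
        using st(1,2) that by (auto simp: atLeastatMost_subset_iff)
      ultimately show ?thesis using \<gamma> U that(2) unfolding W1p_curve_def by blast
    qed
    show ?thesis
    proof (cases "s \<le> b \<and> b \<le> t")
      case True
      then show ?thesis using W1p_combine[OF w[of s b] w[of b t] p] by auto
    qed (use w[of s t] st(1) in auto)
  qed
  ultimately show ?thesis unfolding W1p_curve_def by auto
qed

lemma W1p_curve_subset:
  assumes "W1p_curve p A I \<gamma>" "J \<subseteq> I"
  shows "W1p_curve p A J \<gamma>"
  unfolding W1p_curve_def
proof (intro conjI)
  show "continuous_on J \<gamma>" using assms by (auto simp: W1p_curve_def intro: continuous_on_subset)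
  have "\<phi> \<circ> \<gamma> \<in> W1p p s t" if "(U, \<phi>) \<in> A" "s \<le> t" "{s..t} \<subseteq> J" "\<gamma> ` {s..t} \<subseteq> U" for U \<phi> s t
    using assms(1) order.trans[OF that(3) assms(2)] that unfolding W1p_curve_def by blast
  then show "\<forall>(U, \<phi>)\<in>A. \<forall>s t. s \<le> t \<and> {s..t} \<subseteq> J \<and> \<gamma> ` {s..t} \<subseteq> U \<longrightarrow> \<phi> \<circ> \<gamma> \<in> W1p p s t"
    by auto
qed

lemma W1p_curve_cong:
  fixes A :: "('g::topological_space, 'e::real_normed_vector) chart set"
  assumes \<gamma>: "W1p_curve p A {a..b} \<gamma>" and eq: "\<And>t. t \<in> {a..b} \<Longrightarrow> \<gamma> t = \<eta> t"
  shows "W1p_curve p A {a..b} \<eta>"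
proof -
  have "continuous_on {a..b} \<gamma>" using \<gamma> by (simp add: W1p_curve_def)
  then have "continuous_on {a..b} \<eta>" by (rule continuous_on_eq) (rule eq)
  moreover have "\<phi> \<circ> \<eta> \<in> W1p p c d"
    if U: "(U, \<phi>) \<in> A" and st: "c \<le> d" "{c..d} \<subseteq> {a..b}" "\<eta> ` {c..d} \<subseteq> U" for U \<phi> c d
  proof (rule W1p_cong)
    have "\<gamma> ` {c..d} = \<eta> ` {c..d}" using st(2) eq by (intro image_cong) auto
    then have "\<gamma> ` {c..d} \<subseteq> U" using st(3) by simp
    then show "\<phi> \<circ> \<gamma> \<in> W1p p c d" using \<gamma> U st unfolding W1p_curve_def by blast
  qed (use st eq in auto)
  ultimately show ?thesis unfolding W1p_curve_def by auto
qed

lemma W1p_curve_affine: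
  fixes A :: "('g::topological_space, 'e::real_normed_vector) chart set"
  assumes \<gamma>: "W1p_curve p A {u + c * a..u + c * b} \<gamma>" and c: "0 < c"
  shows "W1p_curve p A {a..b} (\<lambda>t. \<gamma> (u + c * t))"
proof -
  have "continuous_on {a..b} (\<lambda>t. \<gamma> (u + c * t))"
    by (rule continuous_on_compose2[of "{u + c * a..u + c * b}" \<gamma>])
      (use \<gamma> c in \<open>auto simp: W1p_curve_def intro!: continuous_intros\<close>)
  moreover have "\<phi> \<circ> (\<lambda>t. \<gamma> (u + c * t)) \<in> W1p p s t"
    if U: "(U, \<phi>) \<in> A" and st: "s \<le> t" "{s..t} \<subseteq> {a..b}" "(\<lambda>t. \<gamma> (u + c * t)) ` {s..t} \<subseteq> U" for U \<phi> s t
  proof -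
    have "\<gamma> ` {u + c * s..u + c * t} \<subseteq> U"
    proof
      fix z assume "z \<in> \<gamma> ` {u + c * s..u + c * t}"
      then obtain y where y: "z = \<gamma> y" "u + c * s \<le> y" "y \<le> u + c * t" by auto
      then have "(y - u) / c \<in> {s..t}" "z = \<gamma> (u + c * ((y - u) / c))" using c by (auto simp: field_simps)
      then show "z \<in> U" using st(3) by blast
    qed
    moreover have "{u + c * s..u + c * t} \<subseteq> {u + c * a..u + c * b}" "u + c * s \<le> u + c * t"
      using st(1,2) c by auto
    ultimately have "\<phi> \<circ> \<gamma> \<in> W1p p (u + c * s) (u + c * t)"
      using \<gamma> U unfolding W1p_curve_def by blast
    from W1p_affine[OF this c] show ?thesis by (simp add: o_def)
  qed
  ultimately show ?thesis unfolding W1p_curve_def by auto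
qed

lemma W1p_curve_const: "W1p_curve p A {a..b} (\<lambda>t. x)"
  by (auto simp: W1p_curve_def o_def)

lemma W1p_curve_exponent_1:
  assumes "W1p_curve p A I \<gamma>" "1 \<le> p"
  shows "W1p_curve 1 A I \<gamma>"
proof -
  have "\<phi> \<circ> \<gamma> \<in> W1p 1 a b" if "(U, \<phi>) \<in> A" "a \<le> b" "{a..b} \<subseteq> I" "\<gamma> ` {a..b} \<subseteq> U" for U \<phi> a b
    by (rule W1p_imp_W11[OF _ assms(2)]) (use assms(1) that in \<open>auto simp: W1p_curve_def\<close>)
  then show ?thesis using assms(1) unfolding W1p_curve_def by auto
qed

lemma W1p_curve_UNIV_I:
  assumes "continuous_on UNIV \<gamma>" "\<And>a b. a \<le> b \<Longrightarrow> W1p_curve p A {a..b} \<gamma>"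
  shows "W1p_curve p A UNIV \<gamma>"
proof -
  have "\<phi> \<circ> \<gamma> \<in> W1p p s t" if "(U, \<phi>) \<in> A" "s \<le> t" "\<gamma> ` {s..t} \<subseteq> U" for U \<phi> s t
    using assms(2)[OF that(2)] that unfolding W1p_curve_def by blast
  then show ?thesis unfolding W1p_curve_def using assms(1) by auto
qed

text \<open>
  By the smooth transition maps, this holds in every chart around \<open>\<gamma> t\<close> if it holds in one.
\<close>

definition chart_differentiable ::
    "('g, 'e::real_normed_vector) chart set \<Rightarrow> (real \<Rightarrow> 'g) \<Rightarrow> real \<Rightarrow> bool"
  where "chart_differentiable A \<gamma> t \<longleftrightarrow> (\<exists>(U, \<phi>)\<in>A. \<gamma> t \<in> U \<and> (\<phi> \<circ> \<gamma>) differentiable (at t))"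

lemma W1p_curve_AE_differentiable:
  fixes A :: "('g::topological_space, 'e::real_normed_vector) chart set"
  assumes A: "smooth_atlas A" and \<gamma>: "W1p_curve p A {a..b} \<gamma>" and ab: "a \<le> b"
  shows "AE t in lebesgue_on {a..b}. a < t \<and> t < b \<and> isCont \<gamma> t \<and> chart_differentiable A \<gamma> t"
proof -
  have cont: "continuous_on {a..b} \<gamma>" using \<gamma> by (simp add: W1p_curve_def)
  have "AE t in lebesgue_on {a..b}. a < t \<and> t < b \<and> isCont \<gamma> t"
    by (rule AE_lebesgue_on_interior) (use cont continuous_on_interior[of "{a..b}" \<gamma>] in auto)
  moreover have "AE t in lebesgue_on {a..b}. chart_differentiable A \<gamma> t"
    using ab
  proof (rule interval_localization)
    show "AE t in lebesgue_on {c..e}. chart_differentiable A \<gamma> t"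
      if "AE t in lebesgue_on {c..d}. chart_differentiable A \<gamma> t" "AE t in lebesgue_on {d..e}. chart_differentiable A \<gamma> t" for c d e
      using that by (rule AE_lebesgue_on_combine)
    fix x assume x: "x \<in> {a..b}"
    obtain U \<phi> where U: "(U, \<phi>) \<in> A" "\<gamma> x \<in> U" using chart_at_mem[OF A] by (metis prod.collapse)
    obtain \<delta> where \<delta>: "\<delta> > 0" "\<And>c d. a \<le> c \<Longrightarrow> c \<le> x \<Longrightarrow> x \<le> d \<Longrightarrow> d \<le> b \<Longrightarrow> d - c < \<delta> \<Longrightarrow> \<gamma> ` {c..d} \<subseteq> U"
      using curve_near[OF cont x chartD(1)[OF A U(1)] U(2)] by blast
    have "AE t in lebesgue_on {c..d}. chart_differentiable A \<gamma> t" if cd: "a \<le> c" "c \<le> x" "x \<le> d" "d \<le> b" "d - c < \<delta>" for c d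
    proof -
      have "\<phi> \<circ> \<gamma> \<in> W1p p c d" using \<gamma> U(1) \<delta>(2)[OF cd] cd unfolding W1p_curve_def by force
      then have "AE t in lebesgue_on {c..d}. (\<phi> \<circ> \<gamma>) differentiable (at t)" by (rule W1p_differentiable)
      moreover have "AE t in lebesgue_on {c..d}. t \<in> {c..d}" using AE_space[of "lebesgue_on {c..d}"] by simp
      ultimately show ?thesis
      proof eventually_elim
        case (elim t)
        then show ?case using U(1) \<delta>(2)[OF cd] unfolding chart_differentiable_def by blast
      qed
    qed
    then show "\<exists>\<delta>>0. \<forall>c d. a \<le> c \<and> c \<le> x \<and> x \<le> d \<and> d \<le> b \<and> d - c < \<delta> \<longrightarrow> (AE t in lebesgue_on {c..d}. chart_differentiable A \<gamma> t)"
      using \<delta>(1) by blast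
  qed
  ultimately show ?thesis by eventually_elim simp
qed

lemma chart_derivative_compose:
  fixes A :: "('g::topological_space, 'e::real_normed_vector) chart set"
  assumes A: "smooth_atlas A" "(U, \<phi>) \<in> A" "(V, \<psi>) \<in> A"
    and R: "smooth_in_charts A R" "continuous_on UNIV R"
    and \<gamma>: "isCont \<gamma> t" "\<gamma> t \<in> U" "R (\<gamma> t) \<in> V" "(\<phi> \<circ> \<gamma> has_vector_derivative v) (at t)"
  shows "(\<psi> \<circ> (\<lambda>s. R (\<gamma> s)) has_vector_derivative
    frechet_derivative (\<psi> \<circ> R \<circ> inv_into U \<phi>) (at (\<phi> (\<gamma> t))) v) (at t)"
proof -
  let ?F = "\<psi> \<circ> R \<circ> inv_into U \<phi>"
  have "\<phi> (\<gamma> t) \<in> \<phi> ` (U \<inter> R -` V)" using \<gamma> by auto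
  then have "?F differentiable (at (\<phi> (\<gamma> t)))" by (rule chart_rep_facts(2)[OF A R])
  define D where "D = frechet_derivative ?F (at (\<phi> (\<gamma> t)))"
  have F: "(?F has_derivative D) (at (\<phi> (\<gamma> t)))"
    using \<open>?F differentiable (at (\<phi> (\<gamma> t)))\<close> unfolding D_def frechet_derivative_works .
  have "((\<lambda>s. ?F ((\<phi> \<circ> \<gamma>) s)) has_derivative (\<lambda>s. D (s *\<^sub>R v))) (at t)"
    using has_derivative_compose[OF \<gamma>(4)[unfolded has_vector_derivative_def], of ?F] F by (simp only: o_apply)
  then have "(?F \<circ> (\<phi> \<circ> \<gamma>) has_vector_derivative D v) (at t)"
    by (simp add: has_vector_derivative_def o_def linear_scale[OF has_derivative_linear[OF F]])
  moreover have "\<forall>\<^sub>F s in nhds t. (?F \<circ> (\<phi> \<circ> \<gamma>)) s = (\<psi> \<circ> (\<lambda>s. R (\<gamma> s))) s"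
  proof -
    have "(\<gamma> \<longlongrightarrow> \<gamma> t) (nhds t)" using \<gamma>(1) unfolding isCont_def tendsto_at_iff_tendsto_nhds .
    then have "\<forall>\<^sub>F s in nhds t. \<gamma> s \<in> U" using chartD(1)[OF A(1,2)] \<gamma>(2) by (rule topological_tendstoD)
    then show ?thesis by eventually_elim (simp add: chartD(5)[OF A(1,2)])
  qed
  ultimately show ?thesis
    using has_vector_derivative_cong_ev[where S=UNIV and x=t and f="?F \<circ> (\<phi> \<circ> \<gamma>)" and g="\<psi> \<circ> (\<lambda>s. R (\<gamma> s))"]
    unfolding D_def by (auto elim: eventually_mono dest: eventually_nhds_x_imp_x)
qed

lemma chart_differentiable_any:
  fixes A :: "('g::topological_space, 'e::real_normed_vector) chart set"
  assumes A: "smooth_atlas A" "(V, \<psi>) \<in> A" and \<gamma>: "isCont \<gamma> t" "chart_differentiable A \<gamma> t" "\<gamma> t \<in> V"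
  shows "(\<psi> \<circ> \<gamma>) differentiable (at t)"
proof -
  obtain U \<phi> where U: "(U, \<phi>) \<in> A" "\<gamma> t \<in> U" "(\<phi> \<circ> \<gamma>) differentiable (at t)"
    using \<gamma>(2) by (auto simp: chart_differentiable_def)
  then have "(\<phi> \<circ> \<gamma> has_vector_derivative vector_derivative (\<phi> \<circ> \<gamma>) (at t)) (at t)"
    by (simp add: vector_derivative_works[symmetric])
  from chart_derivative_compose[OF A(1) U(1) A(2) smooth_id(1)[OF A(1)] smooth_id(2) \<gamma>(1) U(2) _ this] \<gamma>(3)
  show ?thesis by (auto simp: id_def dest: differentiableI_vector)
qed

text \<open>
  The chart in which \<open>velocity\<close> is computed may jump along the curve; here one chart serves for a
  whole piece of it.
\<close>

lemma velocity_from_chart: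
  fixes A :: "('g::topological_space, 'e::real_normed_vector) chart set"
  assumes A: "smooth_atlas A" "(U, \<phi>) \<in> A" and \<gamma>: "isCont \<gamma> t" "chart_differentiable A \<gamma> t" "\<gamma> t \<in> U"
  shows "velocity A \<gamma> t = from_chart A (U, \<phi>) (\<gamma> t) (vector_derivative (\<phi> \<circ> \<gamma>) (at t))"
proof -
  obtain V \<psi> where V: "chart_at A (\<gamma> t) = (V, \<psi>)" by fastforce
  then have V': "(V, \<psi>) \<in> A" "\<gamma> t \<in> V" using chart_at_mem[OF A(1), of "\<gamma> t"] by auto
  have "(\<phi> \<circ> \<gamma> has_vector_derivative vector_derivative (\<phi> \<circ> \<gamma>) (at t)) (at t)"
    using chart_differentiable_any[OF A \<gamma>] by (simp add: vector_derivative_works[symmetric])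
  from chart_derivative_compose[OF A V'(1) smooth_id(1)[OF A(1)] smooth_id(2) \<gamma>(1,3) _ this] V'(2)
  have "(\<psi> \<circ> (\<lambda>s. id (\<gamma> s)) has_vector_derivative
    frechet_derivative (\<psi> \<circ> id \<circ> inv_into U \<phi>) (at (\<phi> (\<gamma> t))) (vector_derivative (\<phi> \<circ> \<gamma>) (at t))) (at t)"
    by simp
  then have "vector_derivative (\<psi> \<circ> \<gamma>) (at t) =
    frechet_derivative (\<psi> \<circ> inv_into U \<phi>) (at (\<phi> (\<gamma> t))) (vector_derivative (\<phi> \<circ> \<gamma>) (at t))"
    by (simp add: vector_derivative_at)
  then show ?thesis by (simp add: velocity_def from_chart_def V)
qed

lemma from_chart_preferred:
  fixes A :: "('g::topological_space, 'e::real_normed_vector) chart set"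
  assumes A: "smooth_atlas A"
  shows "from_chart A (chart_at A x) x v = v"
proof -
  obtain U \<phi> where U: "chart_at A x = (U, \<phi>)" by fastforce
  then have U': "(U, \<phi>) \<in> A" "x \<in> U" using chart_at_mem[OF A, of x] by auto
  have "((\<lambda>y. y) has_derivative (\<lambda>v. v)) (at (\<phi> x))" by simp
  then have "(\<phi> \<circ> inv_into U \<phi> has_derivative (\<lambda>v. v)) (at (\<phi> x))"
    by (rule has_derivative_transform_within_open[OF _ chartD(2)[OF A U'(1)]])
      (use U' chartD(5)[OF A U'(1)] in auto)
  from frechet_derivative_at[OF this] show ?thesis by (metis from_chart_def U fst_conv snd_conv)
qed

section \<open>The right logarithmic derivative on a half-Lie group\<close>

context half_lie_group
begin

lemma continuous_right_mult: "continuous_on UNIV (\<lambda>x. x \<odot> y)"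
proof -
  have "continuous_on UNIV (\<lambda>x. (x, y))" by (intro continuous_intros)
  from continuous_on_compose2[OF continuous_mult this] show ?thesis by simp
qed

lemma mult_iv_cancel [simp]: "x \<odot> y \<odot> iv y = x" "x \<odot> iv y \<odot> y = x"
  by (simp_all add: assoc)

text \<open>
  The right logarithmic derivative: the tangent vector at \<open>e\<close> which the right translation by \<open>\<gamma> t\<close> maps
  to the velocity.  The curve is translated before it is differentiated, so that all derivatives are
  taken at \<open>e\<close> and in one chart.
\<close>

definition rlog :: "(real \<Rightarrow> 'g) \<Rightarrow> real \<Rightarrow> 'e"
  where "rlog \<gamma> t = vector_derivative (snd (chart_at A e) \<circ> (\<lambda>s. \<gamma> s \<odot> iv (\<gamma> t))) (at t)"

lemma rlog_differentiable:
  assumes "isCont \<gamma> t" "chart_differentiable A \<gamma> t"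
  shows "(snd (chart_at A e) \<circ> (\<lambda>s. \<gamma> s \<odot> iv (\<gamma> t))) differentiable (at t)"
proof -
  obtain U \<phi> where U: "(U, \<phi>) \<in> A" "\<gamma> t \<in> U" "(\<phi> \<circ> \<gamma>) differentiable (at t)"
    using assms(2) by (auto simp: chart_differentiable_def)
  obtain V \<psi> where V: "chart_at A e = (V, \<psi>)" by fastforce
  then have V': "(V, \<psi>) \<in> A" "e \<in> V" using chart_at_mem[OF smooth_atlas, of e] by auto
  have "(\<phi> \<circ> \<gamma> has_vector_derivative vector_derivative (\<phi> \<circ> \<gamma>) (at t)) (at t)"
    using U(3) by (simp add: vector_derivative_works[symmetric])
  from chart_derivative_compose[OF smooth_atlas U(1) V'(1) smooth_right_mult[of "iv (\<gamma> t)"] continuous_right_mult assms(1) U(2) _ this]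
  show ?thesis using V'(2) V by (auto intro: differentiableI_vector)
qed

text \<open>
  Translating the curve \<open>s \<mapsto> \<gamma> s \<odot> iv (\<gamma> t)\<close> back by \<open>\<gamma> t\<close> recovers \<open>\<gamma>\<close>, so this is the chain rule.
\<close>

lemma velocity_eq_rlog:
  assumes "isCont \<gamma> t" "chart_differentiable A \<gamma> t"
  shows "velocity A \<gamma> t = tangent_map A (\<lambda>z. z \<odot> \<gamma> t) e (rlog \<gamma> t)"
proof -
  obtain V \<psi> where V: "chart_at A e = (V, \<psi>)" by fastforce
  then have V': "(V, \<psi>) \<in> A" "e \<in> V" using chart_at_mem[OF smooth_atlas, of e] by auto
  obtain U \<phi> where U: "chart_at A (\<gamma> t) = (U, \<phi>)" by fastforce
  then have U': "(U, \<phi>) \<in> A" "\<gamma> t \<in> U" using chart_at_mem[OF smooth_atlas, of "\<gamma> t"] by auto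
  let ?\<beta> = "\<lambda>s. \<gamma> s \<odot> iv (\<gamma> t)"
  have cont: "isCont ?\<beta> t"
    using isCont_o2[OF assms(1), of "\<lambda>x. x \<odot> iv (\<gamma> t)"] continuous_right_mult[of "iv (\<gamma> t)"]
    by (simp add: continuous_on_eq_continuous_at)
  have d: "(\<psi> \<circ> ?\<beta> has_vector_derivative rlog \<gamma> t) (at t)"
    using rlog_differentiable[OF assms] by (simp add: rlog_def V vector_derivative_works[symmetric])
  have "(\<phi> \<circ> (\<lambda>s. ?\<beta> s \<odot> \<gamma> t) has_vector_derivative
    frechet_derivative (\<phi> \<circ> (\<lambda>z. z \<odot> \<gamma> t) \<circ> inv_into V \<psi>) (at (\<psi> (?\<beta> t))) (rlog \<gamma> t)) (at t)"
    by (rule chart_derivative_compose[OF smooth_atlas V'(1) U'(1) smooth_right_mult continuous_right_mult cont _ _ d])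
      (use V' U' in simp_all)
  then have "vector_derivative (\<phi> \<circ> \<gamma>) (at t) =
    frechet_derivative (\<phi> \<circ> (\<lambda>z. z \<odot> \<gamma> t) \<circ> inv_into V \<psi>) (at (\<psi> e)) (rlog \<gamma> t)"
    by (simp add: vector_derivative_at o_def)
  then show ?thesis by (simp add: velocity_def tangent_map_def U V left_neutral)
qed

lemma rlog_right_translate: "rlog (\<lambda>t. \<gamma> t \<odot> x) t = rlog \<gamma> t"
proof -
  have "\<gamma> s \<odot> x \<odot> iv (\<gamma> t \<odot> x) = \<gamma> s \<odot> iv (\<gamma> t)" for s
    by (simp add: inverse_distrib_swap assoc[symmetric])
  then show ?thesis by (simp add: rlog_def)
qed

lemma rlog_const: "rlog (\<lambda>_. x) t = 0"
  by (simp add: rlog_def o_def)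

lemma rlog_cong:
  assumes "\<And>s. s \<in> {a..b} \<Longrightarrow> \<gamma> s = \<eta> s" "a < t" "t < b"
  shows "rlog \<gamma> t = rlog \<eta> t"
  unfolding rlog_def
  by (rule vector_derivative_cong_interval(2)[of a b]) (use assms in auto)

lemma rlog_affine:
  assumes "isCont \<gamma> (d + c * t)" "chart_differentiable A \<gamma> (d + c * t)"
  shows "rlog (\<lambda>t. \<gamma> (d + c * t)) t = c *\<^sub>R rlog \<gamma> (d + c * t)"
  using vector_derivative_at[OF vector_derivative_affine[OF rlog_differentiable[OF assms]]]
  by (simp add: rlog_def o_def)

text \<open>
  The tangent maps of the translations by \<open>iv (\<gamma> t)\<close> are not known to depend continuously on \<open>t\<close>.  But
  the difference quotients of \<open>s \<mapsto> \<gamma> s \<odot> iv (\<gamma> t)\<close> at \<open>t\<close> do, since the group operations are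
  continuous.
\<close>

lemma rlog_strongly_measurable:
  assumes \<gamma>: "W1p_curve p A {a..b} \<gamma>" and ab: "a \<le> b"
  shows "strongly_measurable (lebesgue_on {a..b}) (rlog \<gamma>)"
  using ab
proof (rule interval_localization)
  show "strongly_measurable (lebesgue_on {r..t}) (rlog \<gamma>)"
    if "r \<le> s" "s \<le> t" "strongly_measurable (lebesgue_on {r..s}) (rlog \<gamma>)" "strongly_measurable (lebesgue_on {s..t}) (rlog \<gamma>)" for r s t
    using that by (intro strongly_measurable_combine[of r s _ t]) auto
next
  fix x assume x: "x \<in> {a..b}"
  have cont: "continuous_on {a..b} \<gamma>" using \<gamma> by (simp add: W1p_curve_def)
  obtain V \<psi> where V: "chart_at A e = (V, \<psi>)" by fastforce
  then have V': "(V, \<psi>) \<in> A" "e \<in> V" using chart_at_mem[OF smooth_atlas, of e] by auto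
  let ?m = "\<lambda>(y, z). y \<odot> iv z"
  have m: "continuous_on UNIV ?m"
    unfolding split_def
    by (rule continuous_on_compose2[OF continuous_mult, of UNIV "\<lambda>p. (fst p, iv (snd p))", simplified split_def, simplified])
      (intro continuous_intros continuous_on_compose2[OF continuous_inv]; simp)
  have op: "open (?m -` V)" using m chartD(1)[OF smooth_atlas V'(1)] by (rule open_vimage[rotated])
  have mem: "(\<gamma> x, \<gamma> x) \<in> ?m -` V" using V' by simp
  obtain W1 W2 where W: "open W1" "open W2" "(\<gamma> x, \<gamma> x) \<in> W1 \<times> W2" "W1 \<times> W2 \<subseteq> ?m -` V"
    by (rule open_prod_elim[OF op mem])
  have W12: "open (W1 \<inter> W2)" "\<gamma> x \<in> W1 \<inter> W2" using W by auto
  obtain \<delta> where \<delta>: "\<delta> > 0" "\<And>c d. a \<le> c \<Longrightarrow> c \<le> x \<Longrightarrow> x \<le> d \<Longrightarrow> d \<le> b \<Longrightarrow> d - c < \<delta> \<Longrightarrow> \<gamma> ` {c..d} \<subseteq> W1 \<inter> W2"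
    using curve_near[OF cont x W12] by blast
  have "strongly_measurable (lebesgue_on {c..d}) (rlog \<gamma>)"
    if cd: "a \<le> c" "c \<le> x" "x \<le> d" "d \<le> b" "d - c < \<delta>" for c d
  proof -
    let ?h = "\<lambda>s t. \<psi> (\<gamma> s \<odot> iv (\<gamma> t))"
    have sub: "{c..d} \<subseteq> {a..b}" using cd by auto
    have "continuous_on ({c..d} \<times> {c..d}) (\<lambda>(s, t). (\<gamma> s, \<gamma> t))"
      unfolding split_def
      by (intro continuous_intros continuous_on_compose2[OF continuous_on_subset[OF cont sub]]) auto
    then have "continuous_on ({c..d} \<times> {c..d}) (\<lambda>st. ?m (case st of (s, t) \<Rightarrow> (\<gamma> s, \<gamma> t)))"
      by (rule continuous_on_compose2[OF m]) simp
    then have "continuous_on ({c..d} \<times> {c..d}) (\<lambda>st. \<psi> (?m (case st of (s, t) \<Rightarrow> (\<gamma> s, \<gamma> t))))"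
    proof (rule continuous_on_compose2[OF chartD(3)[OF smooth_atlas V'(1)]])
      show "(\<lambda>st. ?m (case st of (s, t) \<Rightarrow> (\<gamma> s, \<gamma> t))) ` ({c..d} \<times> {c..d}) \<subseteq> V"
      proof (clarify)
        fix s t assume "s \<in> {c..d}" "t \<in> {c..d}"
        then have "\<gamma> s \<in> W1" "\<gamma> t \<in> W2" using \<delta>(2)[OF cd] by auto
        then show "\<gamma> s \<odot> iv (\<gamma> t) \<in> V" using W(4) by auto
      qed
    qed
    then have "continuous_on ({c..d} \<times> {c..d}) (\<lambda>(s, t). ?h s t)" by (simp add: split_def)
    moreover have "AE t in lebesgue_on {c..d}. (\<lambda>s. ?h s t) differentiable (at t)"
    proof -
      have "AE t in lebesgue_on {c..d}. c < t \<and> t < d \<and> isCont \<gamma> t \<and> chart_differentiable A \<gamma> t"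
        by (rule W1p_curve_AE_differentiable[OF smooth_atlas W1p_curve_subset[OF \<gamma> sub]]) (use cd in simp)
      then show ?thesis
      proof eventually_elim
        case (elim t)
        then show ?case using rlog_differentiable[where \<gamma>=\<gamma> and t=t] by (simp add: V o_def)
      qed
    qed
    ultimately have "strongly_measurable (lebesgue_on {c..d}) (\<lambda>t. vector_derivative (\<lambda>s. ?h s t) (at t))"
      by (rule strongly_measurable_diagonal_derivative)
    moreover have "rlog \<gamma> = (\<lambda>t. vector_derivative (\<lambda>s. ?h s t) (at t))"
      by (simp add: fun_eq_iff rlog_def V o_def)
    ultimately show ?thesis by simp
  qed
  then show "\<exists>\<delta>>0. \<forall>c d. a \<le> c \<and> c \<le> x \<and> x \<le> d \<and> d \<le> b \<and> d - c < \<delta> \<longrightarrow> strongly_measurable (lebesgue_on {c..d}) (rlog \<gamma>)"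
    using \<delta>(1) by blast
qed

lemma lagrangian_rlog:
  assumes "right_invariant_lagrangian mul A L" "isCont \<gamma> t" "chart_differentiable A \<gamma> t"
  shows "L (\<gamma> t) (velocity A \<gamma> t) = L e (rlog \<gamma> t)"
proof -
  have "L (e \<odot> \<gamma> t) (tangent_map A (\<lambda>z. z \<odot> \<gamma> t) e (rlog \<gamma> t)) = L e (rlog \<gamma> t)"
    using assms(1) unfolding right_invariant_lagrangian_def by blast
  then show ?thesis by (simp add: velocity_eq_rlog[OF assms(2,3)] left_neutral)
qed

lemma tangent_map_linear: "linear (tangent_map A (\<lambda>z. z \<odot> x) e)"
proof -
  obtain V \<psi> where V: "chart_at A e = (V, \<psi>)" by fastforce
  then have V': "(V, \<psi>) \<in> A" "e \<in> V" using chart_at_mem[OF smooth_atlas, of e] by auto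
  obtain U \<phi> where U: "chart_at A x = (U, \<phi>)" by fastforce
  then have U': "(U, \<phi>) \<in> A" "x \<in> U" using chart_at_mem[OF smooth_atlas, of x] by auto
  have "\<psi> e \<in> \<psi> ` (V \<inter> (\<lambda>z. z \<odot> x) -` U)" using V' U' by (auto simp: left_neutral)
  from chart_rep_facts(2)[OF smooth_atlas V'(1) U'(1) smooth_right_mult continuous_right_mult this]
  show ?thesis by (simp add: tangent_map_def U V left_neutral linear_frechet_derivative)
qed

end

section \<open>Comparison of the metric with the norm of the model space\<close>

text \<open>
  Some ball of the metric lies in the unit ball of the norm.
\<close>

lemma strong_metric_lower_bound:
  assumes strong: "strong_metric \<G>" and bil: "bilinear (\<G> x)"
  shows "\<exists>c>0. \<forall>v. c * (norm v)\<^sup>2 \<le> \<G> x v v"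
proof -
  have "\<exists>\<epsilon>>0. \<forall>w. sqrt (\<G> x (w - 0) (w - 0)) < \<epsilon> \<longrightarrow> w \<in> ball 0 1"
    using strong unfolding strong_metric_def by (metis open_ball centre_in_ball zero_less_one)
  then obtain \<epsilon> where \<epsilon>: "\<epsilon> > 0" "\<And>w. sqrt (\<G> x w w) < \<epsilon> \<Longrightarrow> norm w < 1" by auto
  have "\<epsilon>\<^sup>2 * (norm v)\<^sup>2 \<le> \<G> x v v" for v
  proof (cases "v = 0")
    case True
    then show ?thesis by (simp add: bilinear_lzero[OF bil])
  next
    case False
    define w where "w = v /\<^sub>R norm v"
    have "\<not> sqrt (\<G> x w w) < \<epsilon>" using \<epsilon>(2)[of w] False by (auto simp: w_def)
    then have sq: "\<epsilon> \<le> sqrt (\<G> x w w)" by simp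
    then have "0 < \<G> x w w" using \<epsilon>(1) real_sqrt_gt_0_iff[of "\<G> x w w"] by linarith
    then have "\<epsilon>\<^sup>2 \<le> \<G> x w w" using power_mono[OF sq, of 2] \<epsilon>(1) by simp
    moreover have "\<G> x v v = (norm v)\<^sup>2 * \<G> x w w"
      using False by (simp add: w_def bilinear_lmul[OF bil] bilinear_rmul[OF bil] power2_eq_square field_simps)
    moreover have "\<epsilon>\<^sup>2 * (norm v)\<^sup>2 \<le> \<G> x w w * (norm v)\<^sup>2" using calculation(1) by (rule mult_right_mono) simp
    ultimately show ?thesis by (simp add: mult.commute)
  qed
  then show ?thesis using \<epsilon>(1) by (intro exI[of _ "\<epsilon>\<^sup>2"]) auto
qed

text \<open>
  In its preferred chart the metric at \<open>x0\<close> is bounded below because it is strong, and above because it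
  is a second derivative.  Continuity in the operator norm carries both bounds to nearby points.
\<close>

lemma metric_locally_equivalent:
  fixes A :: "('g::topological_space, 'e::real_normed_vector) chart set"
  assumes A: "smooth_atlas A" and \<G>: "riemannian_metric A \<G>" "strong_metric \<G>"
  obtains W c C where "open W" "x0 \<in> W" "W \<subseteq> fst (chart_at A x0)" "0 < c" "0 < C"
    "\<And>x v. x \<in> W \<Longrightarrow> c * (norm v)\<^sup>2 \<le> \<G> x (from_chart A (chart_at A x0) x v) (from_chart A (chart_at A x0) x v)"
    "\<And>x v. x \<in> W \<Longrightarrow> \<G> x (from_chart A (chart_at A x0) x v) (from_chart A (chart_at A x0) x v) \<le> C * (norm v)\<^sup>2"
proof -
  obtain U \<phi> where U: "chart_at A x0 = (U, \<phi>)" by fastforce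
  then have U': "(U, \<phi>) \<in> A" "x0 \<in> U" using chart_at_mem[OF A, of x0] by auto
  let ?T = "\<lambda>x. from_chart A (U, \<phi>) x"
  define \<Phi> where "\<Phi> = (\<lambda>(y, v, w). let x = inv_into U \<phi> y in \<G> x (?T x v) (?T x w))"
  have \<Phi>: "\<Phi> (\<phi> x, v, w) = \<G> x (?T x v) (?T x w)" if "x \<in> U" for x v w
    using chartD(5)[OF A U'(1) that] by (simp add: \<Phi>_def)
  have bil: "bilinear (\<G> x)" for x using \<G>(1) by (simp add: riemannian_metric_def)
  have linT: "linear (?T x)" if "x \<in> U" for x
  proof -
    obtain V \<psi> where V: "chart_at A x = (V, \<psi>)" by fastforce
    then have V': "(V, \<psi>) \<in> A" "x \<in> V" using chart_at_mem[OF A, of x] by auto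
    have "\<phi> x \<in> \<phi> ` (U \<inter> id -` V)" using V' that by auto
    from chart_rep_facts(2)[OF A U'(1) V'(1) smooth_id(1)[OF A] smooth_id(2) this]
    show ?thesis by (simp add: from_chart_def V linear_frechet_derivative)
  qed
  have "smooth_on (\<phi> ` U \<times> UNIV \<times> UNIV) \<Phi>"
    using \<G>(1) U'(1) unfolding riemannian_metric_def \<Phi>_def by blast
  then have C2: "Ck_on 2 (\<phi> ` U \<times> UNIV \<times> UNIV) \<Phi>" by (simp add: smooth_on_def)
  have "bilinear (\<lambda>v w. \<Phi> (y, v, w))" if y: "y \<in> \<phi> ` U" for y
  proof -
    obtain x where x: "x \<in> U" "y = \<phi> x" using y by auto
    show ?thesis
      unfolding bilinear_def x(2) \<Phi>[OF x(1)]
      using bil[of x] linT[OF x(1)] by (auto simp: bilinear_def intro: linear_compose[unfolded o_def])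
  qed
  from C2_bilinear_form[OF C2 chartD(2)[OF A U'(1)] this, of "\<phi> x0"] U'(2)
  obtain K where K: "\<And>v w. \<bar>\<Phi> (\<phi> x0, v, w)\<bar> \<le> K * (norm v * norm w)"
    and cont: "\<And>\<epsilon>. 0 < \<epsilon> \<Longrightarrow> \<exists>\<delta>>0. \<forall>y\<in>\<phi> ` U. dist y (\<phi> x0) < \<delta> \<longrightarrow>
      (\<forall>v w. \<bar>\<Phi> (y, v, w) - \<Phi> (\<phi> x0, v, w)\<bar> \<le> \<epsilon> * (norm v * norm w))" by blast
  obtain c where c: "c > 0" "\<And>v. c * (norm v)\<^sup>2 \<le> \<G> x0 v v"
    using strong_metric_lower_bound[OF \<G>(2) bil] by blast
  have "0 < c / 2" using c by simp
  from cont[OF this] obtain \<delta> where \<delta>: "\<delta> > 0" "\<And>y v w. y \<in> \<phi> ` U \<Longrightarrow> dist y (\<phi> x0) < \<delta> \<Longrightarrow>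
      \<bar>\<Phi> (y, v, w) - \<Phi> (\<phi> x0, v, w)\<bar> \<le> c / 2 * (norm v * norm w)" by blast
  define W where "W = U \<inter> \<phi> -` ball (\<phi> x0) \<delta>"
  have "open W" unfolding W_def
    using continuous_open_preimage[OF chartD(3)[OF A U'(1)] chartD(1)[OF A U'(1)]] by simp
  moreover have "x0 \<in> W" "W \<subseteq> U" using U' \<delta>(1) by (auto simp: W_def)
  moreover have "c / 2 * (norm v)\<^sup>2 \<le> \<G> x (?T x v) (?T x v)" "\<G> x (?T x v) (?T x v) \<le> (\<bar>K\<bar> + c) * (norm v)\<^sup>2"
    if x: "x \<in> W" for x v
  proof -
    have "x \<in> U" "dist (\<phi> x) (\<phi> x0) < \<delta>" using x by (auto simp: W_def dist_commute)
    then have "\<bar>\<G> x (?T x v) (?T x v) - \<Phi> (\<phi> x0, v, v)\<bar> \<le> c / 2 * (norm v)\<^sup>2"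
      using \<delta>(2)[of "\<phi> x" v v] by (simp add: \<Phi> power2_eq_square)
    moreover have "c * (norm v)\<^sup>2 \<le> \<Phi> (\<phi> x0, v, v)"
      using c(2)[of v] from_chart_preferred[OF A, of x0] by (simp add: \<Phi>[OF U'(2)] U)
    moreover have "\<Phi> (\<phi> x0, v, v) \<le> \<bar>K\<bar> * (norm v)\<^sup>2"
    proof -
      have "K * (norm v * norm v) \<le> \<bar>K\<bar> * (norm v * norm v)" by (intro mult_right_mono) auto
      then show ?thesis using K[of v v] unfolding power2_eq_square by linarith
    qed
    moreover have "c / 2 * (norm v)\<^sup>2 + c / 2 * (norm v)\<^sup>2 = c * (norm v)\<^sup>2" by simp
    moreover have "0 \<le> c / 2 * (norm v)\<^sup>2" using c(1) by simp
    ultimately show "c / 2 * (norm v)\<^sup>2 \<le> \<G> x (?T x v) (?T x v)" "\<G> x (?T x v) (?T x v) \<le> (\<bar>K\<bar> + c) * (norm v)\<^sup>2"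
      unfolding distrib_right by linarith+
  qed
  moreover have "0 < c / 2" "0 < \<bar>K\<bar> + c" using c(1) by auto
  ultimately show ?thesis using that[of W "c / 2" "\<bar>K\<bar> + c"] unfolding U by simp
qed

section \<open>Paths and square integrable curves in the Lie algebra\<close>

lemma AE_lebesgue_iff_negligible: "(AE x in lebesgue. P x) \<longleftrightarrow> negligible {x. \<not> P x}"
  using AE_lebesgue_on_iff_negligible[of UNIV P] by (subst lebesgue_on_UNIV_eq[symmetric]) simp

lemma AE_lebesgueI_intervals:
  assumes "\<And>n::nat. AE x in lebesgue_on {- real n..real n}. P x"
  shows "AE x in lebesgue. P x"
proof -
  have "x \<in> (\<Union>n::nat. {x \<in> {- real n..real n}. \<not> P x})" if "\<not> P x" for x
  proof -
    obtain n :: nat where "\<bar>x\<bar> \<le> real n" using real_arch_simple by blast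
    then have "x \<in> {x \<in> {- real n..real n}. \<not> P x}" using that by (auto simp: abs_le_iff)
    then show ?thesis by blast
  qed
  then have "{x. \<not> P x} = (\<Union>n::nat. {x \<in> {- real n..real n}. \<not> P x})" by auto
  moreover have "negligible (\<Union>n::nat. {x \<in> {- real n..real n}. \<not> P x})"
    using assms by (intro negligible_countable_Union) (auto simp: AE_lebesgue_on_iff_negligible)
  ultimately show ?thesis by (simp add: AE_lebesgue_iff_negligible)
qed

lemma AE_lebesgue_imp_interval:
  assumes "AE x in lebesgue. P x" shows "AE x in lebesgue_on {a..b::real}. P x"
  using assms by (simp add: AE_lebesgue_iff_negligible AE_lebesgue_on_iff_negligible) (erule negligible_subset, auto)

locale half_lie_group_metric = half_lie_group mul e iv A
  for mul :: "'g::t2_space \<Rightarrow> 'g \<Rightarrow> 'g" (infixl \<open>\<odot>\<close> 70)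
    and e :: 'g
    and iv :: "'g \<Rightarrow> 'g"
    and A :: "('g, 'e::{real_inner, complete_space}) chart set" +
  fixes \<G> :: "'g \<Rightarrow> 'e \<Rightarrow> 'e \<Rightarrow> real"
  assumes riemannian: "riemannian_metric A \<G>"
    and strong: "strong_metric \<G>"
    and right_invariant: "right_invariant_metric mul e A \<G>"
begin

lemma metric_e_bounds:
  obtains c C where "0 < c" "0 < C" "\<And>v. c * (norm v)\<^sup>2 \<le> \<G> e v v" "\<And>v. \<G> e v v \<le> C * (norm v)\<^sup>2"
proof -
  obtain W c C where W: "open W" "e \<in> W" "W \<subseteq> fst (chart_at A e)" and c: "0 < c" "0 < C"
    and b: "\<And>x v. x \<in> W \<Longrightarrow> c * (norm v)\<^sup>2 \<le> \<G> x (from_chart A (chart_at A e) x v) (from_chart A (chart_at A e) x v)"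
    "\<And>x v. x \<in> W \<Longrightarrow> \<G> x (from_chart A (chart_at A e) x v) (from_chart A (chart_at A e) x v) \<le> C * (norm v)\<^sup>2"
    using metric_locally_equivalent[OF smooth_atlas riemannian strong, of e] by blast
  show ?thesis
    by (rule that[OF c]) (use b[OF W(2)] in \<open>simp_all add: from_chart_preferred[OF smooth_atlas]\<close>)
qed

text \<open>
  Right invariance turns the length of the velocity into the length of the logarithmic derivative,
  so the two are locally comparable although the right translations involved vary with the point.
\<close>

lemma rlog_norm_locally_equivalent:
  obtains W K1 K2 where "open W" "x0 \<in> W" "W \<subseteq> fst (chart_at A x0)"
    "\<And>\<gamma> t. isCont \<gamma> t \<Longrightarrow> chart_differentiable A \<gamma> t \<Longrightarrow> \<gamma> t \<in> W \<Longrightarrow>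
      norm (rlog \<gamma> t) \<le> K1 * norm (vector_derivative (snd (chart_at A x0) \<circ> \<gamma>) (at t))"
    "\<And>\<gamma> t. isCont \<gamma> t \<Longrightarrow> chart_differentiable A \<gamma> t \<Longrightarrow> \<gamma> t \<in> W \<Longrightarrow>
      norm (vector_derivative (snd (chart_at A x0) \<circ> \<gamma>) (at t)) \<le> K2 * norm (rlog \<gamma> t)"
proof -
  obtain W c C where W: "open W" "x0 \<in> W" "W \<subseteq> fst (chart_at A x0)" and c: "0 < c" "0 < C"
    and b: "\<And>x v. x \<in> W \<Longrightarrow> c * (norm v)\<^sup>2 \<le> \<G> x (from_chart A (chart_at A x0) x v) (from_chart A (chart_at A x0) x v)"
    "\<And>x v. x \<in> W \<Longrightarrow> \<G> x (from_chart A (chart_at A x0) x v) (from_chart A (chart_at A x0) x v) \<le> C * (norm v)\<^sup>2"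
    using metric_locally_equivalent[OF smooth_atlas riemannian strong, of x0] by blast
  obtain c' C' where c': "0 < c'" "0 < C'" "\<And>v. c' * (norm v)\<^sup>2 \<le> \<G> e v v" "\<And>v. \<G> e v v \<le> C' * (norm v)\<^sup>2"
    by (rule metric_e_bounds) blast
  obtain U \<phi> where U: "chart_at A x0 = (U, \<phi>)" by fastforce
  then have U': "(U, \<phi>) \<in> A" using chart_at_mem[OF smooth_atlas, of x0] by auto
  have both: "c' * (norm (rlog \<gamma> t))\<^sup>2 \<le> C * (norm (vector_derivative (\<phi> \<circ> \<gamma>) (at t)))\<^sup>2 \<and>
      c * (norm (vector_derivative (\<phi> \<circ> \<gamma>) (at t)))\<^sup>2 \<le> C' * (norm (rlog \<gamma> t))\<^sup>2"
    if \<gamma>: "isCont \<gamma> t" "chart_differentiable A \<gamma> t" "\<gamma> t \<in> W" for \<gamma> t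
  proof -
    let ?v = "velocity A \<gamma> t"
    have "\<gamma> t \<in> U" using \<gamma>(3) W(3) U by auto
    then have v1: "?v = from_chart A (chart_at A x0) (\<gamma> t) (vector_derivative (\<phi> \<circ> \<gamma>) (at t))"
      using velocity_from_chart[OF smooth_atlas U' \<gamma>(1,2)] U by simp
    have "\<G> (\<gamma> t) ?v ?v = \<G> e (rlog \<gamma> t) (rlog \<gamma> t)"
      using right_invariant unfolding right_invariant_metric_def velocity_eq_rlog[OF \<gamma>(1,2)] by blast
    then show ?thesis
      using b[OF \<gamma>(3), of "vector_derivative (\<phi> \<circ> \<gamma>) (at t)"] c'(3,4)[of "rlog \<gamma> t"]
      unfolding v1 by linarith
  qed
  have root: "norm u \<le> sqrt (k / l) * norm v" if "l * (norm u)\<^sup>2 \<le> k * (norm v)\<^sup>2" "0 < l" for u v :: 'e and k l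
  proof -
    have "(norm u)\<^sup>2 \<le> k / l * (norm v)\<^sup>2" using that by (simp add: field_simps)
    then have "sqrt ((norm u)\<^sup>2) \<le> sqrt (k / l * (norm v)\<^sup>2)" by (rule real_sqrt_le_mono)
    then show ?thesis by (simp only: real_sqrt_mult real_sqrt_abs abs_norm_cancel)
  qed
  show ?thesis
  proof (rule that[OF W, of "sqrt (C / c')" "sqrt (C' / c)"])
    fix \<gamma> :: "real \<Rightarrow> 'g" and t :: real
    assume \<gamma>: "isCont \<gamma> t" "chart_differentiable A \<gamma> t" "\<gamma> t \<in> W"
    show "norm (rlog \<gamma> t) \<le> sqrt (C / c') * norm (vector_derivative (snd (chart_at A x0) \<circ> \<gamma>) (at t))"
      using both[OF \<gamma>] c'(1) unfolding U snd_conv by (intro root) auto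
    show "norm (vector_derivative (snd (chart_at A x0) \<circ> \<gamma>) (at t)) \<le> sqrt (C' / c) * norm (rlog \<gamma> t)"
      using both[OF \<gamma>] c(1) unfolding U snd_conv by (intro root) auto
  qed
qed

lemma rlog_in_L2:
  assumes \<gamma>: "W1p_curve 2 A {a..b} \<gamma>" and ab: "a \<le> b"
  shows "rlog \<gamma> \<in> Lp 2 a b"
  using ab
proof (rule interval_localization)
  show "rlog \<gamma> \<in> Lp 2 r t" if "r \<le> s" "s \<le> t" "rlog \<gamma> \<in> Lp 2 r s" "rlog \<gamma> \<in> Lp 2 s t" for r s t
    by (rule Lp_combine[OF that(3,4,1,2)])
  fix x assume x: "x \<in> {a..b}"
  have cont: "continuous_on {a..b} \<gamma>" using \<gamma> by (simp add: W1p_curve_def)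
  obtain W K1 K2 where W: "open W" "\<gamma> x \<in> W" "W \<subseteq> fst (chart_at A (\<gamma> x))"
    and K: "\<And>\<eta> t. isCont \<eta> t \<Longrightarrow> chart_differentiable A \<eta> t \<Longrightarrow> \<eta> t \<in> W \<Longrightarrow>
      norm (rlog \<eta> t) \<le> K1 * norm (vector_derivative (snd (chart_at A (\<gamma> x)) \<circ> \<eta>) (at t))"
    by (rule rlog_norm_locally_equivalent) blast
  obtain U \<phi> where U: "chart_at A (\<gamma> x) = (U, \<phi>)" by fastforce
  then have U': "(U, \<phi>) \<in> A" using chart_at_mem[OF smooth_atlas, of "\<gamma> x"] by auto
  obtain \<delta> where \<delta>: "\<delta> > 0" "\<And>c d. a \<le> c \<Longrightarrow> c \<le> x \<Longrightarrow> x \<le> d \<Longrightarrow> d \<le> b \<Longrightarrow> d - c < \<delta> \<Longrightarrow> \<gamma> ` {c..d} \<subseteq> W"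
    using curve_near[OF cont x W(1,2)] by blast
  have "rlog \<gamma> \<in> Lp 2 c d" if cd: "a \<le> c" "c \<le> x" "x \<le> d" "d \<le> b" "d - c < \<delta>" for c d
  proof -
    have sub: "{c..d} \<subseteq> {a..b}" "c \<le> d" using cd by auto
    have im: "\<gamma> ` {c..d} \<subseteq> W" by (rule \<delta>(2)[OF cd])
    have \<gamma>': "W1p_curve 2 A {c..d} \<gamma>" by (rule W1p_curve_subset[OF \<gamma> sub(1)])
    have "\<gamma> ` {c..d} \<subseteq> U" using im W(3) U by auto
    then have "\<phi> \<circ> \<gamma> \<in> W1p 2 c d" using \<gamma>' U' sub(2) unfolding W1p_curve_def by blast
    then have L: "(\<lambda>t. vector_derivative (\<phi> \<circ> \<gamma>) (at t)) \<in> Lp 2 c d" by (rule W1p_derivative_Lp)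
    show ?thesis
    proof (rule Lp_bound[OF L rlog_strongly_measurable[OF \<gamma>' sub(2)]])
      show "AE t in lebesgue_on {c..d}. norm (rlog \<gamma> t) \<le> K1 * norm (vector_derivative (\<phi> \<circ> \<gamma>) (at t))"
        using W1p_curve_AE_differentiable[OF smooth_atlas \<gamma>' sub(2)]
      proof eventually_elim
        case (elim t)
        then have "\<gamma> t \<in> W" using im by auto
        then show ?case using elim by (intro K[unfolded U snd_conv]) auto
      qed
    qed
  qed
  then show "\<exists>\<delta>>0. \<forall>c d. a \<le> c \<and> c \<le> x \<and> x \<le> d \<and> d \<le> b \<and> d - c < \<delta> \<longrightarrow> rlog \<gamma> \<in> Lp 2 c d"
    using \<delta>(1) by blast
qed

text \<open>
  Regularity only asserts that evolutions are \<open>W\<^sup>1\<^sup>,\<^sup>1\<close> curves; this is how the evolution of a square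
  integrable curve becomes an \<open>H\<^sup>1\<close> curve.
\<close>

lemma H1_curve_if_rlog_L2:
  assumes \<gamma>: "W1p_curve 1 A {a..b} \<gamma>" and L2: "rlog \<gamma> \<in> Lp 2 a b"
  shows "W1p_curve 2 A {a..b} \<gamma>"
proof (rule W1p_curveI_local[OF smooth_atlas])
  show cont: "continuous_on {a..b} \<gamma>" using \<gamma> by (simp add: W1p_curve_def)
  fix x assume x: "x \<in> {a..b}"
  obtain W K1 K2 where W: "open W" "\<gamma> x \<in> W" "W \<subseteq> fst (chart_at A (\<gamma> x))"
    and K: "\<And>\<eta> t. isCont \<eta> t \<Longrightarrow> chart_differentiable A \<eta> t \<Longrightarrow> \<eta> t \<in> W \<Longrightarrow>
      norm (vector_derivative (snd (chart_at A (\<gamma> x)) \<circ> \<eta>) (at t)) \<le> K2 * norm (rlog \<eta> t)"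
    by (rule rlog_norm_locally_equivalent) blast
  obtain U \<phi> where U: "chart_at A (\<gamma> x) = (U, \<phi>)" by fastforce
  then have U': "(U, \<phi>) \<in> A" "\<gamma> x \<in> U" using chart_at_mem[OF smooth_atlas, of "\<gamma> x"] by auto
  obtain \<delta> where \<delta>: "\<delta> > 0" "\<And>c d. a \<le> c \<Longrightarrow> c \<le> x \<Longrightarrow> x \<le> d \<Longrightarrow> d \<le> b \<Longrightarrow> d - c < \<delta> \<Longrightarrow> \<gamma> ` {c..d} \<subseteq> W"
    using curve_near[OF cont x W(1,2)] by blast
  have "\<phi> \<circ> \<gamma> \<in> W1p 2 c d" if cd: "a \<le> c" "c \<le> x" "x \<le> d" "d \<le> b" "d - c < \<delta>" for c d
  proof -
    have sub: "{c..d} \<subseteq> {a..b}" "c \<le> d" using cd by auto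
    have im: "\<gamma> ` {c..d} \<subseteq> W" by (rule \<delta>(2)[OF cd])
    have \<gamma>': "W1p_curve 1 A {c..d} \<gamma>" by (rule W1p_curve_subset[OF \<gamma> sub(1)])
    have "\<gamma> ` {c..d} \<subseteq> U" using im W(3) U by auto
    then have W1: "\<phi> \<circ> \<gamma> \<in> W1p 1 c d" using \<gamma>' U'(1) sub(2) unfolding W1p_curve_def by blast
    show ?thesis
    proof (rule W1p_exponent[OF W1], rule Lp_bound[OF Lp_subinterval[OF L2 sub(1)]])
      show "strongly_measurable (lebesgue_on {c..d}) (\<lambda>t. vector_derivative (\<phi> \<circ> \<gamma>) (at t))"
        using W1p_derivative_Lp[OF W1] by (rule LpD)
      show "AE t in lebesgue_on {c..d}. norm (vector_derivative (\<phi> \<circ> \<gamma>) (at t)) \<le> K2 * norm (rlog \<gamma> t)"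
        using W1p_curve_AE_differentiable[OF smooth_atlas \<gamma>' sub(2)]
      proof eventually_elim
        case (elim t)
        then have "\<gamma> t \<in> W" using im by auto
        then show ?case using elim by (intro K[unfolded U snd_conv]) auto
      qed
    qed
  qed
  then show "\<exists>(U, \<phi>)\<in>A. \<gamma> x \<in> U \<and> (\<exists>\<delta>>0. \<forall>c d. a \<le> c \<and> c \<le> x \<and> x \<le> d \<and> d \<le> b \<and> d - c < \<delta> \<longrightarrow> \<phi> \<circ> \<gamma> \<in> W1p 2 c d)"
    using \<delta>(1) U' by blast
qed simp

text \<open>
  The translation preserves the metric, which is definite.
\<close>

lemma tangent_map_injective:
  assumes "tangent_map A (\<lambda>z. z \<odot> x) e v = tangent_map A (\<lambda>z. z \<odot> x) e w"
  shows "v = w"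
proof -
  let ?T = "tangent_map A (\<lambda>z. z \<odot> x) e"
  obtain c C where c: "0 < c" "\<And>v. c * (norm v)\<^sup>2 \<le> \<G> e v v"
    by (rule metric_e_bounds) blast
  have "?T (v - w) = 0" using assms by (simp add: linear_diff[OF tangent_map_linear])
  moreover have "\<G> x (?T (v - w)) (?T (v - w)) = \<G> e (v - w) (v - w)"
    using right_invariant unfolding right_invariant_metric_def by blast
  moreover have "\<G> x 0 0 = 0"
    using riemannian bilinear_lzero[of "\<G> x"] by (simp add: riemannian_metric_def)
  ultimately have "c * (norm (v - w))\<^sup>2 \<le> 0" using c(2)[of "v - w"] by simp
  then have "(norm (v - w))\<^sup>2 \<le> 0" using c(1) by (simp add: mult_le_0_iff)
  then show ?thesis by simp
qed

lemma evolution_AE_rlog: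
  assumes "W1p_curve 1 A UNIV g"
  shows "(AE t in lebesgue. velocity A g t = tangent_map A (\<lambda>z. z \<odot> g t) e (X t)) \<longleftrightarrow>
    (AE t in lebesgue. rlog g t = X t)"
proof -
  have "AE t in lebesgue. isCont g t \<and> chart_differentiable A g t"
  proof (rule AE_lebesgueI_intervals)
    fix n :: nat
    have "AE t in lebesgue_on {- real n..real n}. - real n < t \<and> t < real n \<and> isCont g t \<and> chart_differentiable A g t"
      by (rule W1p_curve_AE_differentiable[OF smooth_atlas W1p_curve_subset[OF assms]]) auto
    then show "AE t in lebesgue_on {- real n..real n}. isCont g t \<and> chart_differentiable A g t"
      by eventually_elim simp
  qed
  then have "AE t in lebesgue. velocity A g t = tangent_map A (\<lambda>z. z \<odot> g t) e (X t) \<longleftrightarrow> rlog g t = X t"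
  proof eventually_elim
    case (elim t)
    then show ?case using velocity_eq_rlog[where \<gamma>=g and t=t] tangent_map_injective[of "g t" "rlog g t" "X t"] by auto
  qed
  then show ?thesis by (rule eventually_subst)
qed

end

lemma integral_cong_AE_interval:
  fixes f g :: "real \<Rightarrow> real"
  assumes "f \<in> borel_measurable (lebesgue_on {a..b})" "AE t in lebesgue_on {a..b}. f t = g t"
  shows "integral\<^sup>L (lebesgue_on {a..b}) f = integral\<^sup>L (lebesgue_on {a..b}) g"
proof -
  have "complete_measure (lebesgue_on {a..b})" by (rule complete_measure_lebesgue_on) simp
  then have "g \<in> borel_measurable (lebesgue_on {a..b})" using assms by (rule measurable_cong_AE_complete)
  then show ?thesis using assms by (intro integral_cong_AE) auto
qed

lemma borel_measurable_continuous_strongly: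
  fixes f :: "'e::real_normed_vector \<Rightarrow> real" and \<xi> :: "real \<Rightarrow> 'e"
  assumes "continuous_on UNIV f" "strongly_measurable (lebesgue_on {a..b}) \<xi>"
  shows "(\<lambda>t. f (\<xi> t)) \<in> borel_measurable (lebesgue_on {a..b})"
proof (rule strongly_measurable_real[OF complete_measure_lebesgue_on])
  show "strongly_measurable (lebesgue_on {a..b}) (\<lambda>t. f (\<xi> t))"
    by (rule strongly_measurable_compose[OF assms(2)])
      (use assms(1) in \<open>auto simp: continuous_on_eq_continuous_at intro: isCont_tendsto_compose\<close>)
qed simp

lemma integrable_quadratic_growth:
  fixes f :: "'e::real_normed_vector \<Rightarrow> real"
  assumes "continuous_on UNIV f" "\<And>w. \<bar>f w\<bar> \<le> C * (1 + (norm w)\<^sup>2)" "\<xi> \<in> Lp 2 a b"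
  shows "integrable (lebesgue_on {a..b}) (\<lambda>t. f (\<xi> t))"
proof (rule Bochner_Integration.integrable_bound)
  show "integrable (lebesgue_on {a..b}) (\<lambda>t. C * (1 + (norm (\<xi> t))\<^sup>2))"
    using LpD(2)[OF assms(3)] by simp
  show "(\<lambda>t. f (\<xi> t)) \<in> borel_measurable (lebesgue_on {a..b})"
    by (rule borel_measurable_continuous_strongly[OF assms(1) LpD(1)[OF assms(3)]])
  show "AE t in lebesgue_on {a..b}. norm (f (\<xi> t)) \<le> norm (C * (1 + (norm (\<xi> t))\<^sup>2))"
    using assms(2) by (intro AE_I2) (simp add: order.trans[OF _ abs_ge_self])
qed

lemma W1p_curve_if_chart_line:
  fixes A :: "('g::topological_space, 'e::real_inner) chart set"
  assumes A: "smooth_atlas A" "(U, \<phi>) \<in> A" and p: "1 \<le> p"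
    and seg: "\<And>t. t \<in> {0..1} \<Longrightarrow> u + t *\<^sub>R v \<in> \<phi> ` U"
  shows "W1p_curve p A {0..1} (\<lambda>t. inv_into U \<phi> (u + t *\<^sub>R v))"
proof (rule W1p_curveI_local[OF A(1) p])
  let ?\<gamma> = "\<lambda>t. inv_into U \<phi> (u + t *\<^sub>R v)"
  show "continuous_on {0..1} ?\<gamma>"
    by (rule continuous_on_compose2[OF chartD(4)[OF A]]) (use seg in \<open>auto intro!: continuous_intros\<close>)
  fix x :: real assume x: "x \<in> {0..1}"
  have "?\<gamma> x \<in> U" using seg[OF x] by (rule inv_into_into)
  moreover have "\<phi> \<circ> ?\<gamma> \<in> W1p p c d" if "0 \<le> c" "d \<le> 1" for c d
  proof (rule W1p_cong)
    show "(\<lambda>t. u + (t * 1) *\<^sub>R v) \<in> W1p p c d" by (rule W1p_line)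
    show "u + (t * 1) *\<^sub>R v = (\<phi> \<circ> ?\<gamma>) t" if "t \<in> {c..d}" for t
      using f_inv_into_f[OF seg[of t]] that \<open>0 \<le> c\<close> \<open>d \<le> 1\<close> by simp
  qed
  ultimately show "\<exists>(U, \<phi>)\<in>A. ?\<gamma> x \<in> U \<and> (\<exists>\<delta>>0. \<forall>c d. 0 \<le> c \<and> c \<le> x \<and> x \<le> d \<and> d \<le> 1 \<and> d - c < \<delta> \<longrightarrow> \<phi> \<circ> ?\<gamma> \<in> W1p p c d)"
    using A(2) zero_less_one by blast
qed

text \<open>
  The shift is written as an affine map of slope \<open>1\<close> in order to match \<open>W1p_curve_affine\<close>.
\<close>

definition concat_path :: "real \<Rightarrow> (real \<Rightarrow> 'g) \<Rightarrow> (real \<Rightarrow> 'g) \<Rightarrow> real \<Rightarrow> 'g"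
  where "concat_path T \<gamma> \<eta> t = (if t \<le> T then \<gamma> t else \<eta> (- T + 1 * t))"

lemma concat_path_right:
  assumes "(T, \<gamma>) \<in> paths A p q" "(S, \<eta>) \<in> paths A q r" "T \<le> t"
  shows "concat_path T \<gamma> \<eta> t = \<eta> (- T + 1 * t)"
  using assms by (auto simp: concat_path_def paths_def)

lemma concat_path_mem:
  fixes A :: "('g::topological_space, 'e::real_inner) chart set"
  assumes \<gamma>: "(T, \<gamma>) \<in> paths A p q" and \<eta>: "(S, \<eta>) \<in> paths A q r"
  shows "(T + S, concat_path T \<gamma> \<eta>) \<in> paths A p r"
proof -
  have TS: "0 < T" "0 < S" using \<gamma> \<eta> by (auto simp: paths_def)
  have "W1p_curve 2 A {0..T} (concat_path T \<gamma> \<eta>)"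
    by (rule W1p_curve_cong[where \<gamma>=\<gamma>]) (use \<gamma> in \<open>auto simp: paths_def concat_path_def\<close>)
  moreover have "W1p_curve 2 A {T..T + S} (concat_path T \<gamma> \<eta>)"
  proof (rule W1p_curve_cong[where \<gamma>="\<lambda>t. \<eta> (- T + 1 * t)"])
    show "W1p_curve 2 A {T..T + S} (\<lambda>t. \<eta> (- T + 1 * t))"
      by (rule W1p_curve_affine[where \<gamma>=\<eta> and u="- T" and c=1]) (use \<eta> in \<open>simp_all add: paths_def\<close>)
    show "\<eta> (- T + 1 * t) = concat_path T \<gamma> \<eta> t" if "t \<in> {T..T + S}" for t
      using concat_path_right[OF \<gamma> \<eta>, of t] that by simp
  qed
  ultimately have "W1p_curve 2 A {0..T + S} (concat_path T \<gamma> \<eta>)"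
    by (rule W1p_curve_combine[where b=T]) (use TS in simp_all)
  then show ?thesis using \<gamma> \<eta> TS by (auto simp: paths_def concat_path_def)
qed

text \<open>
  Any two points in a small ball of a chart are joined by a segment, so the points that can be reached
  from \<open>p\<close> form an open and closed set.
\<close>

lemma paths_nonempty_if_connected:
  fixes A :: "('g::t2_space, 'e::real_inner) chart set"
  assumes A: "smooth_atlas A" and conn: "connected_component UNIV p q"
  shows "\<exists>T \<gamma>. (T, \<gamma>) \<in> paths A p q"
proof -
  define S where "S = {y. \<exists>T \<gamma>. (T, \<gamma>) \<in> paths A p y}"
  have nbhd: "\<exists>N. open N \<and> x \<in> N \<and> (\<forall>y\<in>N. \<forall>z\<in>N. \<exists>\<gamma>. (1, \<gamma>) \<in> paths A y z)" for x
  proof -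
    obtain U \<phi> where U: "(U, \<phi>) \<in> A" "x \<in> U" using chart_at_mem[OF A] by (metis prod.collapse)
    obtain r where r: "r > 0" "ball (\<phi> x) r \<subseteq> \<phi> ` U"
      using chartD(2)[OF A U(1)] U(2) open_contains_ball by blast
    define N where "N = U \<inter> \<phi> -` ball (\<phi> x) r"
    have "open N" unfolding N_def
      using continuous_open_preimage[OF chartD(3)[OF A U(1)] chartD(1)[OF A U(1)]] by simp
    moreover have "x \<in> N" using U r by (simp add: N_def)
    moreover have "\<exists>\<gamma>. (1, \<gamma>) \<in> paths A y z" if yz: "y \<in> N" "z \<in> N" for y z
    proof -
      let ?\<gamma> = "\<lambda>t. inv_into U \<phi> (\<phi> y + t *\<^sub>R (\<phi> z - \<phi> y))"
      have "\<phi> y + t *\<^sub>R (\<phi> z - \<phi> y) \<in> \<phi> ` U" if "t \<in> {0..1}" for t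
      proof -
        have "(1 - t) *\<^sub>R \<phi> y + t *\<^sub>R \<phi> z \<in> ball (\<phi> x) r"
          using yz that by (intro convexD[OF convex_ball]) (auto simp: N_def)
        then show ?thesis using r(2) by (auto simp: algebra_simps)
      qed
      then have "W1p_curve 2 A {0..1} ?\<gamma>" by (intro W1p_curve_if_chart_line[OF A U(1)]) auto
      moreover have "?\<gamma> 0 = y" "?\<gamma> 1 = z" using yz chartD(5)[OF A U(1)] by (auto simp: N_def)
      ultimately show ?thesis by (intro exI[of _ ?\<gamma>]) (simp add: paths_def)
    qed
    ultimately show ?thesis by blast
  qed
  have step: "z \<in> S" if "y \<in> S" "(T', \<eta>) \<in> paths A y z" for y z T' \<eta>
    using that concat_path_mem unfolding S_def by blast
  have nbhd_S: "\<exists>N. open N \<and> x \<in> N \<and> (N \<subseteq> S \<or> N \<subseteq> - S)" for x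
  proof -
    obtain N where N: "open N" "x \<in> N" "\<And>y z. y \<in> N \<Longrightarrow> z \<in> N \<Longrightarrow> \<exists>\<gamma>. (1, \<gamma>) \<in> paths A y z"
      using nbhd[of x] by blast
    have "N \<subseteq> S \<or> N \<subseteq> - S" using N(3) step by blast
    then show ?thesis using N(1,2) by blast
  qed
  have "open S" "open (- S)"
    by (subst open_subopen; use nbhd_S in blast)+
  obtain C where C: "connected C" "p \<in> C" "q \<in> C" using conn by (auto simp: connected_component_def)
  have "p \<in> S" unfolding S_def using nbhd[of p] by blast
  have "q \<in> S"
  proof (rule ccontr)
    assume "q \<notin> S"
    then have "S \<inter> C \<noteq> {}" "- S \<inter> C \<noteq> {}" using C \<open>p \<in> S\<close> by auto
    then show False using connectedD[OF C(1) \<open>open S\<close> \<open>open (- S)\<close>] by auto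
  qed
  then show ?thesis by (simp add: S_def)
qed

lemma right_invariant_lagrangian_add:
  "right_invariant_lagrangian mul A L \<Longrightarrow> right_invariant_lagrangian mul A (\<lambda>x v. L x v + \<kappa>)"
  by (simp add: right_invariant_lagrangian_def)

context half_lie_group_metric
begin

lemma action_rlog:
  assumes L: "right_invariant_lagrangian mul A L" "continuous_on UNIV (L e)"
    and \<gamma>: "W1p_curve 2 A {0..T} \<gamma>" and T: "0 \<le> T"
  shows "action A L T \<gamma> = integral\<^sup>L (lebesgue_on {0..T}) (\<lambda>t. L e (rlog \<gamma> t))"
  unfolding action_def
proof (rule integral_cong_AE_interval[symmetric])
  show "(\<lambda>t. L e (rlog \<gamma> t)) \<in> borel_measurable (lebesgue_on {0..T})"
    by (rule borel_measurable_continuous_strongly[OF L(2) rlog_strongly_measurable[OF \<gamma> T]])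
  show "AE t in lebesgue_on {0..T}. L e (rlog \<gamma> t) = L (\<gamma> t) (velocity A \<gamma> t)"
    using W1p_curve_AE_differentiable[OF smooth_atlas \<gamma> T]
    by eventually_elim (simp add: lagrangian_rlog[OF L(1)])
qed

lemma rlog_affine_AE:
  assumes \<gamma>: "W1p_curve p A {d + c * a..d + c * b} \<gamma>" and c: "0 < c" and ab: "a \<le> b"
  shows "AE t in lebesgue_on {a..b}. rlog (\<lambda>t. \<gamma> (d + c * t)) t = c *\<^sub>R rlog \<gamma> (d + c * t)"
proof -
  have "AE t in lebesgue_on {d + c * a..d + c * b}. d + c * a < t \<and> t < d + c * b \<and> isCont \<gamma> t \<and> chart_differentiable A \<gamma> t"
    by (rule W1p_curve_AE_differentiable[OF smooth_atlas \<gamma>]) (use ab c in simp)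
  from AE_lebesgue_on_affine[OF this c] show ?thesis
    by eventually_elim (simp add: rlog_affine)
qed

text \<open>
  Rescaling to the unit interval puts the paths of all durations into one \<open>L\<^sup>2\<close> space.  Moving the
  starting point to \<open>e\<close> does not affect the logarithmic derivative, but makes the path an evolution.
\<close>

definition log_path :: "real \<Rightarrow> (real \<Rightarrow> 'g) \<Rightarrow> real \<Rightarrow> 'e"
  where "log_path T \<gamma> = rlog (\<lambda>t. \<gamma> (0 + T * t) \<odot> iv (\<gamma> 0))"

lemma translated_path:
  assumes "(T, \<gamma>) \<in> paths A p q"
  shows "W1p_curve 2 A {0..1} (\<lambda>t. \<gamma> (0 + T * t) \<odot> iv (\<gamma> 0))"
proof (rule W1p_curve_compose_smooth[OF smooth_atlas _ _ smooth_right_mult continuous_right_mult])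
  show "W1p_curve 2 A {0..1} (\<lambda>t. \<gamma> (0 + T * t))"
    by (rule W1p_curve_affine[where \<gamma>=\<gamma> and u=0 and c=T]) (use assms in \<open>simp_all add: paths_def\<close>)
qed simp

lemma log_path_in_L2: "(T, \<gamma>) \<in> paths A p q \<Longrightarrow> log_path T \<gamma> \<in> Lp 2 0 1"
  unfolding log_path_def by (rule rlog_in_L2[OF translated_path]) auto

lemma action_log_path:
  assumes L: "right_invariant_lagrangian mul A L" "continuous_on UNIV (L e)"
    and \<gamma>: "(T, \<gamma>) \<in> paths A p q"
  shows "action A L T \<gamma> = T * integral\<^sup>L (lebesgue_on {0..1}) (\<lambda>t. L e (log_path T \<gamma> t /\<^sub>R T))"
proof -
  have T: "0 < T" and \<gamma>': "W1p_curve 2 A {0..T} \<gamma>" using \<gamma> by (auto simp: paths_def)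
  have "action A L T \<gamma> = integral\<^sup>L (lebesgue_on {0 + T * 0..0 + T * 1}) (\<lambda>t. L e (rlog \<gamma> t))"
    using action_rlog[OF L \<gamma>'] T by simp
  also have "\<dots> = T * integral\<^sup>L (lebesgue_on {0..1}) (\<lambda>t. L e (rlog \<gamma> (0 + T * t)))"
    by (rule integral_affine[OF T])
  also have "integral\<^sup>L (lebesgue_on {0..1}) (\<lambda>t. L e (rlog \<gamma> (0 + T * t)))
      = integral\<^sup>L (lebesgue_on {0..1}) (\<lambda>t. L e (log_path T \<gamma> t /\<^sub>R T))"
  proof (rule integral_cong_AE_interval[symmetric])
    show "(\<lambda>t. L e (log_path T \<gamma> t /\<^sub>R T)) \<in> borel_measurable (lebesgue_on {0..1})"
      by (rule borel_measurable_continuous_strongly[OF L(2)]) (intro strongly_measurable_scaleR LpD(1)[OF log_path_in_L2[OF \<gamma>]])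
    have "AE t in lebesgue_on {0..1}. rlog (\<lambda>t. \<gamma> (0 + T * t)) t = T *\<^sub>R rlog \<gamma> (0 + T * t)"
      by (rule rlog_affine_AE[OF _ T]) (use \<gamma>' in auto)
    then show "AE t in lebesgue_on {0..1}. L e (log_path T \<gamma> t /\<^sub>R T) = L e (rlog \<gamma> (0 + T * t))"
      unfolding log_path_def rlog_right_translate by eventually_elim (use T in simp)
  qed
  finally show ?thesis .
qed

text \<open>
  Continued by constants, the curve is the evolution of its logarithmic derivative continued by zero.
\<close>

lemma evol_rlog:
  assumes reg: "L2_regular mul e A" and \<gamma>: "W1p_curve 2 A {0..1} \<gamma>" "\<gamma> 0 = e"
  shows "evol mul e A (rlog \<gamma>) = \<gamma> 1"
proof -
  define X where "X t = (if t \<in> {0..1} then rlog \<gamma> t else 0)" for t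
  define g where "g t = \<gamma> (max 0 (min 1 t))" for t
  have X: "X \<in> Lp 2 a b" for a b
    unfolding X_def using rlog_in_L2[OF \<gamma>(1)] by (intro Lp_extend_zero) auto
  have cont: "continuous_on {0..1} \<gamma>" using \<gamma> by (simp add: W1p_curve_def)
  have gc: "continuous_on UNIV g" unfolding g_def
    by (rule continuous_on_compose2[OF cont]) (auto intro!: continuous_intros)
  have g1: "W1p_curve 1 A UNIV g"
  proof (rule W1p_curve_UNIV_I[OF gc])
    fix a b :: real
    have "W1p_curve 1 A {min a 0..0} g"
      by (rule W1p_curve_cong[OF W1p_curve_const[where x="\<gamma> 0"]]) (simp add: g_def max_absorb1 min.coboundedI2)
    moreover have "W1p_curve 1 A {0..1} g"
      by (rule W1p_curve_cong[OF W1p_curve_exponent_1[OF \<gamma>(1)]]) (auto simp: g_def)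
    ultimately have "W1p_curve 1 A {min a 0..1} g"
      by (rule W1p_curve_combine) auto
    moreover have "W1p_curve 1 A {1..max b 1} g"
      by (rule W1p_curve_cong[OF W1p_curve_const[where x="\<gamma> 1"]]) (simp add: g_def)
    ultimately have "W1p_curve 1 A {min a 0..max b 1} g"
      by (rule W1p_curve_combine) auto
    then show "W1p_curve 1 A {a..b} g" by (rule W1p_curve_subset) auto
  qed
  have "rlog g t = X t" if t: "t \<noteq> 0" "t \<noteq> 1" for t
  proof -
    consider "t < 0" | "0 < t" "t < 1" | "1 < t" using t by linarith
    then show ?thesis
    proof cases
      case 1
      then have "rlog g t = rlog (\<lambda>_. \<gamma> 0) t"
        by (intro rlog_cong[of "t - 1" 0]) (auto simp: g_def)
      then show ?thesis using 1 by (simp add: rlog_const X_def)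
    next
      case 2
      then have "rlog g t = rlog \<gamma> t" by (intro rlog_cong[of 0 1]) (auto simp: g_def)
      then show ?thesis using 2 by (simp add: X_def)
    next
      case 3
      then have "rlog g t = rlog (\<lambda>_. \<gamma> 1) t"
        by (intro rlog_cong[of 1 "t + 1"]) (auto simp: g_def)
      then show ?thesis using 3 by (simp add: rlog_const X_def)
    qed
  qed
  then have "{t. \<not> rlog g t = X t} \<subseteq> {0, 1}" by auto
  then have "AE t in lebesgue. rlog g t = X t"
    unfolding AE_lebesgue_iff_negligible by (rule negligible_subset[rotated]) simp
  then have ev: "evolution mul e A X g"
    unfolding evolution_def evolution_AE_rlog[OF g1] using g1 \<gamma>(2) by (simp add: g_def)
  have ex1: "\<exists>!g. evolution mul e A X g" using reg X unfolding L2_regular_def by blast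
  have "Evol mul e A X = g" unfolding Evol_def by (rule the1_equality[OF ex1, OF ev])
  moreover have "X = (\<lambda>t. if t \<in> {0..1} then rlog \<gamma> t else 0)" by (simp add: fun_eq_iff X_def)
  ultimately have "evol mul e A (rlog \<gamma>) = g 1" unfolding evol_def by (simp only:)
  then show ?thesis by (simp add: g_def)
qed

lemma L2_curve_integrates:
  assumes reg: "L2_regular mul e A" and \<xi>: "\<xi> \<in> Lp 2 0 1"
  obtains \<gamma> where "W1p_curve 2 A {0..1} \<gamma>" "\<gamma> 0 = e" "\<gamma> 1 = evol mul e A \<xi>"
    "AE t in lebesgue_on {0..1}. rlog \<gamma> t = \<xi> t"
proof -
  define X where "X t = (if t \<in> {0..1} then \<xi> t else 0)" for t
  define g where "g = Evol mul e A X"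
  have X: "X \<in> Lp 2 a b" for a b
    unfolding X_def by (rule Lp_extend_zero[OF \<xi>])
  have "\<exists>!g. evolution mul e A X g" using reg X unfolding L2_regular_def by blast
  then have ev: "evolution mul e A X g" unfolding g_def Evol_def by (rule theI')
  then have g1: "W1p_curve 1 A UNIV g" by (simp add: evolution_def)
  have "AE t in lebesgue. rlog g t = X t"
    using ev unfolding evolution_def evolution_AE_rlog[OF g1] by simp
  then have "AE t in lebesgue_on {0..1}. rlog g t = X t" by (rule AE_lebesgue_imp_interval)
  moreover have "AE t in lebesgue_on {0..1::real}. t \<in> {0..1}" using AE_space[of "lebesgue_on {0..1::real}"] by simp
  ultimately have ae: "AE t in lebesgue_on {0..1}. rlog g t = \<xi> t"
    by eventually_elim (simp add: X_def)
  then have "AE t in lebesgue_on {0..1}. \<xi> t = rlog g t" by eventually_elim simp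
  then have "rlog g \<in> Lp 2 0 1" by (rule Lp_cong_AE[OF \<xi>])
  then have "W1p_curve 2 A {0..1} g"
    by (rule H1_curve_if_rlog_L2[OF W1p_curve_subset[OF g1 subset_UNIV]])
  moreover have "g 0 = e" using ev by (simp add: evolution_def)
  moreover have "g 1 = evol mul e A \<xi>" by (simp add: g_def evol_def X_def[abs_def])
  ultimately show ?thesis using ae that by blast
qed

lemma evol_log_path:
  assumes reg: "L2_regular mul e A" and \<gamma>: "(T, \<gamma>) \<in> paths A p q"
  shows "evol mul e A (log_path T \<gamma>) = q \<odot> iv p"
proof -
  have "evol mul e A (log_path T \<gamma>) = \<gamma> (0 + T * 1) \<odot> iv (\<gamma> 0)"
    unfolding log_path_def by (rule evol_rlog[OF reg translated_path[OF \<gamma>]]) (simp add: right_inverse)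
  then show ?thesis using \<gamma> by (simp add: paths_def)
qed

lemma path_from_L2:
  assumes reg: "L2_regular mul e A" and T: "0 < T" and \<xi>: "\<xi> \<in> Lp 2 0 1" "evol mul e A \<xi> = q \<odot> iv p"
  obtains \<gamma> where "(T, \<gamma>) \<in> paths A p q" "AE t in lebesgue_on {0..1}. log_path T \<gamma> t = \<xi> t"
proof -
  obtain \<eta> where \<eta>: "W1p_curve 2 A {0..1} \<eta>" "\<eta> 0 = e" "\<eta> 1 = evol mul e A \<xi>"
    "AE t in lebesgue_on {0..1}. rlog \<eta> t = \<xi> t"
    using L2_curve_integrates[OF reg \<xi>(1)] by blast
  define \<gamma> where "\<gamma> t = \<eta> (0 + (1 / T) * t) \<odot> p" for t
  have "W1p_curve 2 A {0..T} \<gamma>"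
    unfolding \<gamma>_def
  proof (rule W1p_curve_compose_smooth[OF smooth_atlas _ _ smooth_right_mult continuous_right_mult])
    show "W1p_curve 2 A {0..T} (\<lambda>t. \<eta> (0 + 1 / T * t))"
      by (rule W1p_curve_affine[where \<gamma>=\<eta> and u=0 and c="1 / T"]) (use T \<eta>(1) in simp_all)
  qed simp
  moreover have "\<gamma> 0 = p" "\<gamma> T = q"
    using T \<eta>(2,3) \<xi>(2) by (simp_all add: \<gamma>_def left_neutral)
  ultimately have "(T, \<gamma>) \<in> paths A p q" using T by (simp add: paths_def)
  moreover have "log_path T \<gamma> = rlog \<eta>"
  proof -
    have "\<gamma> (0 + T * t) \<odot> iv (\<gamma> 0) = \<eta> t" for t
      using T \<open>\<gamma> 0 = p\<close> by (simp add: \<gamma>_def)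
    then show ?thesis by (simp add: log_path_def)
  qed
  ultimately show ?thesis using \<eta>(4) that by simp
qed

lemma action_concat_path:
  assumes L: "right_invariant_lagrangian mul A L" "continuous_on UNIV (L e)"
    and growth: "\<And>w. \<bar>L e w\<bar> \<le> C * (1 + (norm w)\<^sup>2)"
    and \<gamma>: "(T, \<gamma>) \<in> paths A p q" and \<eta>: "(S, \<eta>) \<in> paths A q r"
  shows "action A L (T + S) (concat_path T \<gamma> \<eta>) = action A L T \<gamma> + action A L S \<eta>"
proof -
  let ?c = "concat_path T \<gamma> \<eta>"
  have TS: "0 < T" "0 < S" and \<gamma>': "W1p_curve 2 A {0..T} \<gamma>" and \<eta>': "W1p_curve 2 A {0..S} \<eta>"
    using \<gamma> \<eta> by (auto simp: paths_def)
  have c: "W1p_curve 2 A {0..T + S} ?c" using concat_path_mem[OF \<gamma> \<eta>] by (simp add: paths_def)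
  have int: "integrable (lebesgue_on {0..T + S}) (\<lambda>t. L e (rlog ?c t))"
    by (rule integrable_quadratic_growth[OF L(2) growth rlog_in_L2[OF c]]) (use TS in auto)
  have meas: "(\<lambda>t. L e (rlog ?c t)) \<in> borel_measurable (lebesgue_on {a..b})" if "{a..b} \<subseteq> {0..T + S}" "a \<le> b" for a b
    by (rule borel_measurable_continuous_strongly[OF L(2) rlog_strongly_measurable[OF W1p_curve_subset[OF c that(1)] that(2)]])
  have "action A L (T + S) ?c = integral\<^sup>L (lebesgue_on {0..T + S}) (\<lambda>t. L e (rlog ?c t))"
    by (rule action_rlog[OF L c]) (use TS in auto)
  also have "\<dots> = integral\<^sup>L (lebesgue_on {0..T}) (\<lambda>t. L e (rlog ?c t)) + integral\<^sup>L (lebesgue_on {T..T + S}) (\<lambda>t. L e (rlog ?c t))"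
    using TS by (intro Equivalence_Measurable_On_Borel.integral_combine[OF int]) auto
  also have "integral\<^sup>L (lebesgue_on {0..T}) (\<lambda>t. L e (rlog ?c t)) = action A L T \<gamma>"
    unfolding action_rlog[OF L \<gamma>' less_imp_le[OF TS(1)]]
  proof (rule integral_cong_AE_interval[OF meas])
    have "rlog ?c t = rlog \<gamma> t" if "0 < t" "t < T" for t
      by (rule rlog_cong[of 0 T]) (use that in \<open>auto simp: concat_path_def\<close>)
    then show "AE t in lebesgue_on {0..T}. L e (rlog ?c t) = L e (rlog \<gamma> t)"
      by (intro AE_lebesgue_on_interior) auto
  qed (use TS in auto)
  also have "integral\<^sup>L (lebesgue_on {T..T + S}) (\<lambda>t. L e (rlog ?c t)) = action A L S \<eta>"
  proof -
    have "integral\<^sup>L (lebesgue_on {T..T + S}) (\<lambda>t. L e (rlog ?c t))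
        = integral\<^sup>L (lebesgue_on {T..T + S}) (\<lambda>t. L e (rlog \<eta> (- T + 1 * t)))"
    proof (rule integral_cong_AE_interval[OF meas])
      have "rlog ?c t = rlog (\<lambda>t. \<eta> (- T + 1 * t)) t" if "T < t" "t < T + S" for t
        by (rule rlog_cong[of T "T + S"]) (use that concat_path_right[OF \<gamma> \<eta>] in auto)
      then have "AE t in lebesgue_on {T..T + S}. rlog ?c t = rlog (\<lambda>t. \<eta> (- T + 1 * t)) t"
        by (intro AE_lebesgue_on_interior) auto
      moreover have "AE t in lebesgue_on {T..T + S}. rlog (\<lambda>t. \<eta> (- T + 1 * t)) t = 1 *\<^sub>R rlog \<eta> (- T + 1 * t)"
        by (rule rlog_affine_AE) (use \<eta>' TS in auto)
      ultimately show "AE t in lebesgue_on {T..T + S}. L e (rlog ?c t) = L e (rlog \<eta> (- T + 1 * t))"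
        by eventually_elim simp
    qed (use TS in auto)
    also have "\<dots> = integral\<^sup>L (lebesgue_on {- T + 1 * T..- T + 1 * (T + S)}) (\<lambda>t. L e (rlog \<eta> t))"
      using integral_affine[of 1 "- T" T "T + S" "\<lambda>t. L e (rlog \<eta> t)"] by simp
    also have "\<dots> = action A L S \<eta>" using action_rlog[OF L \<eta>' less_imp_le[OF TS(2)]] by simp
    finally show ?thesis .
  qed
  finally show ?thesis .
qed

end

section \<open>Weak convergence of square integrable curves\<close>

lemma topspace_L2_weak: "topspace L2_weak_topology = (Lp 2 0 1 :: (real \<Rightarrow> 'e::real_normed_vector) set)"
proof -
  have "(\<lambda>f. 0) \<in> (L2_dual :: ((real \<Rightarrow> 'e) \<Rightarrow> real) set)"
    by (auto simp: L2_dual_def intro: exI[of _ 0])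
  then have "{f \<in> Lp 2 0 1. (0::real) \<in> UNIV} \<in> {{f \<in> Lp 2 0 1. F f \<in> V} | (F :: (real \<Rightarrow> 'e) \<Rightarrow> real) V. F \<in> L2_dual \<and> open V}"
    by (intro CollectI exI[of _ "\<lambda>f. 0"] exI[of _ UNIV]) auto
  then show ?thesis unfolding L2_weak_topology_def topology_generated_by_topspace by auto
qed

text \<open>
  By induction over the generation of the topology, a sequence on which every functional converges is
  eventually in every open neighbourhood of its limit.
\<close>

lemma weak_limit_in_closed:
  assumes S: "closedin L2_weak_topology S" and \<xi>: "\<And>n::nat. \<xi> n \<in> S" and u: "u \<in> Lp 2 0 1"
    and lim: "\<And>F. F \<in> L2_dual \<Longrightarrow> (\<lambda>n. F (\<xi> n)) \<longlonglongrightarrow> F u"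
  shows "u \<in> S"
proof (rule ccontr)
  assume "u \<notin> S"
  have sub: "S \<subseteq> Lp 2 0 1" using closedin_subset[OF S] by (simp add: topspace_L2_weak)
  let ?B = "{{f \<in> Lp 2 0 1. F f \<in> V} | F V. F \<in> L2_dual \<and> open V}"
  have ev: "u \<in> O' \<Longrightarrow> \<forall>\<^sub>F n in sequentially. \<xi> n \<in> O'" if "generate_topology_on ?B O'" for O'
    using that
  proof (induction O' rule: generate_topology_on.induct)
    case (Int a b)
    then show ?case by (auto intro: eventually_conj)
  next
    case (UN K)
    then obtain k where k: "k \<in> K" "u \<in> k" by blast
    have "\<forall>\<^sub>F n in sequentially. \<xi> n \<in> k" by (rule UN.IH[OF k])
    then show ?case by eventually_elim (use k in blast)
  next
    case (Basis s)
    then obtain F V where F: "s = {f \<in> Lp 2 0 1. F f \<in> V}" "F \<in> L2_dual" "open V" by blast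
    have "\<forall>\<^sub>F n in sequentially. F (\<xi> n) \<in> V"
      by (rule topological_tendstoD[OF lim[OF F(2)] F(3)]) (use Basis F in auto)
    then show ?case by eventually_elim (use F \<xi> sub in auto)
  qed simp
  have "openin L2_weak_topology (topspace L2_weak_topology - S)" using S by (simp add: closedin_def)
  then have "generate_topology_on ?B (topspace L2_weak_topology - S)"
    unfolding L2_weak_topology_def openin_topology_generated_by_iff .
  moreover have "u \<in> topspace L2_weak_topology - S" using u \<open>u \<notin> S\<close> by (simp add: topspace_L2_weak)
  ultimately have "\<forall>\<^sub>F n in sequentially. \<xi> n \<in> topspace L2_weak_topology - S" by (rule ev)
  then show False using \<xi> by (auto simp: eventually_sequentially)
qed

lemma L2_dual_zero: "F \<in> L2_dual \<Longrightarrow> F (\<lambda>t. 0) = 0"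
proof -
  assume "F \<in> L2_dual"
  then have "\<forall>f\<in>Lp 2 0 1. \<forall>r. F (\<lambda>t. r *\<^sub>R f t) = r * F f" unfolding L2_dual_def by blast
  then have "\<forall>r. F (\<lambda>t. r *\<^sub>R 0) = r * F (\<lambda>t. 0)" by (rule bspec) simp
  from spec[OF this, of 0] show ?thesis by simp
qed

lemma L2_dual_cong_AE:
  assumes F: "F \<in> L2_dual" and f: "f \<in> Lp 2 0 1" and ae: "AE t in lebesgue_on {0..1}. f t = g t"
  shows "F f = F g"
proof -
  have g: "g \<in> Lp 2 0 1" by (rule Lp_cong_AE[OF f ae])
  have d: "(\<lambda>t. f t - g t) \<in> Lp 2 0 1" by (rule L2_diff[OF f g])
  obtain K where K: "\<And>f. f \<in> Lp 2 0 1 \<Longrightarrow> \<bar>F f\<bar> \<le> K * L2_norm f"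
    and add: "\<And>f g. f \<in> Lp 2 0 1 \<Longrightarrow> g \<in> Lp 2 0 1 \<Longrightarrow> F (\<lambda>t. f t + g t) = F f + F g"
    using F unfolding L2_dual_def by blast
  have "AE t in lebesgue_on {0..1}. f t - g t = 0" using ae by eventually_elim simp
  then have "L2_norm (\<lambda>t. f t - g t) = L2_norm (\<lambda>t. 0 :: 'a)" by (rule L2_norm_cong_AE[OF d])
  then have "F (\<lambda>t. f t - g t) = 0" using K[OF d] by (simp add: L2_norm_def)
  then show ?thesis using add[OF d g] by simp
qed

lemma L2_dual_bounded_linear:
  fixes F :: "(real \<Rightarrow> 'e::real_inner) \<Rightarrow> real"
  assumes F: "F \<in> L2_dual"
  shows "bounded_linear (\<lambda>x. F (rep_L2 x))"
proof -
  obtain K where K: "\<And>f. f \<in> Lp 2 0 1 \<Longrightarrow> \<bar>F f\<bar> \<le> K * L2_norm f"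
    and add: "\<And>f g. f \<in> Lp 2 0 1 \<Longrightarrow> g \<in> Lp 2 0 1 \<Longrightarrow> F (\<lambda>t. f t + g t) = F f + F g"
    and scale: "\<And>f r. f \<in> Lp 2 0 1 \<Longrightarrow> F (\<lambda>t. r *\<^sub>R f t) = r * F f"
    using F unfolding L2_dual_def by blast
  show ?thesis
  proof (rule bounded_linear_intro[where K=K])
    fix x y :: "'e L2" and r :: real
    note rx = rep_L2_in_Lp[of x] and ry = rep_L2_in_Lp[of y]
    have "abs_L2 (\<lambda>t. rep_L2 x t + rep_L2 y t) = x + y"
      using plus_L2.abs_eq[OF L2_eq_rep[of x] L2_eq_rep[of y]] by simp
    then have "AE t in lebesgue_on {0..1}. rep_L2 (x + y) t = rep_L2 x t + rep_L2 y t"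
      using rep_abs_L2[OF L2_add[OF rx ry]] by simp
    then show "F (rep_L2 (x + y)) = F (rep_L2 x) + F (rep_L2 y)"
      using L2_dual_cong_AE[OF F rep_L2_in_Lp] add[OF rx ry] by metis
    have "abs_L2 (\<lambda>t. r *\<^sub>R rep_L2 x t) = r *\<^sub>R x"
      using abs_L2_scaleR[OF rx, of r] by simp
    then have "AE t in lebesgue_on {0..1}. rep_L2 (r *\<^sub>R x) t = r *\<^sub>R rep_L2 x t"
      using rep_abs_L2[OF Lp_scaleR[OF rx, of r]] by simp
    then show "F (rep_L2 (r *\<^sub>R x)) = r *\<^sub>R F (rep_L2 x)"
      using L2_dual_cong_AE[OF F rep_L2_in_Lp] scale[OF rx] by (metis real_scaleR_def)
    show "norm (F (rep_L2 x)) \<le> norm x * K"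
      using K[OF rx] norm_abs_L2[OF rx] by (simp add: mult.commute)
  qed
qed

lemma L2_weak_Banach_Saks:
  fixes \<xi> :: "nat \<Rightarrow> real \<Rightarrow> 'e::{real_inner, complete_space}"
  assumes \<xi>: "\<And>n. \<xi> n \<in> Lp 2 0 1" and B: "\<And>n. L2_norm (\<xi> n) \<le> B"
  obtains r u where "strict_mono (r :: nat \<Rightarrow> nat)" "u \<in> Lp 2 0 1"
    "\<And>F. F \<in> L2_dual \<Longrightarrow> (\<lambda>n. F (\<xi> (r n))) \<longlonglongrightarrow> F u"
    "(\<lambda>n. L2_norm (\<lambda>t. (1 / real (Suc n)) *\<^sub>R (\<Sum>i\<le>n. \<xi> (r i) t) - u t)) \<longlonglongrightarrow> 0"
proof -
  define x where "x n = abs_L2 (\<xi> n)" for n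
  have "norm (x n) \<le> B" for n using B[of n] by (simp add: x_def norm_abs_L2[OF \<xi>])
  then obtain r y where r: "strict_mono (r :: nat \<Rightarrow> nat)"
    and weak: "\<And>F :: 'e L2 \<Rightarrow> real. bounded_linear F \<Longrightarrow> (\<lambda>n. F (x (r n))) \<longlonglongrightarrow> F y"
    and mean: "(\<lambda>n. (1 / real (Suc n)) *\<^sub>R (\<Sum>i\<le>n. x (r i))) \<longlonglongrightarrow> y"
    using bounded_sequence_weak_Banach_Saks[of x B] by blast
  show ?thesis
  proof (rule that[OF r rep_L2_in_Lp[of y]])
    fix F :: "(real \<Rightarrow> 'e) \<Rightarrow> real" assume F: "F \<in> L2_dual"
    have "F (rep_L2 (x n)) = F (\<xi> n)" for n
      unfolding x_def by (rule L2_dual_cong_AE[OF F rep_L2_in_Lp rep_abs_L2[OF \<xi>]])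
    then show "(\<lambda>n. F (\<xi> (r n))) \<longlonglongrightarrow> F (rep_L2 y)"
      using weak[OF L2_dual_bounded_linear[OF F]] by simp
  next
    have "norm ((1 / real (Suc n)) *\<^sub>R (\<Sum>i\<le>n. x (r i)) - y) =
        L2_norm (\<lambda>t. (1 / real (Suc n)) *\<^sub>R (\<Sum>i\<le>n. \<xi> (r i) t) - rep_L2 y t)" for n
    proof -
      have s: "(\<lambda>t. \<Sum>i\<le>n. \<xi> (r i) t) \<in> Lp 2 0 1" by (intro L2_sum \<xi>)
      have "(1 / real (Suc n)) *\<^sub>R (\<Sum>i\<le>n. x (r i)) = abs_L2 (\<lambda>t. (1 / real (Suc n)) *\<^sub>R (\<Sum>i\<le>n. \<xi> (r i) t))"
        unfolding x_def abs_L2_sum[of "{..n}" "\<lambda>i. \<xi> (r i)", OF \<xi>] by (rule abs_L2_scaleR[OF s])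
      then have "(1 / real (Suc n)) *\<^sub>R (\<Sum>i\<le>n. x (r i)) - y =
          abs_L2 (\<lambda>t. (1 / real (Suc n)) *\<^sub>R (\<Sum>i\<le>n. \<xi> (r i) t) - rep_L2 y t)"
        using abs_L2_diff[OF Lp_scaleR[OF s, of "1 / real (Suc n)"] rep_L2_in_Lp[of y]] by (simp only: abs_rep_L2)
      then show ?thesis
        using norm_abs_L2[OF L2_diff[OF Lp_scaleR[OF s, of "1 / real (Suc n)"] rep_L2_in_Lp[of y]]] by (simp only:)
    qed
    moreover have "(\<lambda>n. norm ((1 / real (Suc n)) *\<^sub>R (\<Sum>i\<le>n. x (r i)) - y)) \<longlonglongrightarrow> 0"
      using tendsto_norm_zero[OF LIM_zero[OF mean]] .
    ultimately show "(\<lambda>n. L2_norm (\<lambda>t. (1 / real (Suc n)) *\<^sub>R (\<Sum>i\<le>n. \<xi> (r i) t) - rep_L2 y t)) \<longlonglongrightarrow> 0"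
      by (simp only:)
  qed
qed

text \<open>
  Otherwise a sequence in \<open>S\<close> converges to zero strongly, hence weakly.
\<close>

lemma L2_norm_bounded_below:
  assumes S: "closedin L2_weak_topology S" and zero: "(\<lambda>t. 0) \<notin> S"
  shows "\<exists>\<delta>>0. \<forall>\<xi>\<in>S. \<delta> \<le> L2_norm \<xi>"
proof (rule ccontr)
  assume neg: "\<not> ?thesis"
  have "\<exists>\<xi>\<in>S. L2_norm \<xi> < inverse (real (Suc n))" for n
    using neg by (metis inverse_positive_iff_positive not_less of_nat_0_less_iff zero_less_Suc)
  then obtain \<xi> where \<xi>: "\<And>n. \<xi> n \<in> S" "\<And>n. L2_norm (\<xi> n) < inverse (real (Suc n))" by metis
  have sub: "S \<subseteq> Lp 2 0 1" using closedin_subset[OF S] by (simp add: topspace_L2_weak)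
  have "(\<lambda>t. 0) \<in> S"
  proof (rule weak_limit_in_closed[OF S \<xi>(1)])
    fix F :: "(real \<Rightarrow> 'a) \<Rightarrow> real" assume F: "F \<in> L2_dual"
    then obtain K where K: "\<And>f. f \<in> Lp 2 0 1 \<Longrightarrow> \<bar>F f\<bar> \<le> K * L2_norm f"
      unfolding L2_dual_def by blast
    have "norm (F (\<xi> n)) \<le> \<bar>K\<bar> * inverse (real (Suc n))" for n
    proof -
      have "\<bar>F (\<xi> n)\<bar> \<le> K * L2_norm (\<xi> n)" using \<xi>(1) sub by (intro K) auto
      also have "\<dots> \<le> \<bar>K\<bar> * L2_norm (\<xi> n)" by (intro mult_right_mono) (auto simp: L2_norm_def)
      also have "\<dots> \<le> \<bar>K\<bar> * inverse (real (Suc n))" using \<xi>(2)[of n] by (intro mult_left_mono) auto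
      finally show ?thesis by simp
    qed
    then have "\<forall>\<^sub>F n in sequentially. norm (F (\<xi> n)) \<le> \<bar>K\<bar> * inverse (real (Suc n))"
      by (intro always_eventually allI)
    then have "(\<lambda>n. F (\<xi> n)) \<longlonglongrightarrow> 0"
      by (rule Lim_null_comparison[OF _ tendsto_mult_right_zero[OF LIMSEQ_inverse_real_of_nat]])
    then show "(\<lambda>n. F (\<xi> n)) \<longlonglongrightarrow> F (\<lambda>t. 0)" by (simp add: L2_dual_zero[OF F])
  qed simp
  with zero show False by contradiction
qed

section \<open>Minimization over the duration and the logarithmic derivative\<close>

text \<open>
  Joint convexity of the perspective \<open>(T, v) \<mapsto> T f(v / T)\<close>: Jensen's inequality at the points
  \<open>v i / T i\<close> with weights proportional to \<open>T i\<close>.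
\<close>

lemma convex_perspective_sum:
  fixes f :: "'e::real_normed_vector \<Rightarrow> real"
  assumes f: "convex_on UNIV f" and I: "finite I" "I \<noteq> {}" and T: "\<And>i. i \<in> I \<Longrightarrow> 0 < T i"
  shows "(\<Sum>i\<in>I. T i) * f ((\<Sum>i\<in>I. v i) /\<^sub>R (\<Sum>i\<in>I. T i)) \<le> (\<Sum>i\<in>I. T i * f (v i /\<^sub>R T i))"
proof -
  define P where "P = (\<Sum>i\<in>I. T i)"
  have P: "0 < P" unfolding P_def using I T by (intro sum_pos) auto
  have "f (\<Sum>i\<in>I. (T i / P) *\<^sub>R (v i /\<^sub>R T i)) \<le> (\<Sum>i\<in>I. (T i / P) * f (v i /\<^sub>R T i))"
  proof (rule convex_on_sum[OF I f])
    show "(\<Sum>i\<in>I. T i / P) = 1" using P by (simp add: P_def sum_divide_distrib[symmetric])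
    show "0 \<le> T i / P" if "i \<in> I" for i using T[OF that] P by simp
  qed auto
  moreover have "(\<Sum>i\<in>I. (T i / P) *\<^sub>R (v i /\<^sub>R T i)) = (\<Sum>i\<in>I. v i) /\<^sub>R P"
  proof -
    have "(T i / P) *\<^sub>R (v i /\<^sub>R T i) = v i /\<^sub>R P" if "i \<in> I" for i
      using T[OF that] by (simp add: divide_inverse)
    then show ?thesis by (simp only: scaleR_sum_right cong: sum.cong)
  qed
  ultimately have "P * f ((\<Sum>i\<in>I. v i) /\<^sub>R P) \<le> P * (\<Sum>i\<in>I. (T i / P) * f (v i /\<^sub>R T i))"
    using P by (intro mult_left_mono) auto
  also have "\<dots> = (\<Sum>i\<in>I. T i * f (v i /\<^sub>R T i))"
    using P by (simp add: sum_distrib_left)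
  finally show ?thesis by (simp add: P_def)
qed

text \<open>
  The action of a path of duration \<open>T\<close>, if \<open>\<xi>\<close> is its logarithmic derivative rescaled to the unit
  interval and \<open>f\<close> is the Lagrangian at the neutral element.
\<close>

definition scaled_action :: "('e::real_normed_vector \<Rightarrow> real) \<Rightarrow> real \<Rightarrow> (real \<Rightarrow> 'e) \<Rightarrow> real"
  where "scaled_action f T \<xi> = T * integral\<^sup>L (lebesgue_on {0..1}) (\<lambda>t. f (\<xi> t /\<^sub>R T))"

text \<open>
  The direct method.  Along a minimizing sequence the durations stay in a compact subset of the open
  half-line and the curves stay in a ball.  A weak limit \<open>u\<close> of the curves is in \<open>S\<close>, and the Cesaro
  means of a subsequence converge to \<open>u\<close> strongly, so almost everywhere for a further subsequence.  As
  duration and curve are averaged simultaneously, convexity of the perspective shows that the means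
  are again minimizing, and Fatou's lemma passes to the limit.
\<close>

lemma scaled_action_minimizer:
  fixes f :: "'e::{real_inner, complete_space} \<Rightarrow> real"
  assumes S: "closedin L2_weak_topology S" "S \<noteq> {}" and zero: "(\<lambda>t. 0) \<notin> S"
    and f: "convex_on UNIV f" "continuous_on UNIV f"
    and coercive: "0 < c" "0 \<le> B" "\<And>w. c * (norm w)\<^sup>2 - B \<le> f w"
    and growth: "\<And>w. \<bar>f w\<bar> \<le> C * (1 + (norm w)\<^sup>2)"
    and proper: "0 < k" "\<And>T \<xi>. 0 < T \<Longrightarrow> \<xi> \<in> S \<Longrightarrow> k * T - D \<le> scaled_action f T \<xi>"
  shows "\<exists>T>0. \<exists>\<xi>\<in>S. \<forall>T'>0. \<forall>\<xi>'\<in>S. scaled_action f T \<xi> \<le> scaled_action f T' \<xi>'"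
proof -
  let ?M = "lebesgue_on {0..1::real}"
  let ?F = "scaled_action f"
  have sub: "S \<subseteq> Lp 2 0 1" using closedin_subset[OF S(1)] by (simp add: topspace_L2_weak)
  have M1: "integral\<^sup>L ?M (\<lambda>t. d) = d" for d :: real by (simp add: measure_restrict_space)
  have int: "integrable ?M (\<lambda>t. f (\<xi> t /\<^sub>R T))" if "\<xi> \<in> Lp 2 0 1" for \<xi> T
    by (rule integrable_quadratic_growth[OF f(2) growth]) (rule Lp_scaleR[OF that])
  have energy: "c / T * (L2_norm \<xi>)\<^sup>2 - T * B \<le> ?F T \<xi>" if T: "0 < T" and \<xi>: "\<xi> \<in> Lp 2 0 1" for T \<xi>
  proof -
    have i2: "integrable ?M (\<lambda>t. (norm (\<xi> t))\<^sup>2)" using LpD(2)[OF \<xi>] .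
    have "integral\<^sup>L ?M (\<lambda>t. c / T\<^sup>2 * (norm (\<xi> t))\<^sup>2 - B) \<le> integral\<^sup>L ?M (\<lambda>t. f (\<xi> t /\<^sub>R T))"
    proof (rule integral_mono[OF _ int[OF \<xi>]])
      show "integrable ?M (\<lambda>t. c / T\<^sup>2 * (norm (\<xi> t))\<^sup>2 - B)" using i2 by simp
      show "c / T\<^sup>2 * (norm (\<xi> t))\<^sup>2 - B \<le> f (\<xi> t /\<^sub>R T)" for t
        using coercive(3)[of "\<xi> t /\<^sub>R T"] T by (simp add: power_mult_distrib power_inverse divide_inverse mult.assoc)
    qed
    moreover have "integral\<^sup>L ?M (\<lambda>t. c / T\<^sup>2 * (norm (\<xi> t))\<^sup>2 - B) = c / T\<^sup>2 * (L2_norm \<xi>)\<^sup>2 - B"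
      using i2 by (simp add: L2_norm_power2 measure_restrict_space)
    ultimately have "T * (c / T\<^sup>2 * (L2_norm \<xi>)\<^sup>2 - B) \<le> ?F T \<xi>"
      using T unfolding scaled_action_def by (intro mult_left_mono) auto
    then show ?thesis using T by (simp add: right_diff_distrib power2_eq_square)
  qed
  define V where "V = {?F T \<xi> | T \<xi>. 0 < T \<and> \<xi> \<in> S}"
  define m where "m = Inf V"
  obtain \<xi>0 where "\<xi>0 \<in> S" using S(2) by blast
  then have "?F 1 \<xi>0 \<in> V" unfolding V_def using zero_less_one by blast
  then have Vne: "V \<noteq> {}" by blast
  have Vbdd: "bdd_below V"
  proof (rule bdd_belowI[of _ "- D"])
    fix y assume "y \<in> V"
    then obtain T \<xi> where y: "y = ?F T \<xi>" "0 < T" "\<xi> \<in> S" by (auto simp: V_def)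
    have "0 \<le> k * T" using proper(1) y(2) by simp
    then show "- D \<le> y" using proper(2)[OF y(2,3)] y(1) by linarith
  qed
  have m_le: "m \<le> ?F T \<xi>" if "0 < T" "\<xi> \<in> S" for T \<xi>
    unfolding m_def by (rule cInf_lower[OF _ Vbdd]) (use that in \<open>auto simp: V_def\<close>)
  \<comment> \<open>the errors are summable, so that the means of the values also tend to \<open>m\<close>\<close>
  have "\<exists>T \<xi>. 0 < T \<and> \<xi> \<in> S \<and> ?F T \<xi> \<le> m + (1/2) ^ n" for n
  proof -
    have "\<exists>y\<in>V. y < m + (1/2) ^ n"
      using cInf_less_iff[OF Vne Vbdd, of "m + (1/2) ^ n"] by (simp add: m_def)
    then show ?thesis by (force simp: V_def)
  qed
  then obtain Ts \<Xi> where Ts: "\<And>n::nat. 0 < Ts n" "\<And>n. \<Xi> n \<in> S" "\<And>n. ?F (Ts n) (\<Xi> n) \<le> m + (1/2) ^ n"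
    by metis
  have \<Xi>: "\<Xi> n \<in> Lp 2 0 1" for n using Ts(2) sub by auto
  have F_le: "?F (Ts n) (\<Xi> n) \<le> m + 1" for n
    using Ts(3)[of n] power_le_one[of "1/2::real" n] by simp
  \<comment> \<open>the durations are bounded because of properness, and then so are the energies\<close>
  define Tmax where "Tmax = (m + 1 + D) / k"
  have Tmax: "Ts n \<le> Tmax" for n
    using F_le[of n] proper(2)[OF Ts(1,2)[of n]] proper(1) by (simp add: Tmax_def pos_le_divide_eq mult.commute)
  define K where "K = (m + 1 + Tmax * B) / c"
  have en: "(L2_norm (\<Xi> n))\<^sup>2 \<le> Ts n * K" for n
  proof -
    have "c / Ts n * (L2_norm (\<Xi> n))\<^sup>2 \<le> m + 1 + Tmax * B"
      using energy[OF Ts(1)[of n] \<Xi>[of n]] F_le[of n] mult_right_mono[OF Tmax[of n] coercive(2)] by linarith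
    then show ?thesis using Ts(1)[of n] coercive(1) by (simp add: K_def field_simps)
  qed
  \<comment> \<open>short durations would make the energy small, hence the curve close to \<open>0 \<notin> S\<close>\<close>
  obtain \<delta> where \<delta>: "\<delta> > 0" "\<And>\<xi>. \<xi> \<in> S \<Longrightarrow> \<delta> \<le> L2_norm \<xi>"
    using L2_norm_bounded_below[OF S(1) zero] by blast
  have \<delta>2: "\<delta>\<^sup>2 \<le> Ts n * K" for n
    using power_mono[OF \<delta>(2)[OF Ts(2)[of n]], of 2] \<delta>(1) en[of n] by simp
  have K: "0 < K"
  proof -
    have "0 < Ts 0 * K" using \<delta>2[of 0] \<delta>(1) by (smt (verit) zero_less_power)
    then show ?thesis using Ts(1)[of 0] by (simp add: zero_less_mult_iff)
  qed
  define Tmin where "Tmin = \<delta>\<^sup>2 / K"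
  have Tmin: "0 < Tmin" "Tmin \<le> Ts n" for n
    using \<delta>(1) K \<delta>2[of n] by (auto simp: Tmin_def field_simps)
  have bnd: "L2_norm (\<Xi> n) \<le> sqrt (Tmax * K)" for n
  proof (rule real_le_rsqrt)
    show "(L2_norm (\<Xi> n))\<^sup>2 \<le> Tmax * K"
      using en[of n] mult_right_mono[OF Tmax[of n], of K] K by linarith
  qed
  obtain r u where r: "strict_mono (r :: nat \<Rightarrow> nat)" and u: "u \<in> Lp 2 0 1"
    and weak: "\<And>F. F \<in> L2_dual \<Longrightarrow> (\<lambda>n. F (\<Xi> (r n))) \<longlonglongrightarrow> F u"
    and mean: "(\<lambda>n. L2_norm (\<lambda>t. (1 / real (Suc n)) *\<^sub>R (\<Sum>i\<le>n. \<Xi> (r i) t) - u t)) \<longlonglongrightarrow> 0"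
    using L2_weak_Banach_Saks[of \<Xi> "sqrt (Tmax * K)", OF \<Xi> bnd] by blast
  have uS: "u \<in> S" by (rule weak_limit_in_closed[where \<xi>="\<lambda>n. \<Xi> (r n)" and u=u, OF S(1) Ts(2) u weak])
  define \<tau> where "\<tau> n = (1 / real (Suc n)) * (\<Sum>i\<le>n. Ts (r i))" for n
  define a where "a n t = (1 / real (Suc n)) *\<^sub>R (\<Sum>i\<le>n. \<Xi> (r i) t)" for n t
  have \<tau>: "Tmin \<le> \<tau> n" "\<tau> n \<le> Tmax" for n
  proof -
    have "(\<Sum>i\<le>n. Tmin) \<le> (\<Sum>i\<le>n. Ts (r i))" "(\<Sum>i\<le>n. Ts (r i)) \<le> (\<Sum>i\<le>n. Tmax)"
      by (intro sum_mono Tmin Tmax)+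
    then show "Tmin \<le> \<tau> n" "\<tau> n \<le> Tmax" by (simp_all add: \<tau>_def field_simps)
  qed
  have a: "a n \<in> Lp 2 0 1" for n unfolding a_def by (intro Lp_scaleR L2_sum \<Xi>)
  have F_mean: "?F (\<tau> n) (a n) \<le> m + 2 / real (Suc n)" for n
  proof -
    have pt: "\<tau> n * f (a n t /\<^sub>R \<tau> n) \<le> (1 / real (Suc n)) * (\<Sum>i\<le>n. Ts (r i) * f (\<Xi> (r i) t /\<^sub>R Ts (r i)))" for t
    proof -
      have "a n t /\<^sub>R \<tau> n = (\<Sum>i\<le>n. \<Xi> (r i) t) /\<^sub>R (\<Sum>i\<le>n. Ts (r i))"
        by (simp add: a_def \<tau>_def inverse_eq_divide)
      moreover have "(\<Sum>i\<le>n. Ts (r i)) * f ((\<Sum>i\<le>n. \<Xi> (r i) t) /\<^sub>R (\<Sum>i\<le>n. Ts (r i)))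
          \<le> (\<Sum>i\<le>n. Ts (r i) * f (\<Xi> (r i) t /\<^sub>R Ts (r i)))"
        by (rule convex_perspective_sum[OF f(1)]) (use Ts(1) in auto)
      ultimately show ?thesis by (simp add: \<tau>_def divide_right_mono)
    qed
    have "?F (\<tau> n) (a n) = integral\<^sup>L ?M (\<lambda>t. \<tau> n * f (a n t /\<^sub>R \<tau> n))"
      by (simp add: scaled_action_def)
    also have "\<dots> \<le> integral\<^sup>L ?M (\<lambda>t. (1 / real (Suc n)) * (\<Sum>i\<le>n. Ts (r i) * f (\<Xi> (r i) t /\<^sub>R Ts (r i))))"
      by (rule integral_mono[OF _ _ pt])
        (intro integrable_mult_right Bochner_Integration.integrable_sum int a \<Xi>)+
    also have "\<dots> = (1 / real (Suc n)) * (\<Sum>i\<le>n. ?F (Ts (r i)) (\<Xi> (r i)))"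
      using int[OF \<Xi>] by (simp add: scaled_action_def Bochner_Integration.integral_sum)
    also have "\<dots> \<le> (1 / real (Suc n)) * (\<Sum>i\<le>n. m + (1/2) ^ i)"
    proof (intro mult_left_mono sum_mono)
      fix i
      have "(1/2 :: real) ^ r i \<le> (1/2) ^ i" using seq_suble[OF r, of i] by (intro power_decreasing) auto
      then show "?F (Ts (r i)) (\<Xi> (r i)) \<le> m + (1/2) ^ i" using Ts(3)[of "r i"] by linarith
    qed simp
    also have "\<dots> \<le> m + 2 / real (Suc n)"
    proof -
      have "(\<Sum>i\<le>n. (1/2 :: real) ^ i) = 2 - (1/2) ^ n" by (induction n) auto
      then have "(\<Sum>i\<le>n. (1/2 :: real) ^ i) \<le> 2" by simp
      then have "(\<Sum>i\<le>n. m + (1/2) ^ i) \<le> real (Suc n) * m + 2" by (simp add: sum.distrib)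
      then have "(1 / real (Suc n)) * (\<Sum>i\<le>n. m + (1/2) ^ i) \<le> (1 / real (Suc n)) * (real (Suc n) * m + 2)"
        by (rule mult_left_mono) simp
      also have "\<dots> = m + 2 / real (Suc n)" by (simp add: field_simps)
      finally show ?thesis .
    qed
    finally show ?thesis .
  qed
  have "bounded (range \<tau>)"
    by (rule bounded_subset[OF bounded_closed_interval[of Tmin Tmax]]) (use \<tau> in auto)
  then obtain T0 s where s: "strict_mono (s :: nat \<Rightarrow> nat)" "(\<tau> \<circ> s) \<longlonglongrightarrow> T0"
    using bounded_imp_convergent_subsequence by blast
  have T0: "0 < T0"
  proof -
    have "Tmin \<le> T0" by (rule LIMSEQ_le_const[OF s(2)]) (use \<tau>(1) in auto)
    then show ?thesis using Tmin(1) by linarith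
  qed
  have "\<exists>s'::nat \<Rightarrow> nat. strict_mono s' \<and> (AE t in ?M. (\<lambda>n. (norm (a (s (s' n)) t - u t))\<^sup>2) \<longlonglongrightarrow> 0)"
  proof (rule tendsto_L1_AE_subseq)
    show "integrable ?M (\<lambda>t. (norm (a (s n) t - u t))\<^sup>2)" for n
      using LpD(2)[OF L2_diff[OF a u]] .
    have "(\<lambda>n. (L2_norm (\<lambda>t. a n t - u t))\<^sup>2) \<longlonglongrightarrow> 0\<^sup>2"
      using mean unfolding a_def[symmetric] by (rule tendsto_power)
    then have "(\<lambda>n. (L2_norm (\<lambda>t. a (s n) t - u t))\<^sup>2) \<longlonglongrightarrow> 0"
      using LIMSEQ_subseq_LIMSEQ[OF _ s(1)] by (force simp: o_def)
    then show "(\<lambda>n. \<integral>t. norm ((norm (a (s n) t - u t))\<^sup>2) \<partial>?M) \<longlonglongrightarrow> 0"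
      by (simp add: L2_norm_power2)
  qed
  then obtain s' where s': "strict_mono (s' :: nat \<Rightarrow> nat)"
    "AE t in ?M. (\<lambda>n. (norm (a (s (s' n)) t - u t))\<^sup>2) \<longlonglongrightarrow> 0" by blast
  define \<sigma> where "\<sigma> n = s (s' n)" for n
  have \<sigma>: "strict_mono \<sigma>" unfolding \<sigma>_def using strict_mono_o[OF s(1) s'(1)] by (simp add: o_def)
  have \<tau>lim: "(\<lambda>n. \<tau> (\<sigma> n)) \<longlonglongrightarrow> T0"
    using LIMSEQ_subseq_LIMSEQ[OF s(2) s'(1)] by (simp add: o_def \<sigma>_def)
  have alim: "AE t in ?M. (\<lambda>n. a (\<sigma> n) t) \<longlonglongrightarrow> u t"
    using s'(2)
  proof eventually_elim
    case (elim t)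
    then have "(\<lambda>n. norm (a (\<sigma> n) t - u t)) \<longlonglongrightarrow> 0" by (simp add: \<sigma>_def)
    then have "(\<lambda>n. a (\<sigma> n) t - u t) \<longlonglongrightarrow> 0" by (rule tendsto_norm_zero_cancel)
    then show ?case by (rule LIM_zero_cancel)
  qed
  have "?F T0 u \<le> m + \<epsilon>" if \<epsilon>: "0 < \<epsilon>" for \<epsilon>
  proof -
    \<comment> \<open>the constant makes the integrands nonnegative, as \<open>f \<ge> - B\<close> and the durations are at most \<open>Tmax\<close>\<close>
    define h where "h n t = \<tau> (\<sigma> n) * f (a (\<sigma> n) t /\<^sub>R \<tau> (\<sigma> n)) + Tmax * B" for n t
    have pos: "0 \<le> T * f w + Tmax * B" if "0 \<le> T" "T \<le> Tmax" for T w
    proof -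
      have "0 \<le> c * (norm w)\<^sup>2" using coercive(1) by simp
      then have "- B \<le> f w" using coercive(3)[of w] by linarith
      then have "T * (- B) \<le> T * f w" using that by (intro mult_left_mono)
      moreover have "T * B \<le> Tmax * B" using that coercive(2) by (intro mult_right_mono)
      ultimately show ?thesis by simp
    qed
    have T0max: "T0 \<le> Tmax" by (rule LIMSEQ_le_const2[OF \<tau>lim]) (use \<tau>(2) in auto)
    have "integrable ?M (\<lambda>t. T0 * f (u t /\<^sub>R T0) + Tmax * B) \<and>
        integral\<^sup>L ?M (\<lambda>t. T0 * f (u t /\<^sub>R T0) + Tmax * B) \<le> m + \<epsilon> + Tmax * B"
    proof (rule Fatou_integral[where h=h])
      show "integrable ?M (h n)" for n
        unfolding h_def using int[OF a] by simp
      show "0 \<le> h n t" for n t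
        unfolding h_def using \<tau>[of "\<sigma> n"] Tmin(1) by (intro pos) auto
      show "(\<lambda>t. T0 * f (u t /\<^sub>R T0) + Tmax * B) \<in> borel_measurable ?M"
        using borel_measurable_integrable[OF int[OF u, of T0]] by simp
      show "0 \<le> T0 * f (u t /\<^sub>R T0) + Tmax * B" for t using T0 T0max by (intro pos) auto
      show "AE t in ?M. (\<lambda>n. h n t) \<longlonglongrightarrow> T0 * f (u t /\<^sub>R T0) + Tmax * B"
        using alim
      proof eventually_elim
        case (elim t)
        have "(\<lambda>n. a (\<sigma> n) t /\<^sub>R \<tau> (\<sigma> n)) \<longlonglongrightarrow> u t /\<^sub>R T0"
          using T0 by (intro tendsto_intros elim \<tau>lim) simp
        moreover have "isCont f (u t /\<^sub>R T0)" using f(2) by (simp add: continuous_on_eq_continuous_at)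
        ultimately have "(\<lambda>n. f (a (\<sigma> n) t /\<^sub>R \<tau> (\<sigma> n))) \<longlonglongrightarrow> f (u t /\<^sub>R T0)"
          by (rule isCont_tendsto_compose[rotated])
        then show ?case unfolding h_def by (intro tendsto_intros \<tau>lim)
      qed
      have hF: "integral\<^sup>L ?M (h n) = ?F (\<tau> (\<sigma> n)) (a (\<sigma> n)) + Tmax * B" for n
        unfolding h_def scaled_action_def using int[OF a] by (simp add: measure_restrict_space)
      have "(\<lambda>n. 2 * inverse (real (Suc n))) \<longlonglongrightarrow> 2 * 0"
        by (intro tendsto_intros LIMSEQ_inverse_real_of_nat)
      then have "\<forall>\<^sub>F n in sequentially. 2 * inverse (real (Suc n)) < \<epsilon>" using \<epsilon> by (intro order_tendstoD) auto
      then show "\<forall>\<^sub>F n in sequentially. integral\<^sup>L ?M (h n) \<le> m + \<epsilon> + Tmax * B"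
      proof eventually_elim
        case (elim n)
        have "2 / real (Suc (\<sigma> n)) \<le> 2 / real (Suc n)"
          using seq_suble[OF \<sigma>, of n] by (intro divide_left_mono) auto
        then show ?case using F_mean[of "\<sigma> n"] elim unfolding hF divide_inverse by linarith
      qed
    qed
    then have "integral\<^sup>L ?M (\<lambda>t. T0 * f (u t /\<^sub>R T0) + Tmax * B) \<le> m + \<epsilon> + Tmax * B" by blast
    moreover have "integral\<^sup>L ?M (\<lambda>t. T0 * f (u t /\<^sub>R T0) + Tmax * B) = ?F T0 u + Tmax * B"
      unfolding scaled_action_def using int[OF u] by (simp add: measure_restrict_space)
    ultimately show ?thesis by simp
  qed
  then have "?F T0 u \<le> m" by (rule field_le_epsilon)
  then have "\<forall>T'>0. \<forall>\<xi>'\<in>S. ?F T0 u \<le> ?F T' \<xi>'" using m_le by (meson order.trans)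
  then show ?thesis using T0 uS by blast
qed

section \<open>Existence of minimizers\<close>

context half_lie_group_metric
begin

text \<open>
  In the preferred chart at \<open>e\<close> the fibre is the model space, whose norm is equivalent to that of the
  metric; so the Tonelli condition pinches the second derivative of \<open>L e\<close>.
\<close>

lemma tonelli_fibre:
  assumes "tonelli_lagrangian mul e A \<G> L"
  obtains c B C where "convex_on UNIV (L e)" "continuous_on UNIV (L e)" "0 < c" "0 \<le> B"
    "\<And>w. c * (norm w)\<^sup>2 - B \<le> L e w" "\<And>w. \<bar>L e w\<bar> \<le> C * (1 + (norm w)\<^sup>2)"
proof -
  obtain m M where m: "0 < m" "m \<le> M" "\<And>v w. m * \<G> e w w \<le> second_derivative (L e) v w"
      "\<And>v w. second_derivative (L e) v w \<le> M * \<G> e w w" and C2: "C2_lagrangian A L"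
    using assms unfolding tonelli_lagrangian_def by blast
  obtain c C where c: "0 < c" "0 < C" "\<And>v. c * (norm v)\<^sup>2 \<le> \<G> e v v" "\<And>v. \<G> e v v \<le> C * (norm v)\<^sup>2"
    by (rule metric_e_bounds) blast
  obtain U \<phi> where U: "chart_at A e = (U, \<phi>)" by fastforce
  then have U': "(U, \<phi>) \<in> A" "e \<in> U" using chart_at_mem[OF smooth_atlas, of e] by auto
  define \<Psi> where "\<Psi> = (\<lambda>(y, v). let x = inv_into U \<phi> y in L x (from_chart A (U, \<phi>) x v))"
  have \<Psi>: "Ck_on 2 (\<phi> ` U \<times> UNIV) \<Psi>" using C2 U'(1) unfolding C2_lagrangian_def \<Psi>_def by blast
  have fibre: "L e v = \<Psi> (\<phi> e, v)" for v
    using chartD(5)[OF smooth_atlas U'(1,2)] from_chart_preferred[OF smooth_atlas, of e v] by (simp add: \<Psi>_def U)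
  have "\<phi> e \<in> \<phi> ` U" using U'(2) by simp
  then obtain f1 f2 where f1: "\<And>u. (L e has_derivative f1 u) (at u)"
    and f2: "\<And>v w. ((\<lambda>u. f1 u w) has_derivative f2 v w) (at v)"
    and sd: "\<And>v w. second_derivative (L e) v w = f2 v w w"
    using C2_fibre_second_derivative[of "\<phi> ` U" \<Psi> "\<phi> e" "L e", OF \<Psi> chartD(2)[OF smooth_atlas U'(1)] _ fibre]
    by metis
  have low: "m * c * (norm w)\<^sup>2 \<le> f2 v w w" for v w
  proof -
    have "m * (c * (norm w)\<^sup>2) \<le> m * \<G> e w w" using m(1) c(3) by (intro mult_left_mono) auto
    then show ?thesis using m(3)[of w v] by (simp add: sd mult.assoc)
  qed
  have up: "f2 v w w \<le> M * C * (norm w)\<^sup>2" for v w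
  proof -
    have "M * \<G> e w w \<le> M * (C * (norm w)\<^sup>2)" using m(1,2) c(4) by (intro mult_left_mono) auto
    then show ?thesis using m(4)[of v w] by (simp add: sd mult.assoc)
  qed
  note P = pinched_second_derivative[OF f1 f2 mult_pos_pos[OF m(1) c(1)] low up]
  obtain c' B where "0 < c'" "0 \<le> B" "\<And>w. c' * (norm w)\<^sup>2 - B \<le> L e w" using P(3) by blast
  moreover obtain C' where "\<And>w. \<bar>L e w\<bar> \<le> C' * (1 + (norm w)\<^sup>2)" using P(4) by blast
  ultimately show ?thesis using that P(1,2) by blast
qed

lemma evol_zero:
  assumes "L2_regular mul e A"
  shows "evol mul e A (\<lambda>t. 0) = e"
proof -
  have "rlog (\<lambda>_. e) = (\<lambda>t. 0)" by (simp add: fun_eq_iff rlog_const)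
  then show ?thesis using evol_rlog[OF assms W1p_curve_const[of 2 A 0 1 e]] by simp
qed

text \<open>
  The number \<open>\<kappa>0\<close> is strictly between the critical value and \<open>\<kappa>\<close>; the gap will make long paths
  expensive.
\<close>

lemma closed_curve_action_lower_bound:
  assumes "mane_critical_value A L < ereal \<kappa>"
  obtains \<kappa>0 where "\<kappa>0 < \<kappa>" "\<And>T \<gamma> x. (T, \<gamma>) \<in> paths A x x \<Longrightarrow> - \<kappa>0 * T \<le> action A L T \<gamma>"
proof -
  define I where "I = (INF (T, \<gamma>)\<in>{(T, \<gamma>). 0 < T \<and> H1_curve A T \<gamma> \<and> \<gamma> 0 = \<gamma> T}. ereal (1 / T * action A L T \<gamma>))"
  obtain \<kappa>0 where \<kappa>0: "- I < ereal \<kappa>0" "\<kappa>0 < \<kappa>"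
    using ereal_dense2[OF assms] unfolding mane_critical_value_def I_def by auto
  show ?thesis
  proof (rule that[OF \<kappa>0(2)])
    fix T \<gamma> x assume "(T, \<gamma>) \<in> paths A x x"
    then have T: "0 < T" and mem: "(T, \<gamma>) \<in> {(T, \<gamma>). 0 < T \<and> H1_curve A T \<gamma> \<and> \<gamma> 0 = \<gamma> T}"
      by (auto simp: paths_def)
    have "I \<le> (case (T, \<gamma>) of (T, \<gamma>) \<Rightarrow> ereal (1 / T * action A L T \<gamma>))"
      unfolding I_def by (rule INF_lower[OF mem])
    then have le: "I \<le> ereal (1 / T * action A L T \<gamma>)" by simp
    have "ereal (- \<kappa>0) < I" using \<kappa>0(1) by (simp add: ereal_uminus_less_reorder flip: uminus_ereal.simps)
    then have "ereal (- \<kappa>0) < ereal (1 / T * action A L T \<gamma>)" using le by (rule less_le_trans)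
    then show "- \<kappa>0 * T \<le> action A L T \<gamma>" using T by (simp add: field_simps)
  qed
qed

theorem global_minimizer_exists:
  assumes L: "tonelli_lagrangian mul e A \<G> L"
    and reg: "L2_regular mul e A"
    and closed: "closedin L2_weak_topology {\<xi> \<in> Lp 2 0 1. evol mul e A \<xi> = q \<odot> iv p}"
    and conn: "connected_component UNIV p q" and pq: "p \<noteq> q"
    and \<kappa>: "mane_critical_value A L < ereal \<kappa>"
  shows "\<exists>(T, \<gamma>)\<in>paths A p q. ereal (action A (\<lambda>x v. L x v + \<kappa>) T \<gamma>) =
      (INF (S, \<eta>)\<in>paths A p q. ereal (action A (\<lambda>x v. L x v + \<kappa>) S \<eta>))"
proof -
  define S where "S = {\<xi> \<in> Lp 2 0 1. evol mul e A \<xi> = q \<odot> iv p}"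
  define L' where "L' = (\<lambda>x v. L x v + \<kappa>)"
  obtain c B C where f: "convex_on UNIV (L e)" "continuous_on UNIV (L e)" and c: "0 < c" and B: "0 \<le> B"
    and coercive: "\<And>w. c * (norm w)\<^sup>2 - B \<le> L e w" and growth: "\<And>w. \<bar>L e w\<bar> \<le> C * (1 + (norm w)\<^sup>2)"
    by (rule tonelli_fibre[OF L]) blast
  have inv: "right_invariant_lagrangian mul A L" using L by (simp add: tonelli_lagrangian_def)
  have inv': "right_invariant_lagrangian mul A L'"
    unfolding L'_def by (rule right_invariant_lagrangian_add[OF inv])
  have f': "convex_on UNIV (L' e)" "continuous_on UNIV (L' e)"
    unfolding L'_def using f by (auto intro!: convex_on_add continuous_intros simp: convex_on_const)
  have coercive': "c * (norm w)\<^sup>2 - (B + \<bar>\<kappa>\<bar>) \<le> L' e w" for w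
    using coercive[of w] by (simp add: L'_def)
  have growth': "\<bar>L' e w\<bar> \<le> (C + \<bar>\<kappa>\<bar>) * (1 + (norm w)\<^sup>2)" for w
  proof -
    have "\<bar>\<kappa>\<bar> \<le> \<bar>\<kappa>\<bar> * (1 + (norm w)\<^sup>2)" by (simp add: algebra_simps)
    then show ?thesis using growth[of w] unfolding L'_def distrib_right by linarith
  qed
  have act: "action A L' T \<gamma> = scaled_action (L' e) T (log_path T \<gamma>)" "log_path T \<gamma> \<in> S"
    if "(T, \<gamma>) \<in> paths A p q" for T \<gamma>
    using action_log_path[OF inv' f'(2) that] evol_log_path[OF reg that] log_path_in_L2[OF that]
    by (auto simp: S_def scaled_action_def)
  have lift: "\<exists>\<gamma>. (T, \<gamma>) \<in> paths A p q \<and> action A L' T \<gamma> = scaled_action (L' e) T \<xi>"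
    if T: "0 < T" and \<xi>: "\<xi> \<in> S" for T \<xi>
  proof -
    have \<xi>': "\<xi> \<in> Lp 2 0 1" "evol mul e A \<xi> = q \<odot> iv p" using \<xi> by (auto simp: S_def)
    obtain \<gamma> where \<gamma>: "(T, \<gamma>) \<in> paths A p q" "AE t in lebesgue_on {0..1}. log_path T \<gamma> t = \<xi> t"
      by (rule path_from_L2[OF reg T \<xi>']) blast
    have "scaled_action (L' e) T (log_path T \<gamma>) = scaled_action (L' e) T \<xi>"
      unfolding scaled_action_def
    proof (rule arg_cong[where f="\<lambda>y. T * y"], rule integral_cong_AE_interval)
      show "(\<lambda>t. L' e (log_path T \<gamma> t /\<^sub>R T)) \<in> borel_measurable (lebesgue_on {0..1})"
        by (rule borel_measurable_continuous_strongly[OF f'(2)]) (intro strongly_measurable_scaleR LpD(1)[OF log_path_in_L2[OF \<gamma>(1)]])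
      show "AE t in lebesgue_on {0..1}. L' e (log_path T \<gamma> t /\<^sub>R T) = L' e (\<xi> t /\<^sub>R T)"
        using \<gamma>(2) by eventually_elim simp
    qed
    then show ?thesis using \<gamma>(1) act(1)[OF \<gamma>(1)] by auto
  qed
  obtain T1 \<gamma>1 where \<gamma>1: "(T1, \<gamma>1) \<in> paths A p q"
    using paths_nonempty_if_connected[OF smooth_atlas conn] by blast
  obtain T2 \<gamma>2 where \<gamma>2: "(T2, \<gamma>2) \<in> paths A q p"
    using paths_nonempty_if_connected[OF smooth_atlas connected_component_sym[OF conn]] by blast
  obtain \<kappa>0 where \<kappa>0: "\<kappa>0 < \<kappa>" "\<And>T \<gamma> x. (T, \<gamma>) \<in> paths A x x \<Longrightarrow> - \<kappa>0 * T \<le> action A L T \<gamma>"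
    by (rule closed_curve_action_lower_bound[OF \<kappa>]) blast
  have add: "action A L' T \<gamma> = action A L T \<gamma> + \<kappa> * T" if \<gamma>: "(T, \<gamma>) \<in> paths A p q" for T \<gamma>
  proof -
    have T: "0 \<le> T" "W1p_curve 2 A {0..T} \<gamma>" using \<gamma> by (auto simp: paths_def)
    have "integrable (lebesgue_on {0..T}) (\<lambda>t. L e (rlog \<gamma> t))"
      by (rule integrable_quadratic_growth[OF f(2) growth rlog_in_L2[OF T(2,1)]])
    then show ?thesis
      unfolding action_rlog[OF inv' f'(2) T(2,1)] action_rlog[OF inv f(2) T(2,1)] using T(1)
      by (simp add: L'_def measure_restrict_space)
  qed
  \<comment> \<open>closing a path from \<open>p\<close> to \<open>q\<close> by the fixed path back shows that long paths are expensive\<close>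
  define D where "D = \<kappa>0 * T2 + action A L T2 \<gamma>2"
  have proper: "(\<kappa> - \<kappa>0) * T - D \<le> scaled_action (L' e) T \<xi>" if T: "0 < T" and \<xi>: "\<xi> \<in> S" for T \<xi>
  proof -
    obtain \<gamma> where \<gamma>: "(T, \<gamma>) \<in> paths A p q" "action A L' T \<gamma> = scaled_action (L' e) T \<xi>"
      using lift[OF T \<xi>] by blast
    have "- \<kappa>0 * (T + T2) \<le> action A L T \<gamma> + action A L T2 \<gamma>2"
      using \<kappa>0(2)[OF concat_path_mem[OF \<gamma>(1) \<gamma>2]] action_concat_path[OF inv f(2) growth \<gamma>(1) \<gamma>2] by simp
    then show ?thesis using \<gamma>(2) add[OF \<gamma>(1)] by (simp add: D_def algebra_simps)
  qed
  have zero: "(\<lambda>t. 0) \<notin> S"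
  proof
    assume "(\<lambda>t. 0) \<in> S"
    then have "q \<odot> iv p = e" using evol_zero[OF reg] by (simp add: S_def)
    then have "q \<odot> iv p \<odot> p = p" by (simp add: left_neutral)
    then show False using pq by simp
  qed
  have "\<exists>T>0. \<exists>\<xi>\<in>S. \<forall>T'>0. \<forall>\<xi>'\<in>S. scaled_action (L' e) T \<xi> \<le> scaled_action (L' e) T' \<xi>'"
  proof (rule scaled_action_minimizer[OF _ _ zero f' c _ coercive' growth' _ proper])
    show "closedin L2_weak_topology S" using closed by (simp add: S_def)
    show "S \<noteq> {}" using act(2)[OF \<gamma>1] by blast
    show "0 \<le> B + \<bar>\<kappa>\<bar>" using B by simp
    show "0 < \<kappa> - \<kappa>0" using \<kappa>0(1) by simp
  qed
  then obtain T \<xi> where T: "0 < T" "\<xi> \<in> S"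
    and min: "\<And>T' \<xi>'. 0 < T' \<Longrightarrow> \<xi>' \<in> S \<Longrightarrow> scaled_action (L' e) T \<xi> \<le> scaled_action (L' e) T' \<xi>'" by blast
  obtain \<gamma> where \<gamma>: "(T, \<gamma>) \<in> paths A p q" "action A L' T \<gamma> = scaled_action (L' e) T \<xi>"
    using lift[OF T] by blast
  have least: "action A L' T \<gamma> \<le> action A L' T' \<eta>" if \<eta>: "(T', \<eta>) \<in> paths A p q" for T' \<eta>
  proof -
    have "0 < T'" using \<eta> by (simp add: paths_def)
    then show ?thesis using min[OF _ act(2)[OF \<eta>]] act(1)[OF \<eta>] \<gamma>(2) by simp
  qed
  have "(case (T, \<gamma>) of (T, \<gamma>) \<Rightarrow> ereal (action A L' T \<gamma>)) = (INF (S, \<eta>)\<in>paths A p q. ereal (action A L' S \<eta>))"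
  proof (rule antisym)
    show "(case (T, \<gamma>) of (T, \<gamma>) \<Rightarrow> ereal (action A L' T \<gamma>)) \<le> (INF (S, \<eta>)\<in>paths A p q. ereal (action A L' S \<eta>))"
      by (rule INF_greatest) (use least in auto)
    show "(INF (S, \<eta>)\<in>paths A p q. ereal (action A L' S \<eta>)) \<le> (case (T, \<gamma>) of (T, \<gamma>) \<Rightarrow> ereal (action A L' T \<gamma>))"
      by (rule INF_lower[OF \<gamma>(1)])
  qed
  then show ?thesis using \<gamma>(1) unfolding L'_def by (intro bexI[of _ "(T, \<gamma>)"]) auto
qed

end

theorem theorem1p3:
  fixes mul :: "'g::t2_space \<Rightarrow> 'g \<Rightarrow> 'g"
    and e :: 'g
    and iv :: "'g \<Rightarrow> 'g"
    and A :: "('g, 'e::{real_inner, complete_space}) chart set"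
    and \<G> :: "'g \<Rightarrow> 'e \<Rightarrow> 'e \<Rightarrow> real"
    and L :: "'g \<Rightarrow> 'e \<Rightarrow> real"
    and p q :: 'g
    and \<kappa> :: real
  assumes "half_lie_group mul e iv A"
    and "riemannian_metric A \<G>"
    and "strong_metric \<G>"
    and "right_invariant_metric mul e A \<G>"
    and "tonelli_lagrangian mul e A \<G> L"
    and "L2_regular mul e A"
    and "\<forall>x. closedin L2_weak_topology {\<xi> \<in> Lp 2 0 1. evol mul e A \<xi> = x}"
    and "connected_component UNIV p q"
    and "p \<noteq> q"
    and "mane_critical_value A L < ereal \<kappa>"
  shows "\<exists>(T, \<gamma>)\<in>paths A p q.
    ereal (action A (\<lambda>x v. L x v + \<kappa>) T \<gamma>) =
      (INF (S, \<eta>)\<in>paths A p q. ereal (action A (\<lambda>x v. L x v + \<kappa>) S \<eta>))"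
proof -
  interpret half_lie_group_metric mul e iv A \<G>
    using assms(1-4) by (intro half_lie_group_metric.intro half_lie_group_metric_axioms.intro)
  show ?thesis
    by (rule global_minimizer_exists[OF assms(5,6) spec[OF assms(7)] assms(8-10)])
qed

end
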